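(* The Riemann hypothesis is true if and only if $\Psi(t)=O(1)$ on $[0,\infty)$, i.e. $\Psi$ is bounded on $[0,\infty)$.
   Context: $\xi(s)=\frac12 s(s-1)\pi^{-s/2}\Gamma(s/2)\zeta(s)$; the Riemann hypothesis asserts all zeros of $\xi$ lie on $\Re(s)=1/2$. $\Lambda$ is the von Mangoldt function, $G$ is Catalan's constant, $C=\pi^2+8G$, $\Phi(z,s,a)=\sum_{n\ge0}(n+a)^{-s}z^n$. For $t\ge0$, \[\Psi(t):=4(e^{t/2}+e^{-t/2}-2)-\sum_{n\le e^t}\frac{\Lambda(n)}{\sqrt n}(t-\log n)+\frac t2\Big[\frac{\Gamma'}{\Gamma}\Big(\frac14\Big)-\log\pi\Big]+\frac14\Big(C-e^{-t/2}\Phi(e^{-2t},2,1/4)\Big).\] *)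

theory Defs
  imports "HOL-Complex_Analysis.Complex_Analysis" "HOL-Number_Theory.Prime_Powers"
begin

(* The analytic continuation of the Dirichlet series to the plane minus 1.  By the identity
   theorem it is unique; the value 0 at the pole is a convention that makes the total function
   unique as well. *)
definition riemann_zeta :: "complex \<Rightarrow> complex" where
  "riemann_zeta = (THE f. f holomorphic_on (- {1}) \<and>
     (\<forall>s. Re s > 1 \<longrightarrow> (\<lambda>n. of_nat (Suc n) powr (- s)) sums f s) \<and> f 1 = 0)"

(* The defining product has removable singularities at 1, 0, -2, -4, ...  Evaluated pointwise
   with the library's totalised Gamma (zero at its poles) it would have spurious zeros there;
   remove_sings yields the entire function. *)
definition riemann_xi :: "complex \<Rightarrow> complex" where
  "riemann_xi = remove_sings (\<lambda>s. 1 / 2 * s * (s - 1) * of_real pi powr (- s / 2) *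
     Gamma (s / 2) * riemann_zeta s)"

definition riemann_hypothesis :: bool where
  "riemann_hypothesis \<longleftrightarrow> (\<forall>s. riemann_xi s = 0 \<longrightarrow> Re s = 1 / 2)"

definition catalan_constant :: real where
  "catalan_constant = (\<Sum>k. (- 1) ^ k / (2 * real k + 1) ^ 2)"

(* Real parameters only.  The formula is meaningful for a > 0 where the series converges,
   e.g. for 0 <= z < 1, or z = 1 and s > 1. *)
definition lerch_phi :: "real \<Rightarrow> real \<Rightarrow> real \<Rightarrow> real" where
  "lerch_phi z s a = (\<Sum>n. (real n + a) powr (- s) * z ^ n)"

(* Digamma is the logarithmic derivative of Gamma. *)
definition Psi :: "real \<Rightarrow> real" where
  "Psi t = 4 * (exp (t / 2) + exp (- t / 2) - 2)
     - (\<Sum>n | 1 \<le> n \<and> real n \<le> exp t. mangoldt n / sqrt (real n) * (t - ln (real n)))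
     + t / 2 * (Digamma (1 / 4) - ln pi)
     + 1 / 4 * ((pi\<^sup>2 + 8 * catalan_constant)
         - exp (- t / 2) * lerch_phi (exp (- 2 * t)) 2 (1 / 4))"

end

theory Submission
  imports Defs "HOL-Probability.Probability" "HOL-Real_Asymp.Real_Asymp"
begin

text \<open>
  For real \<open>w > 1/2\<close> the Laplace transform of \<open>Psi\<close> at \<open>w\<close> is, up to a term \<open>c / w\<close>, equal to
  \<open>w\<^sup>-\<^sup>2 (\<xi>' / \<xi>) (1/2 + w)\<close>.

  If \<open>Psi\<close> is bounded, its transform is holomorphic for \<open>Re w > 0\<close>, so there \<open>A w = \<xi> (1/2 + w)\<close>
  satisfies a differential equation \<open>A' = G A\<close> with holomorphic \<open>G\<close> and has no zeros; the functional
  equation \<open>\<xi> s = \<xi> (1 - s)\<close> does the rest.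

  Conversely, \<open>\<xi> (1/2 + w)\<close> is an entire function of \<open>w\<^sup>2\<close>, of order less than one, whose zeros under the Riemann
  hypothesis are negative numbers \<open>- \<rho>\<close>. The partial sums \<open>\<Sum>\<rho>. 2 (1 - cos (\<surd>\<rho> t)) / \<rho>\<close> take values in a
  fixed interval \<open>[0, 4 K]\<close>, and their Laplace transforms converge to that of \<open>Psi + c\<close> at every
  positive integer. Since continuous functions are limits of polynomials in \<open>exp (- t)\<close>, the function
  \<open>Psi + c\<close> takes values in the same interval.
\<close>

section \<open>Poisson summation for the Gaussian\<close>

text \<open>The trigonometric sums of the converse are the explicit formula in disguise. Under the
  hypothesis, with \<open>\<rho>\<close> = gamma^2, \<open>Psi\<close> plus a constant should be the
  sum of 2 (1 - cos (gamma t)) / gamma^2 over the positive ordinates gamma, and one summand has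
  transform 2 / (w (w^2 + \<open>\<rho>\<close>)). Proving that expansion would require convergence
  in t; comparing transforms requires convergence only at fixed w. The price is that signs must be
  recovered from transforms: polynomials in \<open>exp (- t)\<close> against the weight
  \<open>exp (- t)\<close> involve only the transform at integers k >= 1, all in the range w > 1/2
  where that of \<open>Psi\<close> is known. Most integrals and sums are evaluated at real
  arguments, where terms are nonnegative and exchanges are justified by positivity; complex
  arguments are reached through power series or the identity theorem. In the other direction the
  obstacle is that xi cannot be divided by where its zeros are in question, hence the product form
  of the differential equation.\<close>

text \<open>One integration by parts gains a factor 1 / l: sin (l u) has the antiderivative - cos (l
  u) / l, and p' is again bounded on the interval.\<close>

lemma riemann_lebesgue_polynomial:
  fixes p :: "real \<Rightarrow> real" and a b :: real
  assumes p: "real_polynomial_function p" and ab: "a \<le> b"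
  shows "((\<lambda>l. integral {a..b} (\<lambda>u. p u * sin (l * u))) \<longlongrightarrow> 0) at_top"
proof -
  from p obtain p' where p': "real_polynomial_function p'" "\<And>x. (p has_real_derivative p' x) (at x)"
    using has_real_derivative_polynomial_function by blast
  have cp: "continuous_on S p" and cp': "continuous_on S p'" for S
    using p p' continuous_on_polymonial_function real_polynomial_function_eq by auto
  obtain B where B: "\<And>x. x \<in> {a..b} \<Longrightarrow> \<bar>p x\<bar> \<le> B"
    using compact_continuous_image[OF cp compact_Icc, THEN compact_imp_bounded]
    by (force simp: bounded_iff)
  obtain B' where B': "\<And>x. x \<in> {a..b} \<Longrightarrow> \<bar>p' x\<bar> \<le> B'"
    using compact_continuous_image[OF cp' compact_Icc, THEN compact_imp_bounded]
    by (force simp: bounded_iff)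
  define K where "K = 2 * B + B' * (b - a)"
  have bound: "norm (integral {a..b} (\<lambda>u. p u * sin (l * u))) \<le> K / l" if l: "l > 0" for l
  proof -
    define I where "I = integral {a..b} (\<lambda>u. - cos (l * u) / l * p' u)"
    have "((\<lambda>u. sin (l * u) * p u) has_integral
        (- cos (l*b)/l * p b - (- cos (l * a)/l) * p a - I)) {a..b}"
    proof (rule integration_by_parts[OF bounded_bilinear_mult ab, where g=p and g'=p' and f="\<lambda>u. - cos (l*u)/l" and f'="\<lambda>u. sin (l*u)"])
      show "continuous_on {a..b} (\<lambda>u. - cos (l * u) / l)" using l by (intro continuous_intros) auto
      show "(p has_vector_derivative p' x) (at x)" for x
        using p'(2)[of x] by (simp add: has_real_derivative_iff_has_vector_derivative)
      show "((\<lambda>u. - cos (l * u) / l) has_vector_derivative sin (l * x)) (at x)" for x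
        unfolding has_real_derivative_iff_has_vector_derivative[symmetric]
        using l by (auto intro!: derivative_eq_intros)
      have "((\<lambda>x. - cos (l * x) / l * p' x) has_integral I) {a..b}"
        unfolding I_def using l by (intro integrable_integral integrable_continuous_interval continuous_intros cp') auto
      thus "((\<lambda>x. - cos (l * x) / l * p' x) has_integral
          (- cos (l*b)/l * p b - (- cos (l * a)/l) * p a -
            (- cos (l*b)/l * p b - (- cos (l * a)/l) * p a - I))) {a..b}"
        by simp
    qed (auto intro: cp)
    hence eq: "integral {a..b} (\<lambda>u. p u * sin (l * u)) = 
        p b * (- cos (l*b)/l) - p a * (- cos (l * a)/l) - I"
      by (simp add: integral_unique mult.commute)
    have 1: "\<bar>p x * (- cos (l*x)/l)\<bar> \<le> B / l" if "x \<in> {a..b}" for x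
    proof -
      have "\<bar>p x\<bar> * \<bar>cos (l*x)\<bar> \<le> B * 1"
        using B[OF that] by (intro mult_mono) auto
      thus ?thesis using l by (simp add: abs_mult divide_right_mono)
    qed
    have 2: "norm (p' x * (- cos (l*x)/l)) \<le> B' / l" if "x \<in> {a..b}" for x
    proof -
      have "\<bar>p' x\<bar> * \<bar>cos (l*x)\<bar> \<le> B' * 1"
        using B'[OF that] by (intro mult_mono) auto
      thus ?thesis using l by (simp add: abs_mult divide_right_mono)
    qed
    have 3: "norm I \<le> B' / l * (b - a)"
      unfolding I_def
      by (rule integral_bound[OF ab]) (use 2 l in \<open>auto intro!: continuous_intros cp' simp: mult.commute\<close>)
    have 4: "K / l = B/l + B/l + B'/l * (b-a)"
      using l by (simp add: K_def field_simps)
    have *: "\<bar>X - Y - I\<bar> \<le> B/l + B/l + B'/l*(b-a)" if "\<bar>X\<bar> \<le> B/l" "\<bar>Y\<bar> \<le> B/l" for X Y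
      using that 3 unfolding real_norm_def by linarith
    show ?thesis unfolding 4 eq real_norm_def
      using ab by (intro * 1) auto
  qed
  have "((\<lambda>l. K / l) \<longlongrightarrow> 0) at_top" by real_asymp
  thus ?thesis
    by (rule Lim_null_comparison[rotated]) (use bound in \<open>auto intro!: eventually_mono[OF eventually_gt_at_top[of 0]]\<close>)
qed

text \<open>Density of polynomials: replacing \<open>q\<close> by a polynomial within
  \<open>d\<close> changes the integral by at most \<open>d * (b - a)\<close>, uniformly in
  l.\<close>

lemma riemann_lebesgue:
  fixes q :: "real \<Rightarrow> real" and a b :: real
  assumes q: "continuous_on {a..b} q" and ab: "a \<le> b"
  shows "((\<lambda>l. integral {a..b} (\<lambda>u. q u * sin (l * u))) \<longlongrightarrow> 0) at_top"
proof (rule tendstoI)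
  fix e :: real assume e: "e > 0"
  define d where "d = e / (2 * (b - a + 1))"
  have d: "d > 0" "d * (b - a) \<le> e / 2" using e ab by (auto simp: d_def field_simps)
  obtain p where p: "real_polynomial_function p" "\<And>x. x \<in> {a..b} \<Longrightarrow> \<bar>q x - p x\<bar> < d"
    using Stone_Weierstrass_real_polynomial_function[OF compact_Icc q d(1)] by blast
  have cp: "continuous_on S p" for S
    using p continuous_on_polymonial_function real_polynomial_function_eq by auto
  have "eventually (\<lambda>l. dist (integral {a..b} (\<lambda>u. p u * sin (l * u))) 0 < e / 2) at_top"
    using riemann_lebesgue_polynomial[OF p(1) ab] e by (intro tendstoD) auto
  thus "eventually (\<lambda>l. dist (integral {a..b} (\<lambda>u. q u * sin (l * u))) 0 < e) at_top"
  proof eventually_elim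
    case (elim l)
    have "norm (integral {a..b} (\<lambda>u. (q u - p u) * sin (l * u))) \<le> d * (b - a)"
    proof (rule integral_bound[OF ab])
      show "continuous_on {a..b} (\<lambda>u. (q u - p u) * sin (l * u))"
        by (intro continuous_intros q cp)
      fix t assume t: "t \<in> {a..b}"
      have "\<bar>q t - p t\<bar> * \<bar>sin (l * t)\<bar> \<le> d * 1"
        using p(2)[OF t] by (intro mult_mono) auto
      thus "norm ((q t - p t) * sin (l * t)) \<le> d" by (simp add: abs_mult)
    qed
    also have "integral {a..b} (\<lambda>u. (q u - p u) * sin (l * u)) =
      integral {a..b} (\<lambda>u. q u * sin (l * u)) - integral {a..b} (\<lambda>u. p u * sin (l * u))"
      by (subst integral_diff[symmetric])
         (auto intro!: integrable_continuous_interval continuous_intros q cp simp: algebra_simps)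
    finally show ?case using d(2) elim by (simp add: dist_real_def)
  qed
qed

section \<open>The Dirichlet kernel\<close>

text \<open>The sum of exp (2 pi i k u) over |k| <= N, of period 1; integrating a function against
  it over a cell of length 1 gives a symmetric partial sum of its Fourier series at the
  centre.\<close>

definition dirichlet_kernel :: "nat \<Rightarrow> real \<Rightarrow> real" where
  "dirichlet_kernel N u = 1 + 2 * (\<Sum>k=1..N. cos (2 * pi * real k * u))"

lemma sin_times_dirichlet_kernel:
  "sin (pi * u) * dirichlet_kernel N u = sin ((2 * real N + 1) * pi * u)"
proof (induction N)
  case (Suc N)
  have "sin (pi * u) * dirichlet_kernel (Suc N) u =
     sin ((2 * real N + 1) * pi * u) + 2 * sin (pi * u) * cos (2 * pi * real (Suc N) * u)"
    using Suc by (simp add: dirichlet_kernel_def algebra_simps)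
  also have "2 * sin (pi * u) * cos (2 * pi * real (Suc N) * u) =
     sin (pi * u + 2 * pi * real (Suc N) * u) - sin (2 * pi * real (Suc N) * u - pi * u)"
    by (simp add: sin_add sin_diff)
  also have "pi * u + 2 * pi * real (Suc N) * u = (2 * real (Suc N) + 1) * pi * u"
    by (simp add: algebra_simps)
  also have "2 * pi * real (Suc N) * u - pi * u = (2 * real N + 1) * pi * u"
    by (simp add: algebra_simps)
  finally show ?case by simp
qed (simp add: dirichlet_kernel_def)

lemma continuous_on_dirichlet_kernel [continuous_intros]: "continuous_on S (dirichlet_kernel N)"
  unfolding dirichlet_kernel_def by (intro continuous_intros)

lemma dirichlet_kernel_shift: "dirichlet_kernel N (real n + u) = dirichlet_kernel N u"
proof -
  have "cos (2 * pi * real k * (real n + u)) = cos (2 * pi * real k * u)" for k :: nat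
  proof -
    have "2 * pi * real k * (real n + u) = 2 * pi * real k * u + 2 * pi * real (k * n)"
      by (simp add: algebra_simps)
    moreover have "cos (2 * pi * real (k * n)) = 1" "sin (2 * pi * real (k * n)) = 0"
      by (metis cos_2npi mult.assoc mult.commute, metis sin_2npi mult.assoc mult.commute)
    ultimately show ?thesis by (simp only: cos_add)
  qed
  thus ?thesis by (simp add: dirichlet_kernel_def)
qed

text \<open>Sine is concave on [0, pi/2] and so lies above its chord, which for the argument pi u is
  2 u.\<close>

lemma abs_sin_pi_ge:
  assumes "\<bar>u\<bar> \<le> 1 / 2"
  shows "\<bar>sin (pi * u)\<bar> \<ge> 2 * \<bar>u\<bar>"
proof -
  have *: "sin (pi * v) \<ge> 2 * v" if "0 \<le> v" "v \<le> 1/2" for v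
  proof -
    have "convex_on {0..pi/2} (\<lambda>x. - sin x)"
    proof (rule f''_ge0_imp_convex)
      show "((\<lambda>x. - sin x) has_real_derivative (- cos x)) (at x)" for x :: real
        by (auto intro!: derivative_eq_intros)
      show "((\<lambda>x. - cos x) has_real_derivative (sin x)) (at x)" for x :: real
        by (auto intro!: derivative_eq_intros)
      show "sin x \<ge> 0" if "x \<in> {0..pi/2}" for x :: real
        using that by (intro sin_ge_zero) auto
    qed auto
    from convex_onD[OF this, of "2 * v" 0 "pi / 2"] that show ?thesis
      by (simp add: mult.commute)
  qed
  show ?thesis using *[of "\<bar>u\<bar>"] assms
    by (cases "u \<ge> 0") (auto simp: abs_if)
qed

lemma integral_dirichlet_kernel: "integral {-1/2..1/2} (dirichlet_kernel N) = 1"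
proof -
  have "((\<lambda>u. 1 + 2 * (\<Sum>k=1..N. cos (2 * pi * real k * u))) has_integral 
     ((1/2) + 2 * (\<Sum>k=1..N. sin (2 * pi * real k * (1/2)) / (2*pi*real k))) -
     ((-1/2) + 2 * (\<Sum>k=1..N. sin (2 * pi * real k * (-1/2)) / (2*pi*real k)))) {-1/2..1/2}"
    by (rule fundamental_theorem_of_calculus)
       (auto simp flip: has_real_derivative_iff_has_vector_derivative intro!: derivative_eq_intros sum.cong)
  moreover have "sin (2 * pi * real k * (1/2)) = 0" "sin (2 * pi * real k * (-1/2)) = 0" for k
    by (simp_all add: mult.commute[of pi])
  ultimately have "((\<lambda>u. 1 + 2 * (\<Sum>k=1..N. cos (2 * pi * real k * u))) has_integral 1) {-1/2..1/2}"
    by simp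
  thus ?thesis by (simp add: dirichlet_kernel_def[abs_def] integral_unique)
qed

lemma dirichlet_kernel_integral_diff:
  fixes g :: "real \<Rightarrow> real"
  assumes "continuous_on {-1/2..1/2} g"
  shows "integral {-1/2..1/2} (\<lambda>u. g u * dirichlet_kernel N u) - g 0 =
         integral {-1/2..1/2} (\<lambda>u. (g u - g 0) * dirichlet_kernel N u)"
proof -
  have "integral {-1/2..1/2} (\<lambda>u. (g u - g 0) * dirichlet_kernel N u) = 
     integral {-1/2..1/2} (\<lambda>u. g u * dirichlet_kernel N u) - integral {-1/2..1/2} (\<lambda>u. g 0 * dirichlet_kernel N u)"
    by (subst integral_diff[symmetric])
       (use assms in \<open>auto intro!: integrable_continuous_interval continuous_intros simp: algebra_simps\<close>)
  thus ?thesis using integral_dirichlet_kernel[of N] by simp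
qed

text \<open>Off 0 the kernel is at most 1 / |sin (pi u)| <= 1 / (2 |u|), and the Lipschitz factor
  |u| cancels this. The bound is independent of N, so it can serve as a dominating term when N tends
  to infinity.\<close>

lemma dirichlet_kernel_bound:
  fixes g :: "real \<Rightarrow> real"
  assumes cont: "continuous_on {-1/2..1/2} g"
    and lip: "\<And>u. \<bar>u\<bar> \<le> 1/2 \<Longrightarrow> \<bar>g u - g 0\<bar> \<le> L * \<bar>u\<bar>"
  shows "\<bar>integral {-1/2..1/2} (\<lambda>u. g u * dirichlet_kernel N u) - g 0\<bar> \<le> L / 2"
proof -
  have "norm (integral {-1/2..1/2} (\<lambda>u. (g u - g 0) * dirichlet_kernel N u)) \<le> L / 2 * (1/2 - (-1/2))"
  proof (rule integral_bound)
    show "continuous_on {-1/2..1/2} (\<lambda>u. (g u - g 0) * dirichlet_kernel N u)"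
      by (intro continuous_intros cont)
    fix t :: real assume "t \<in> {-1/2..1/2}"
    hence t: "\<bar>t\<bar> \<le> 1/2" by auto
    show "norm ((g t - g 0) * dirichlet_kernel N t) \<le> L / 2"
    proof (cases "t = 0")
      case True
      have "0 \<le> L * \<bar>1/2\<bar>" using lip[of "1/2"] by linarith
      thus ?thesis using True by simp
    next
      case False
      have "\<bar>sin (pi * t)\<bar> * \<bar>dirichlet_kernel N t\<bar> \<le> 1"
        by (subst abs_mult[symmetric], subst sin_times_dirichlet_kernel) simp
      hence "2 * \<bar>t\<bar> * \<bar>dirichlet_kernel N t\<bar> \<le> 1"
        using mult_right_mono[OF abs_sin_pi_ge[OF t], of "\<bar>dirichlet_kernel N t\<bar>"] by simp
      hence "\<bar>dirichlet_kernel N t\<bar> \<le> 1 / (2 * \<bar>t\<bar>)" using False by (simp add: field_simps)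
      hence "\<bar>g t - g 0\<bar> * \<bar>dirichlet_kernel N t\<bar> \<le> (L * \<bar>t\<bar>) * (1 / (2 * \<bar>t\<bar>))"
        using lip[OF t] by (intro mult_mono) auto
      also have "\<dots> = L / 2" using False by simp
      finally show ?thesis by (simp add: abs_mult)
    qed
  qed auto
  thus ?thesis by (subst dirichlet_kernel_integral_diff[OF cont]) simp
qed

text \<open>
  Chernoff's argument: \<open>(g u - g 0) / sin (\<pi> u)\<close> extends continuously to \<open>u = 0\<close>, and multiplying
  it by \<open>sin ((2 N + 1) \<pi> u)\<close> gives \<open>(g u - g 0)\<close> times the Dirichlet kernel.
\<close>

lemma dirichlet_kernel_tendsto:
  fixes g :: "real \<Rightarrow> real"
  assumes cont: "continuous_on {-1/2..1/2} g"
    and deriv: "(g has_real_derivative g') (at 0)"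
  shows "(\<lambda>N. integral {-1/2..1/2} (\<lambda>u. g u * dirichlet_kernel N u)) \<longlonglongrightarrow> g 0"
proof -
  define q where "q u = (if u = 0 then g' / pi else (g u - g 0) / sin (pi * u))" for u
  have nz: "sin (pi * u) \<noteq> 0" if "u \<noteq> 0" "\<bar>u\<bar> \<le> 1/2" for u
    using abs_sin_pi_ge[OF that(2)] that by auto
  have lim: "((\<lambda>u. (g u - g 0) / sin (pi * u)) \<longlongrightarrow> g' / pi) (at 0)"
  proof -
    have "((\<lambda>u. (g u - g 0) / u) \<longlongrightarrow> g') (at 0)" using deriv by (simp add: has_field_derivative_iff)
    moreover have "((\<lambda>u. sin (pi * u) / u) \<longlongrightarrow> pi) (at 0)"
    proof -
      have "((\<lambda>u. sin (pi * u)) has_real_derivative pi) (at 0)"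
        by (auto intro!: derivative_eq_intros)
      thus ?thesis by (simp add: has_field_derivative_iff)
    qed
    ultimately have "((\<lambda>u. ((g u - g 0) / u) / (sin (pi * u) / u)) \<longlongrightarrow> g' / pi) (at 0)"
      by (intro tendsto_intros) auto
    moreover have "eventually (\<lambda>u. ((g u - g 0) / u) / (sin (pi * u) / u) = (g u - g 0) / sin (pi * u)) (at (0::real))"
      using eventually_neq_at_within[of 0] by eventually_elim auto
    ultimately show ?thesis using tendsto_cong by fast
  qed
  have contq: "continuous_on {-1/2..1/2} q"
    unfolding continuous_on_eq_continuous_within
  proof
    fix x :: real assume x: "x \<in> {-1/2..1/2}"
    show "continuous (at x within {-1/2..1/2}) q"
    proof (cases "x = 0")
      case True
      have "((\<lambda>u. (g u - g 0) / sin (pi * u)) \<longlongrightarrow> g' / pi) (at 0 within {-1/2..1/2})"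
        using lim by (rule tendsto_mono[OF at_le, rotated]) auto
      moreover have "eventually (\<lambda>u. (g u - g 0) / sin (pi * u) = q u) (at 0 within {-1/2..1/2})"
        using eventually_neq_at_within[of 0] by eventually_elim (auto simp: q_def)
      ultimately have "(q \<longlongrightarrow> g' / pi) (at 0 within {-1/2..1/2})"
        using tendsto_cong by fast
      thus ?thesis using True by (simp add: continuous_within q_def)
    next
      case False
      have c: "continuous (at x within {-1/2..1/2}) (\<lambda>u. (g u - g 0) / sin (pi * u))"
      proof -
        have "\<bar>x\<bar> \<le> 1/2" using x by auto
        thus ?thesis
          using cont x nz[OF False] by (intro continuous_intros) (auto simp: continuous_on_eq_continuous_within)
      qed
      have "eventually (\<lambda>u. u \<noteq> 0) (at x within {-1/2..1/2})"
        using False tendsto_imp_eventually_ne[of "\<lambda>u. u" x "at x within {-1/2..1/2}" 0] by (simp add: tendsto_ident_at)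
      hence ev: "eventually (\<lambda>u. (g u - g 0) / sin (pi * u) = q u) (at x within {-1/2..1/2})"
        by eventually_elim (auto simp: q_def)
      from c have "((\<lambda>u. (g u - g 0) / sin (pi * u)) \<longlongrightarrow> q x) (at x within {-1/2..1/2})"
        using False by (simp add: continuous_within q_def)
      hence "(q \<longlongrightarrow> q x) (at x within {-1/2..1/2})"
        using tendsto_cong[OF ev] by simp
      thus ?thesis by (simp add: continuous_within)
    qed
  qed
  have "((\<lambda>l. integral {-1/2..1/2} (\<lambda>u. q u * sin (l * u))) \<longlongrightarrow> 0) at_top"
    by (rule riemann_lebesgue[OF contq]) auto
  hence "(\<lambda>N. integral {-1/2..1/2} (\<lambda>u. q u * sin (((2 * real N + 1) * pi) * u))) \<longlonglongrightarrow> 0"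
    by (rule filterlim_compose) real_asymp
  also have "(\<lambda>N. integral {-1/2..1/2} (\<lambda>u. q u * sin (((2 * real N + 1) * pi) * u))) =
    (\<lambda>N. integral {-1/2..1/2} (\<lambda>u. g u * dirichlet_kernel N u) - g 0)"
  proof
    fix N
    have "integral {-1/2..1/2} (\<lambda>u. q u * sin (((2 * real N + 1) * pi) * u)) = 
          integral {-1/2..1/2} (\<lambda>u. (g u - g 0) * dirichlet_kernel N u)"
    proof (rule integral_cong)
      fix u :: real assume "u \<in> {-1/2..1/2}"
      hence "\<bar>u\<bar> \<le> 1/2" by auto
      thus "q u * sin ((2 * real N + 1) * pi * u) = (g u - g 0) * dirichlet_kernel N u"
        using nz[of u] by (subst sin_times_dirichlet_kernel[symmetric]) (auto simp: q_def)
    qed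
    thus "integral {-1/2..1/2} (\<lambda>u. q u * sin (((2 * real N + 1) * pi) * u)) =
      integral {-1/2..1/2} (\<lambda>u. g u * dirichlet_kernel N u) - g 0"
      using dirichlet_kernel_integral_diff[OF cont] by simp
  qed
  finally show ?thesis using LIM_zero_iff by blast
qed

section \<open>Fourier transform of the Gaussian and summation over unit cells\<close>

text \<open>The characteristic function of the standard normal law, rescaled.\<close>

lemma gaussian_integral_cos:
  fixes a t :: real
  assumes a: "a > 0"
  shows "integrable lborel (\<lambda>u. exp (- a * u\<^sup>2) * cos (t * u))"
    and "(LINT u|lborel. exp (- a * u\<^sup>2) * cos (t * u)) = sqrt (pi / a) * exp (- (t\<^sup>2) / (4 * a))"
proof -
  have int: "integrable lborel (\<lambda>x. std_normal_density x *\<^sub>R exp (\<i> * complex_of_real (s * x)))" for s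
  proof (rule Bochner_Integration.integrable_bound)
    show "integrable lborel std_normal_density" by simp
    show "AE x in lborel. norm (std_normal_density x *\<^sub>R exp (\<i> * complex_of_real (s * x))) \<le> norm (std_normal_density x)"
      by (simp add: norm_exp_i_times[of "s * x" for x, simplified])
  qed simp
  have eq: "(LINT x|lborel. std_normal_density x *\<^sub>R exp (\<i> * complex_of_real (s * x))) = complex_of_real (exp (- (s^2) / 2))" for s
  proof -
    have "(LINT x|lborel. std_normal_density x *\<^sub>R exp (\<i> * complex_of_real (s * x))) = char std_normal_distribution s"
      unfolding char_def by (subst integral_density) (auto simp: mult.commute)
    thus ?thesis by (simp add: char_std_normal_distribution)
  qed
  have Re: "Re (std_normal_density x *\<^sub>R exp (\<i> * complex_of_real (s * x))) = std_normal_density x * cos (s * x)" for s x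
    by (simp add: Re_exp)
  have int2: "integrable lborel (\<lambda>x. std_normal_density x * cos (s * x))" for s
    using integrable_Re[OF int[of s]] unfolding Re .
  have eq2: "(LINT x|lborel. std_normal_density x * cos (s * x)) = exp (- (s^2) / 2)" for s
    using integral_Re[OF int[of s]] unfolding Re eq by simp
  \<comment> \<open>Chosen so that (c u)^2 / 2 = a u^2.\<close>
  define c where "c = sqrt (2 * a)"
  have c: "c > 0" "c\<^sup>2 = 2 * a" using a by (auto simp: c_def)
  have dens: "std_normal_density (c * u) * cos (t / c * (c * u)) = (1 / sqrt (2 * pi)) * (exp (- a * u\<^sup>2) * cos (t * u))" for u
    using c by (simp add: std_normal_density_def power_mult_distrib)
  have int3: "integrable lborel (\<lambda>u. (1 / sqrt (2 * pi)) * (exp (- a * u\<^sup>2) * cos (t * u)))"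
    using lborel_integrable_real_affine[OF int2[of "t / c"], of c 0] c unfolding dens[symmetric] by simp
  thus "integrable lborel (\<lambda>u. exp (- a * u\<^sup>2) * cos (t * u))"
    by (simp add: integrable_mult_right_iff del: times_divide_eq_left times_divide_eq_right)
  have "exp (- ((t/c)^2) / 2) = c * (LINT u|lborel. std_normal_density (c * u) * cos (t / c * (c * u)))"
    unfolding eq2[of "t / c", symmetric]
    using lborel_integral_real_affine[of c "\<lambda>x. std_normal_density x * cos (t / c * x)" 0] c
    by simp
  also have "\<dots> = c * ((1 / sqrt (2 * pi)) * (LINT u|lborel. exp (- a * u\<^sup>2) * cos (t * u)))"
    unfolding dens by simp
  also have "- ((t/c)^2) / 2 = - (t\<^sup>2) / (4 * a)" using c by (simp add: power_divide)
  finally have "(LINT u|lborel. exp (- a * u\<^sup>2) * cos (t * u)) = sqrt (2 * pi) / c * exp (- (t\<^sup>2) / (4 * a))"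
    using c by (simp add: field_simps)
  also have "sqrt (2 * pi) / c = sqrt (pi / a)"
    using a by (simp add: c_def real_sqrt_divide[symmetric])
  finally show "(LINT u|lborel. exp (- a * u\<^sup>2) * cos (t * u)) = sqrt (pi / a) * exp (- (t\<^sup>2) / (4 * a))" .
qed

text \<open>The line is cut into unit cells centred at the integers; evenness merges the cells
  around n and - n, whence the factor 2 and the separate cell at 0.\<close>

lemma integral_whole_line_split:
  fixes f :: "real \<Rightarrow> real"
  assumes cont: "continuous_on UNIV f" and int: "integrable lborel f" and even: "\<And>x. f (- x) = f x"
  shows "(\<lambda>n. 2 * integral {-1/2..1/2} (\<lambda>u. f (real (Suc n) + u))) sums
           ((LINT u|lborel. f u) - integral {-1/2..1/2} f)"
proof -
  have ii: "f integrable_on {a..b}" for a b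
    by (intro integrable_continuous_interval continuous_on_subset[OF cont]) auto
  have shift: "integral {-1/2..1/2} (\<lambda>u. f (real n + u)) = integral {real n - 1/2..real n + 1/2} f" for n
  proof -
    have "continuous_on {-1/2 + real n..1/2 + real n} f" by (rule continuous_on_subset[OF cont]) auto
    from integral_shift[OF this] show ?thesis by (simp add: o_def add.commute)
  qed
  have refl: "integral {-b..-a} f = integral {a..b} f" for a b
    using Henstock_Kurzweil_Integration.integral_reflect_real[of b a f] by (simp add: even)
  have partial: "(\<Sum>n<M. 2 * integral {-1/2..1/2} (\<lambda>u. f (real (Suc n) + u))) =
        integral {-(real M + 1/2)..real M + 1/2} f - integral {-1/2..1/2} f" for M
  proof (induction M)
    case (Suc M)
    have 1: "integral {-(real M + 3/2)..-(real M + 1/2)} f + integral {-(real M + 1/2)..real M + 3/2} f = 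
       integral {-(real M + 3/2)..real M + 3/2} f"
      by (rule Henstock_Kurzweil_Integration.integral_combine) (auto intro: ii)
    have 2: "integral {-(real M + 1/2)..real M + 1/2} f + integral {real M + 1/2..real M + 3/2} f = 
       integral {-(real M + 1/2)..real M + 3/2} f"
      by (rule Henstock_Kurzweil_Integration.integral_combine) (auto intro: ii)
    have 3: "integral {-(real M + 3/2)..-(real M + 1/2)} f = integral {real M + 1/2..real M + 3/2} f"
      by (rule refl)
    have 4: "integral {-1/2..1/2} (\<lambda>u. f (real (Suc M) + u)) = integral {real M + 1/2..real M + 3/2} f"
      by (subst shift) (simp add: algebra_simps)
    show ?case using Suc 1 2 3 4 by (simp add: algebra_simps)
  qed simp
  have lb: "integral {-(real M + 1/2)..real M + 1/2} f = (LINT x|lborel. indicator {-(real M + 1/2)..real M + 1/2} x *\<^sub>R f x)" for M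
    by (subst set_borel_integral_eq_integral(2)[symmetric])
       (use integrable_mult_indicator[OF _ int] in \<open>auto simp: set_lebesgue_integral_def set_integrable_def\<close>)
  have "(\<lambda>M. LINT x|lborel. indicator {-(real M + 1/2)..real M + 1/2} x *\<^sub>R f x) \<longlonglongrightarrow> (LINT x|lborel. f x)"
  proof (rule integral_dominated_convergence)
    show "integrable lborel (\<lambda>x. norm (f x))" using int by simp
    show "AE x in lborel. (\<lambda>M. indicator {-(real M + 1/2)..real M + 1/2} x *\<^sub>R f x) \<longlonglongrightarrow> f x"
    proof (rule AE_I2)
      fix x :: real
      have "eventually (\<lambda>M. indicator {-(real M + 1/2)..real M + 1/2} x *\<^sub>R f x = f x) sequentially"
        using eventually_ge_at_top[of "nat \<lceil>\<bar>x\<bar>\<rceil>"]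
      proof eventually_elim
        case (elim M)
        hence "\<bar>x\<bar> \<le> real M" by linarith
        thus ?case by (auto simp: indicator_def)
      qed
      thus "(\<lambda>M. indicator {-(real M + 1/2)..real M + 1/2} x *\<^sub>R f x) \<longlonglongrightarrow> f x"
        by (rule tendsto_eventually)
    qed
  qed (use int in \<open>auto simp: indicator_def\<close>)
  hence "(\<lambda>M. (\<Sum>n<M. 2 * integral {-1/2..1/2} (\<lambda>u. f (real (Suc n) + u)))) \<longlonglongrightarrow>
      ((LINT u|lborel. f u) - integral {-1/2..1/2} f)"
    unfolding partial lb[symmetric] by (intro tendsto_intros)
  thus ?thesis by (simp add: sums_def)
qed

text \<open>\<open>D N\<close>, the integral of the Gaussian against the Dirichlet kernel, is
  evaluated twice. Termwise it is a partial sum of the right-hand side; cut into unit cells, on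
  which the kernel repeats by periodicity, each cell tends to the value of the Gaussian at its
  centre.\<close>

theorem gaussian_poisson:
  fixes a :: real
  assumes a: "a > 0"
  shows "1 + 2 * (\<Sum>n. exp (- a * (real (Suc n))\<^sup>2)) =
    sqrt (pi / a) * (1 + 2 * (\<Sum>n. exp (- (pi\<^sup>2 / a) * (real (Suc n))\<^sup>2)))"
proof -
  define G where "G u = exp (- a * u\<^sup>2)" for u :: real
  define D where "D N = LINT u|lborel. G u * dirichlet_kernel N u" for N
  have summ: "summable (\<lambda>n. exp (- b * (real (Suc n))\<^sup>2))" if "b > 0" for b :: real
  proof (rule summable_comparison_test')
    show "summable (\<lambda>n. exp (- b) ^ n)" using that by (intro summable_geometric) auto
    show "norm (exp (- b * (real (Suc n))\<^sup>2)) \<le> exp (- b) ^ n" for n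
    proof -
      have "real n \<le> (real (Suc n))\<^sup>2" by (simp add: power2_eq_square algebra_simps)
      thus ?thesis using that by (simp add: exp_of_nat_mult[symmetric])
    qed
  qed
  have contG: "continuous_on S G" for S unfolding G_def by (intro continuous_intros)
  have trm: "integrable lborel (\<lambda>u. G u * cos (2 * pi * real k * u))"
    "(LINT u|lborel. G u * cos (2 * pi * real k * u)) = sqrt (pi / a) * exp (- (pi\<^sup>2 / a) * (real k)\<^sup>2)" for k
    using gaussian_integral_cos[OF a, of "2 * pi * real k"] a unfolding G_def
    by (simp_all add: power_mult_distrib)
  have GD: "G u * dirichlet_kernel N u = G u * cos (2 * pi * real 0 * u) + 2 * (\<Sum>k=1..N. G u * cos (2 * pi * real k * u))" for u N
    by (simp add: dirichlet_kernel_def algebra_simps sum_distrib_left)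
  have int: "integrable lborel (\<lambda>u. G u * dirichlet_kernel N u)" for N
    unfolding GD by (intro Bochner_Integration.integrable_add integrable_mult_right Bochner_Integration.integrable_sum trm)
  have D: "D N = sqrt (pi / a) * (1 + 2 * (\<Sum>k<N. exp (- (pi\<^sup>2 / a) * (real (Suc k))\<^sup>2)))" for N
  proof -
    have "D N = sqrt (pi / a) + 2 * (\<Sum>k=1..N. sqrt (pi / a) * exp (- (pi\<^sup>2 / a) * (real k)\<^sup>2))"
      unfolding D_def GD using trm trm[of 0]
      by (subst Bochner_Integration.integral_add) 
         (auto simp: Bochner_Integration.integral_sum Bochner_Integration.integrable_sum)
    also have "(\<Sum>k=1..N. sqrt (pi / a) * exp (- (pi\<^sup>2 / a) * (real k)\<^sup>2)) = 
       (\<Sum>k<N. sqrt (pi / a) * exp (- (pi\<^sup>2 / a) * (real (Suc k))\<^sup>2))"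
      by (rule sum.reindex_bij_witness[of _ Suc "\<lambda>k. k - 1"]) auto
    finally show ?thesis by (simp add: algebra_simps sum_distrib_left)
  qed
  have lim1: "D \<longlonglongrightarrow> sqrt (pi / a) * (1 + 2 * (\<Sum>n. exp (- (pi\<^sup>2 / a) * (real (Suc n))\<^sup>2)))"
    unfolding D by (intro tendsto_intros summable_LIMSEQ summ) (use a in auto)
  define A where "A n N = 2 * integral {-1/2..1/2} (\<lambda>u. G (real (Suc n) + u) * dirichlet_kernel N u)" for n N
  define A0 where "A0 N = integral {-1/2..1/2} (\<lambda>u. G u * dirichlet_kernel N u)" for N
  have sums: "(\<lambda>n. A n N) sums (D N - A0 N)" for N
  proof -
    have "(\<lambda>n. 2 * integral {-1/2..1/2} (\<lambda>u. G (real (Suc n) + u) * dirichlet_kernel N (real (Suc n) + u))) sums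
           ((LINT u|lborel. G u * dirichlet_kernel N u) - integral {-1/2..1/2} (\<lambda>u. G u * dirichlet_kernel N u))"
      by (rule integral_whole_line_split[of "\<lambda>u. G u * dirichlet_kernel N u"])
         (use int in \<open>auto intro!: continuous_intros contG simp: G_def dirichlet_kernel_def\<close>)
    thus ?thesis unfolding dirichlet_kernel_shift A_def D_def A0_def .
  qed
  have G': "(G has_real_derivative (- 2 * a * v * G v)) (at v)" for v
    unfolding G_def by (auto intro!: derivative_eq_intros)
  have Gshift': "((\<lambda>u. G (r + u)) has_real_derivative (- 2 * a * (r + u) * G (r + u))) (at u)" for r u
    by (rule DERIV_cong[OF DERIV_chain2[OF G']]) (auto intro!: derivative_eq_intros)
  have A0lim: "A0 \<longlonglongrightarrow> 1"
  proof -
    have "G 0 = 1" by (simp add: G_def)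
    with dirichlet_kernel_tendsto[OF contG G'] show ?thesis unfolding A0_def by simp
  qed
  have Alim: "(\<lambda>N. A n N) \<longlonglongrightarrow> 2 * G (real (Suc n))" for n
  proof -
    have "(\<lambda>N. integral {-1/2..1/2} (\<lambda>u. G (real (Suc n) + u) * dirichlet_kernel N u)) \<longlonglongrightarrow> G (real (Suc n) + 0)"
      by (rule dirichlet_kernel_tendsto[OF _ Gshift'])
         (auto intro!: continuous_on_compose2[OF contG] continuous_intros)
    thus ?thesis unfolding A_def by (auto intro!: tendsto_intros)
  qed
  \<comment> \<open>On the cell around n + 1 the argument v is at least (n + 1) / 2, so v^2 >= (n +
    1) / 4 and the Gaussian is at most \<open>r ^ Suc n\<close>.\<close>
  define r where "r = exp (- a / 4)"
  have r: "0 < r" "r < 1" using a by (auto simp: r_def)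
  \<comment> \<open>A Lipschitz constant on the cell around n + 1, from the derivative 2 a v G v
    with v <= 2 (n + 1). Its summability in n lets Tannery's theorem exchange the sum over cells
    with the limit in N.\<close>
  define L where "L n = 4 * a * (real (Suc n) * r ^ n)" for n
  have Gle: "G v \<le> r ^ Suc n" if "v \<ge> real (Suc n) / 2" for v n
  proof -
    have "real (Suc n) / 4 \<le> (real (Suc n) / 2)\<^sup>2" by (simp add: power2_eq_square field_simps)
    also have "\<dots> \<le> v\<^sup>2" using that by (intro power_mono) auto
    finally have "a * (real (Suc n) / 4) \<le> a * v\<^sup>2" using a by (intro mult_left_mono) auto
    thus ?thesis unfolding G_def r_def exp_of_nat_mult[symmetric] by (simp add: algebra_simps)
  qed
  have Lip: "\<bar>G (real (Suc n) + u) - G (real (Suc n) + 0)\<bar> \<le> L n * \<bar>u\<bar>" if u: "\<bar>u\<bar> \<le> 1/2" for n u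
  proof -
    have "norm (G (real (Suc n) + u) - G (real (Suc n) + 0)) \<le> L n * norm (u - 0)"
    proof (rule field_differentiable_bound[of "{-1/2..1/2}"])
      fix z :: real assume z: "z \<in> {-1/2..1/2}"
      show "((\<lambda>u. G (real (Suc n) + u)) has_field_derivative - 2 * a * (real (Suc n) + z) * G (real (Suc n) + z)) (at z within {-1/2..1/2})"
        using Gshift' by (rule has_field_derivative_at_within)
      have v: "real (Suc n) + z \<ge> real (Suc n) / 2" "real (Suc n) + z \<le> 2 * real (Suc n)" using z by auto
      have "(real (Suc n) + z) * G (real (Suc n) + z) \<le> (2 * real (Suc n)) * r ^ Suc n"
        using v Gle[OF v(1)] by (intro mult_mono) (auto simp: G_def)
      also have "\<dots> \<le> (2 * real (Suc n)) * r ^ n"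
        using r by (intro mult_left_mono power_decreasing) auto
      finally have "2 * a * ((real (Suc n) + z) * G (real (Suc n) + z)) \<le> 2 * a * ((2 * real (Suc n)) * r ^ n)"
        using a by (intro mult_left_mono) auto
      hence "2 * a * ((real (Suc n) + z) * G (real (Suc n) + z)) \<le> L n"
        unfolding L_def by (simp add: mult_ac)
      moreover have "0 \<le> (real (Suc n) + z)" "0 \<le> G (real (Suc n) + z)" using v(1) by (auto simp: G_def)
      ultimately show "norm (- 2 * a * (real (Suc n) + z) * G (real (Suc n) + z)) \<le> L n"
        using a by (simp add: abs_mult mult.assoc)
    qed (use u in auto)
    thus ?thesis by simp
  qed
  have bound: "\<bar>A n N\<bar> \<le> L n + 2 * r ^ n" for n N
  proof -
    have "\<bar>integral {-1/2..1/2} (\<lambda>u. G (real (Suc n) + u) * dirichlet_kernel N u) - G (real (Suc n) + 0)\<bar> \<le> L n / 2"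
      by (rule dirichlet_kernel_bound[OF _ Lip]) (auto intro!: continuous_on_compose2[OF contG] continuous_intros)
    moreover have "G (real (Suc n)) \<le> r ^ n"
      by (rule order_trans[OF Gle power_decreasing[of n "Suc n" r]]) (use r in auto)
    moreover have "G (real (Suc n)) \<ge> 0" by (simp add: G_def)
    moreover have "\<bar>2 * X\<bar> \<le> L n + 2 * r ^ n" if "\<bar>X - (g + 0)\<bar> \<le> L n / 2" "g \<le> r ^ n" "0 \<le> g" for X g
      using that by linarith
    ultimately show ?thesis unfolding A_def by simp
  qed
  have "summable (\<lambda>n. L n + 2 * r ^ n)"
    unfolding L_def using r geometric_deriv_sums[of r]
    by (intro summable_add summable_mult summable_geometric) (auto simp: sums_iff)
  moreover have "eventually (\<lambda>(k, n). norm (A k n) \<le> L k + 2 * r ^ k) (sequentially \<times>\<^sub>F sequentially)"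
    using bound by (intro always_eventually) auto
  ultimately have "(\<lambda>N. \<Sum>n. A n N) \<longlonglongrightarrow> (\<Sum>n. 2 * G (real (Suc n)))"
    using tannerys_theorem[of "\<lambda>n N. A n N" "\<lambda>n. 2 * G (real (Suc n))" sequentially "\<lambda>n. L n + 2 * r ^ n"] Alim
    by auto
  hence "(\<lambda>N. (\<Sum>n. A n N) + A0 N) \<longlonglongrightarrow> (\<Sum>n. 2 * G (real (Suc n))) + 1"
    using A0lim by (intro tendsto_add)
  also have "(\<lambda>N. (\<Sum>n. A n N) + A0 N) = D"
    using sums by (auto simp: sums_iff fun_eq_iff)
  finally have "D \<longlonglongrightarrow> (\<Sum>n. 2 * G (real (Suc n))) + 1" .
  from LIMSEQ_unique[OF this lim1] have "(\<Sum>n. 2 * G (real (Suc n))) + 1 = sqrt (pi / a) * (1 + 2 * (\<Sum>n. exp (- (pi\<^sup>2 / a) * (real (Suc n))\<^sup>2)))" .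
  moreover have "(\<Sum>n. 2 * G (real (Suc n))) = 2 * (\<Sum>n. G (real (Suc n)))"
    unfolding G_def using a by (intro suminf_mult summ)
  ultimately show ?thesis unfolding G_def by simp
qed

section \<open>The xi function as a power series in the square of s - 1/2\<close>

lemma has_bochner_integral_nonneg_has_integral:
  fixes f :: "real \<Rightarrow> real"
  assumes [measurable]: "f \<in> borel_measurable borel" "A \<in> sets borel" 
    and nonneg: "\<And>x. x \<in> A \<Longrightarrow> f x \<ge> 0" and I: "(f has_integral I) A"
  shows "has_bochner_integral lborel (\<lambda>x. indicator A x * f x) I"
proof -
  have "((\<lambda>x. indicator A x * f x) has_integral I) UNIV"
  proof -
    have "(\<lambda>x. indicator A x * f x) = (\<lambda>x. if x \<in> A then f x else 0)" by (auto simp: indicator_def)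
    thus ?thesis using I by (simp only: has_integral_restrict_UNIV)
  qed
  hence "integral\<^sup>N lborel (\<lambda>x. indicator A x * f x) = ennreal I"
    by (intro nn_integral_has_integral_lborel) (use nonneg in \<open>auto simp: indicator_def\<close>)
  moreover have "I \<ge> 0" using has_integral_nonneg[OF I] nonneg by auto
  ultimately show ?thesis
    by (intro has_bochner_integral_nn_integral) (use nonneg in \<open>auto simp: indicator_def\<close>)
qed

lemma has_bochner_integral_exp_minus_from:
  fixes c L :: real
  assumes "c > 0"
  shows "has_bochner_integral lborel (\<lambda>t. indicator {L..} t * exp (- c * t)) (exp (- c * L) / c)"
  using has_integral_exp_minus_to_infinity[of c L] assms
  by (intro has_bochner_integral_nonneg_has_integral) auto

lemma has_bochner_integral_exp_minus:
  fixes c :: real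
  assumes "c > 0"
  shows "has_bochner_integral lborel (\<lambda>t. indicator {0..} t * exp (- c * t)) (1 / c)"
  using has_bochner_integral_exp_minus_from[OF assms, of 0] by simp

text \<open>Tonelli for series: for nonnegative terms, convergence of the sum of the integrals
  justifies termwise integration. It serves the theta, von Mangoldt and Lerch series alike.\<close>

lemma has_bochner_integral_sums_nonneg:
  fixes f :: "nat \<Rightarrow> 'a \<Rightarrow> real"
  assumes f: "\<And>n. has_bochner_integral M (f n) (a n)" and nonneg: "\<And>n x. f n x \<ge> 0"
    and F: "\<And>x. (\<lambda>n. f n x) sums F x" and a: "a sums S"
  shows "has_bochner_integral M F S"
proof -
  have int: "integrable M (f n)" and val: "integral\<^sup>L M (f n) = a n" for n
    using f[of n] by (simp_all add: has_bochner_integral_iff)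
  have AE: "AE x in M. summable (\<lambda>n. norm (f n x))" using F nonneg by (auto simp: sums_iff)
  have summ: "summable (\<lambda>n. \<integral>x. norm (f n x) \<partial>M)" using a val nonneg by (simp add: sums_iff)
  have eq: "(\<Sum>n. f n x) = F x" for x using F by (simp add: sums_iff)
  have "integrable M F" using integrable_suminf[OF int AE summ] unfolding eq .
  moreover have "a sums integral\<^sup>L M F" using sums_integral[OF int AE summ] unfolding eq val .
  ultimately show ?thesis using a sums_unique2 by (auto simp: has_bochner_integral_iff)
qed

text \<open>Euler's integral for Gamma (s / 2) under x = c exp (2 t), which turns the half line into
  the whole line and powers of x into exponentials.\<close>

lemma has_bochner_integral_exp_exp:
  fixes s c :: real
  assumes s: "s > 0" and c: "c > 0"
  shows "has_bochner_integral lborel (\<lambda>t. exp (s * t) * exp (- c * exp (2 * t))) (Gamma (s / 2) / (2 * c powr (s / 2)))"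
proof -
  define f where "f x = x powr (s / 2 - 1) / exp x" for x :: real
  define g where "g t = c * exp (2 * t)" for t :: real
  define g' where "g' t = 2 * c * exp (2 * t)" for t :: real
  have img: "range g = {0<..}"
  proof (intro equalityI subsetI)
    fix x :: real assume "x \<in> {0<..}"
    hence "x = g (ln (x / c) / 2)" using c by (simp add: g_def)
    thus "x \<in> range g" by blast
  qed (use c in \<open>auto simp: g_def\<close>)
  have "(f has_integral Gamma (s / 2)) {0..}"
    unfolding f_def using Gamma_integral_real[of "s / 2"] s by simp
  \<comment> \<open>The substitution maps onto the open half line, so the endpoint 0 is dropped as a
    negligible set.\<close>
  hence f: "(f has_integral Gamma (s / 2)) {0<..}"
  proof (rule has_integral_spike_set_eq[THEN iffD1, rotated 2])
    show "negligible {x \<in> {0..} - {0<..}. f x \<noteq> 0}"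
      by (rule negligible_subset[of "{0}"]) auto
    have "{x \<in> {0<..} - {0..}. f x \<noteq> 0} = {}" by auto
    thus "negligible {x \<in> {0<..} - {0..}. f x \<noteq> 0}" by (simp only: negligible_empty)
  qed
  have fa: "f absolutely_integrable_on {0<..}"
    using f by (intro nonnegative_absolutely_integrable_1) (auto simp: f_def)
  have "(\<lambda>t. \<bar>g' t\<bar> * f (g t)) absolutely_integrable_on UNIV \<and> integral UNIV (\<lambda>t. \<bar>g' t\<bar> * f (g t)) = Gamma (s / 2)"
  proof (subst has_absolute_integral_change_of_variables_1'[where g=g])
    show "inj g" using c by (auto simp: inj_on_def g_def)
    show "(g has_field_derivative g' x) (at x)" for x
      unfolding g_def g'_def by (auto intro!: derivative_eq_intros)
  qed (use f fa img in \<open>auto simp: integral_unique\<close>)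
  hence "((\<lambda>t. \<bar>g' t\<bar> * f (g t)) has_integral Gamma (s / 2)) UNIV"
    unfolding absolutely_integrable_on_def by (metis integrable_integral)
  also have "(\<lambda>t. \<bar>g' t\<bar> * f (g t)) = (\<lambda>t. (2 * c powr (s / 2)) * (exp (s * t) * exp (- c * exp (2 * t))))"
  proof
    fix t
    have "(c * exp (2 * t)) powr (s / 2) = c powr (s / 2) * exp (s * t)"
      using c by (simp add: powr_mult exp_powr_real)
    moreover have "(c * exp (2 * t)) powr (s / 2 - 1) = (c * exp (2 * t)) powr (s / 2) / (c * exp (2 * t))"
      using c by (simp add: powr_diff)
    ultimately show "\<bar>g' t\<bar> * f (g t) = (2 * c powr (s / 2)) * (exp (s * t) * exp (- c * exp (2 * t)))"
      using c by (simp add: g_def g'_def f_def exp_minus field_simps)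
  qed
  finally have "((\<lambda>t. (2 * c powr (s / 2)) * (exp (s * t) * exp (- c * exp (2 * t)))) has_integral Gamma (s / 2)) UNIV" .
  from has_integral_divide[OF this, of "2 * c powr (s / 2)"]
  have "((\<lambda>t. exp (s * t) * exp (- c * exp (2 * t))) has_integral Gamma (s / 2) / (2 * c powr (s / 2))) UNIV"
    using c by simp
  from has_bochner_integral_nonneg_has_integral[OF _ _ _ this] show ?thesis by simp
qed

section \<open>The theta function and its two-sided Laplace transform\<close>

text \<open>Jacobi's theta function is 1 + 2 \<open>omega\<close>: here the n = 0 term is removed
  and n, - n are counted once.\<close>

definition omega :: "real \<Rightarrow> real" where
  "omega x = (\<Sum>n. exp (- pi * (real (Suc n))\<^sup>2 * x))"

definition phi :: "real \<Rightarrow> real" where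
  "phi t = exp (t / 2) * omega (exp (2 * t))"

text \<open>
  With \<open>x = exp (2 t)\<close> the Mellin transform of \<open>omega\<close> at \<open>s / 2\<close> becomes twice the two-sided
  Laplace transform of \<open>phi\<close> at \<open>w = s - 1/2\<close>, and Jacobi's identity becomes a reflection formula.
\<close>

definition zeta_real :: "real \<Rightarrow> real" where
  "zeta_real s = (\<Sum>n. real (Suc n) powr (- s))"

lemma summable_omega: "x > 0 \<Longrightarrow> summable (\<lambda>n. exp (- pi * (real (Suc n))\<^sup>2 * x))"
proof (rule summable_comparison_test')
  assume x: "x > 0"
  show "summable (\<lambda>n. exp (- (pi * x)) ^ n)" using x by (intro summable_geometric) auto
  show "norm (exp (- pi * (real (Suc n))\<^sup>2 * x)) \<le> exp (- (pi * x)) ^ n" for n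
  proof -
    have "real n \<le> (real (Suc n))\<^sup>2" by (simp add: power2_eq_square algebra_simps)
    hence "(pi * x) * real n \<le> (pi * x) * (real (Suc n))\<^sup>2" using x by (intro mult_left_mono) auto
    thus ?thesis by (simp add: exp_of_nat_mult[symmetric] mult_ac)
  qed
qed

lemma summable_zeta_real: "s > 1 \<Longrightarrow> summable (\<lambda>n. real (Suc n) powr (- s))"
  by (subst summable_Suc_iff) (simp add: summable_real_powr_iff)

lemma phi_nonneg: "phi t \<ge> 0"
  unfolding phi_def omega_def by (intro mult_nonneg_nonneg suminf_nonneg summable_omega) auto

lemma phi_measurable [measurable]: "phi \<in> borel_measurable borel"
  unfolding phi_def[abs_def] omega_def by measurable

text \<open>Poisson summation with a = pi exp (2 t). The added exponentials are the n = 0 terms of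
  the two theta series.\<close>

lemma phi_reflect: "phi t + exp (t / 2) / 2 = phi (- t) + exp (- t / 2) / 2"
proof -
  have "1 + 2 * omega (exp (2 * t)) = sqrt (1 / exp (2 * t)) * (1 + 2 * omega (exp (- 2 * t)))"
  proof -
    have eq: "pi / (pi * exp (2 * t)) = 1 / exp (2 * t)" "pi\<^sup>2 / (pi * exp (2 * t)) = pi * exp (- 2 * t)"
      by (simp_all add: power2_eq_square exp_minus field_simps)
    show ?thesis
      using gaussian_poisson[of "pi * exp (2 * t)"] unfolding eq omega_def by (simp add: mult_ac)
  qed
  also have "sqrt (1 / exp (2 * t)) = exp (- t)"
  proof (rule real_sqrt_unique)
    show "(exp (- t))\<^sup>2 = 1 / exp (2 * t)"
      by (simp add: exp_minus power2_eq_square exp_add[symmetric] field_simps)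
  qed auto
  finally have "exp (t / 2) * (1 + 2 * omega (exp (2 * t))) = exp (t / 2) * exp (- t) * (1 + 2 * omega (exp (- 2 * t)))"
    by simp
  also have "exp (t / 2) * exp (- t) = exp (- t / 2)"
    by (simp add: exp_add[symmetric])
  finally show ?thesis by (simp add: phi_def algebra_simps)
qed

lemma has_bochner_integral_phi:
  assumes w: "w > 1 / 2"
  shows "has_bochner_integral lborel (\<lambda>t. phi t * exp (w * t))
           (pi powr (- (w + 1/2) / 2) * Gamma ((w + 1/2) / 2) * zeta_real (w + 1/2) / 2)"
proof -
  define s where "s = w + 1/2"
  have s: "s > 1" using w by (simp add: s_def)
  define h where "h n t = exp (s * t) * exp (- (pi * (real (Suc n))\<^sup>2) * exp (2 * t))" for n t
  have h: "has_bochner_integral lborel (h n) (Gamma (s / 2) / 2 * pi powr (- s / 2) * real (Suc n) powr (- s))" for n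
  proof -
    have "(pi * (real (Suc n))\<^sup>2) powr (s / 2) = pi powr (s / 2) * real (Suc n) powr s"
      by (simp add: powr_mult powr_powr flip: powr_numeral)
    hence eq: "Gamma (s / 2) / (2 * (pi * (real (Suc n))\<^sup>2) powr (s / 2)) = Gamma (s / 2) / 2 * pi powr (- s / 2) * real (Suc n) powr (- s)"
      by (simp add: powr_minus field_simps)
    have "has_bochner_integral lborel (h n) (Gamma (s / 2) / (2 * (pi * (real (Suc n))\<^sup>2) powr (s / 2)))"
      unfolding h_def using s by (intro has_bochner_integral_exp_exp) auto
    thus ?thesis unfolding eq .
  qed
  have hphi: "(\<lambda>n. h n t) sums (phi t * exp (w * t))" for t
  proof -
    have "(\<lambda>n. exp (s * t) * exp (- pi * (real (Suc n))\<^sup>2 * exp (2 * t))) sums (exp (s * t) * omega (exp (2 * t)))"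
      unfolding omega_def by (intro sums_mult summable_sums summable_omega) auto
    moreover have "exp (s * t) = exp (t / 2) * exp (w * t)"
      by (simp add: s_def exp_add[symmetric] algebra_simps)
    ultimately show ?thesis unfolding h_def phi_def by (simp add: mult_ac)
  qed
  have "(\<lambda>n. Gamma (s / 2) / 2 * pi powr (- s / 2) * real (Suc n) powr (- s)) sums
      (Gamma (s / 2) / 2 * pi powr (- s / 2) * zeta_real s)"
    unfolding zeta_real_def using s by (intro sums_mult summable_sums summable_zeta_real)
  from has_bochner_integral_sums_nonneg[OF h _ hphi this]
  have "has_bochner_integral lborel (\<lambda>t. phi t * exp (w * t)) (Gamma (s / 2) / 2 * pi powr (- s / 2) * zeta_real s)"
    by (simp add: h_def)
  thus ?thesis by (simp add: s_def mult_ac)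
qed

text \<open>Riemann's folding: the part over t < 0 is reflected to t > 0 by
  \<open>phi_reflect\<close>. The exponentials produced there integrate to the pole terms at s = 1
  and s = 0, and what remains is even in w.\<close>

lemma has_bochner_integral_phi_cosh:
  assumes w: "w > 1 / 2"
  shows "has_bochner_integral lborel (\<lambda>t. indicator {0..} t * (phi t * cosh (w * t)))
           (pi powr (- (w + 1/2) / 2) * Gamma ((w + 1/2) / 2) * zeta_real (w + 1/2) / 4 - 1 / (4 * (w\<^sup>2 - 1/4)))"
proof -
  define I where "I = pi powr (- (w + 1/2) / 2) * Gamma ((w + 1/2) / 2) * zeta_real (w + 1/2) / 2"
  have phi: "has_bochner_integral lborel (\<lambda>t. phi t * exp (w * t)) I"
    unfolding I_def using w by (rule has_bochner_integral_phi)
  hence int: "integrable lborel (\<lambda>t. phi t * exp (w * t))" by (simp add: has_bochner_integral_iff)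
  have pos: "integrable lborel (\<lambda>t. indicator {0..} t * (phi t * exp (w * t)))"
    using integrable_mult_indicator[OF _ int, of "{0..}"] by simp
  have neg: "integrable lborel (\<lambda>t. indicator {..<0} t * (phi t * exp (w * t)))"
    using integrable_mult_indicator[OF _ int, of "{..<0}"] by simp
  have split: "I = (LINT t|lborel. indicator {0..} t * (phi t * exp (w * t))) + (LINT t|lborel. indicator {..<0} t * (phi t * exp (w * t)))"
  proof -
    have "I = (LINT t|lborel. phi t * exp (w * t))" using phi by (simp add: has_bochner_integral_iff)
    also have "\<dots> = (LINT t|lborel. indicator {0..} t * (phi t * exp (w * t)) + indicator {..<0} t * (phi t * exp (w * t)))"
      by (intro Bochner_Integration.integral_cong) (auto simp: indicator_def)
    finally show ?thesis using pos neg by simp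
  qed
  have neg': "has_bochner_integral lborel (\<lambda>t. indicator {0<..} t * (phi (- t) * exp (- w * t)))
      (LINT t|lborel. indicator {..<0} t * (phi t * exp (w * t)))"
  proof -
    have "has_bochner_integral lborel (\<lambda>t. indicator {..<0} t * (phi t * exp (w * t)))
      (LINT t|lborel. indicator {..<0} t * (phi t * exp (w * t)))"
      using neg by (simp add: has_bochner_integral_iff)
    hence "has_bochner_integral lborel (\<lambda>t. indicator {..<0} (- t) * (phi (- t) * exp (w * (- t))))
      (LINT t|lborel. indicator {..<0} t * (phi t * exp (w * t)))"
      using lborel_has_bochner_integral_real_affine_iff[of "-1" "\<lambda>t. indicator {..<0} t * (phi t * exp (w * t))" _ 0] by simp
    moreover have "indicator {..<0} (- t) = (indicator {0<..} t :: real)" for t :: real by (simp add: indicator_def)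
    ultimately show ?thesis by simp
  qed
  have e: "has_bochner_integral lborel (\<lambda>t. indicator {0..} t * exp (- (w - 1/2) * t)) (1 / (w - 1/2))"
          "has_bochner_integral lborel (\<lambda>t. indicator {0..} t * exp (- (w + 1/2) * t)) (1 / (w + 1/2))"
    by (rule has_bochner_integral_exp_minus, use w in simp)+
  define E where "E = (1 / (w - 1/2) - 1 / (w + 1/2)) / 2"
  have E: "has_bochner_integral lborel (\<lambda>t. (indicator {0..} t * exp (- (w - 1/2) * t) - indicator {0..} t * exp (- (w + 1/2) * t)) / 2) E"
    unfolding E_def by (intro has_bochner_integral_divide has_bochner_integral_diff e)
  have pos': "has_bochner_integral lborel (\<lambda>t. indicator {0..} t * (phi t * exp (w * t)))
      (LINT t|lborel. indicator {0..} t * (phi t * exp (w * t)))"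
    using pos by (simp add: has_bochner_integral_iff)
  have "has_bochner_integral lborel (\<lambda>t. (indicator {0..} t * (phi t * exp (w * t)) + indicator {0<..} t * (phi (- t) * exp (- w * t))
       - (indicator {0..} t * exp (- (w - 1/2) * t) - indicator {0..} t * exp (- (w + 1/2) * t)) / 2) / 2) ((I - E) / 2)"
    unfolding split by (intro has_bochner_integral_divide has_bochner_integral_diff has_bochner_integral_add pos' neg' E)
  also have "?this \<longleftrightarrow> has_bochner_integral lborel (\<lambda>t. indicator {0..} t * (phi t * cosh (w * t))) ((I - E) / 2)"
  proof (rule has_bochner_integral_cong_AE)
    \<comment> \<open>The reflected half covers t > 0 only, so the two integrands are compared away
      from the single point 0.\<close>
    have "AE t in lborel. t \<noteq> (0::real)" by (rule AE_lborel_singleton)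
    thus "AE t in lborel. (indicator {0..} t * (phi t * exp (w * t)) + indicator {0<..} t * (phi (- t) * exp (- w * t))
       - (indicator {0..} t * exp (- (w - 1/2) * t) - indicator {0..} t * exp (- (w + 1/2) * t)) / 2) / 2 =
        indicator {0..} t * (phi t * cosh (w * t))"
    proof eventually_elim
      case (elim t)
      have "exp (- (w - 1/2) * t) = exp (t / 2) * exp (- w * t)" "exp (- (w + 1/2) * t) = exp (- t / 2) * exp (- w * t)"
        by (simp_all add: exp_add[symmetric] algebra_simps)
      moreover have "phi (- t) = phi t + exp (t / 2) / 2 - exp (- t / 2) / 2" using phi_reflect[of t] by simp
      moreover have "(p * X + (p + A / 2 - B / 2) * Y - (A * Y - B * Y) / 2) / 2 = p * ((X + Y) / 2)"
        for p A B X Y :: real by (simp add: field_simps)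
      ultimately show ?case using elim
        by (auto simp: indicator_def cosh_field_def)
    qed
  qed (auto simp: cosh_field_def)
  finally have "has_bochner_integral lborel (\<lambda>t. indicator {0..} t * (phi t * cosh (w * t))) ((I - E) / 2)" .
  moreover have "E = 1 / (2 * (w\<^sup>2 - 1/4))"
  proof -
    have eq: "w\<^sup>2 - 1/4 = (w - 1/2) * (w + 1/2)" by (simp add: power2_eq_square algebra_simps)
    have "(1 / a - 1 / b) / 2 = 1 / (2 * (a * b))" if "a > 0" "b = a + 1" for a b :: real
      using that by (simp add: field_simps)
    from this[of "w - 1/2" "w + 1/2"] show ?thesis unfolding eq E_def using w by simp
  qed
  ultimately show ?thesis by (simp add: I_def diff_divide_distrib)
qed


section \<open>Expansion in powers of w^2\<close>

lemma sums_cosh_even: "(\<lambda>k. x ^ (2 * k) / fact (2 * k)) sums cosh (x :: real)"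
proof -
  have "strict_mono (\<lambda>k::nat. 2 * k)" by (auto simp: strict_mono_def)
  moreover have "n \<notin> range (\<lambda>k. 2 * k) \<Longrightarrow> (if even n then x ^ n /\<^sub>R fact n else 0) = 0" for n :: nat
    by (auto elim!: evenE)
  ultimately have "(\<lambda>k. if even (2 * k) then x ^ (2 * k) /\<^sub>R fact (2 * k) else 0) sums cosh x"
    using cosh_converges[of x] by (subst sums_mono_reindex) auto
  thus ?thesis by (simp add: field_simps)
qed

definition phi_coeff :: "nat \<Rightarrow> real" where
  "phi_coeff k = (LINT t|lborel. indicator {0..} t * (phi t * t ^ (2 * k))) / fact (2 * k)"

lemma phi_coeff_nonneg: "phi_coeff k \<ge> 0"
  unfolding phi_coeff_def
  by (intro divide_nonneg_nonneg Bochner_Integration.integral_nonneg)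
     (auto simp: indicator_def phi_nonneg power_mult)

text \<open>Both \<open>phi\<close> and the Taylor coefficients of cosh are nonnegative, so every
  partial sum is dominated by the full integrand and the cosh series may be integrated
  termwise.\<close>

lemma phi_coeff_sums:
  assumes w: "w > 1 / 2"
  shows "(\<lambda>k. phi_coeff k * (w\<^sup>2) ^ k) sums
     (pi powr (- (w + 1/2) / 2) * Gamma ((w + 1/2) / 2) * zeta_real (w + 1/2) / 4 - 1 / (4 * (w\<^sup>2 - 1/4)))"
proof -
  define h where "h k t = indicator {0..} t * (phi t * t ^ (2 * k)) * ((w\<^sup>2) ^ k / fact (2 * k))" for k t
  have int: "integrable lborel (\<lambda>t. indicator {0..} t * (phi t * cosh (w * t)))"
    using has_bochner_integral_phi_cosh[OF w] by (simp add: has_bochner_integral_iff)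
  have h_nonneg: "h k t \<ge> 0" for k t by (auto simp: h_def indicator_def phi_nonneg power_mult)
  have h_sums: "(\<lambda>k. h k t) sums (indicator {0..} t * (phi t * cosh (w * t)))" for t
  proof -
    have "(\<lambda>k. indicator {0..} t * (phi t * ((w * t) ^ (2 * k) / fact (2 * k)))) sums (indicator {0..} t * (phi t * cosh (w * t)))"
      by (intro sums_mult sums_cosh_even)
    moreover have "(w * t) ^ (2 * k) = t ^ (2 * k) * (w\<^sup>2) ^ k" for k
      by (metis power_mult power_mult_distrib mult.commute)
    ultimately show ?thesis by (simp add: h_def mult_ac)
  qed
  have sums_nn: "suminf (\<lambda>k. h k t) = indicator {0..} t * (phi t * cosh (w * t))" for t
    using h_sums by (simp add: sums_iff)
  have partial: "(\<Sum>k<n. h k t) \<le> indicator {0..} t * (phi t * cosh (w * t))" for n t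
    using h_sums h_nonneg unfolding sums_nn[symmetric] by (intro sum_le_suminf) (auto simp: sums_iff)
  have h_le: "h k t \<le> indicator {0..} t * (phi t * cosh (w * t))" for k t
  proof -
    have "h k t \<le> (\<Sum>k<Suc k. h k t)" by (simp add: sum_nonneg h_nonneg)
    also note partial
    finally show ?thesis .
  qed
  have meas [measurable]: "h k \<in> borel_measurable lborel" for k
    unfolding h_def[abs_def] by measurable
  have int_h: "integrable lborel (h k)" for k
    by (rule Bochner_Integration.integrable_bound[OF int]) (use h_le h_nonneg in \<open>auto simp: order_trans[OF h_nonneg h_le]\<close>)
  have AE: "AE t in lborel. summable (\<lambda>k. norm (h k t))"
    using h_sums h_nonneg by (auto simp: sums_iff)
  have summ: "summable (\<lambda>k. LINT t|lborel. norm (h k t))"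
  proof (rule bounded_imp_summable)
    show "(\<Sum>k\<le>n. LINT t|lborel. norm (h k t)) \<le> (LINT t|lborel. indicator {0..} t * (phi t * cosh (w * t)))" for n
    proof -
      have "(\<Sum>k\<le>n. LINT t|lborel. norm (h k t)) = (LINT t|lborel. (\<Sum>k\<le>n. h k t))"
        using h_nonneg int_h by (subst Bochner_Integration.integral_sum) auto
      also have "\<dots> \<le> (LINT t|lborel. indicator {0..} t * (phi t * cosh (w * t)))"
        using partial[of _ "Suc n"] by (intro integral_mono Bochner_Integration.integrable_sum int_h int) (auto simp: lessThan_Suc_atMost)
      finally show ?thesis .
    qed
  qed auto
  have "(\<lambda>k. integral\<^sup>L lborel (h k)) sums (LINT t|lborel. indicator {0..} t * (phi t * cosh (w * t)))"
    using sums_integral[OF int_h AE summ] unfolding sums_nn .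
  moreover have "integral\<^sup>L lborel (h k) = phi_coeff k * (w\<^sup>2) ^ k" for k
    unfolding h_def[abs_def] phi_coeff_def by simp
  ultimately show ?thesis using has_bochner_integral_phi_cosh[OF w]
    by (simp only: has_bochner_integral_iff)
qed

text \<open>The coefficients are nonnegative and the series converges at w^2 for every real w > 1/2,
  so its radius of convergence is infinite.\<close>

lemma summable_phi_coeff: "summable (\<lambda>k. phi_coeff k * r ^ k)" 
proof -
  define w where "w = \<bar>r\<bar> + 1"
  have w: "w > 1/2" by (simp add: w_def)
  show ?thesis
  proof (rule summable_comparison_test')
    show "summable (\<lambda>k. phi_coeff k * (w\<^sup>2) ^ k)" using phi_coeff_sums[OF w] by (simp add: sums_iff)
    have "\<bar>r\<bar> \<le> w\<^sup>2" by (simp add: w_def power2_eq_square algebra_simps)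
    thus "norm (phi_coeff k * r ^ k) \<le> phi_coeff k * (w\<^sup>2) ^ k" for k
      using phi_coeff_nonneg[of k] by (simp add: abs_mult power_abs mult_left_mono power_mono)
  qed
qed

text \<open>
  \<open>\<xi> (1/2 + w) = 1/2 + 2 (w\<^sup>2 - 1/4) \<integral>\<^sub>0\<^sup>\<infinity> phi t cosh (w t) dt\<close> is a power series in \<open>w\<^sup>2\<close>.
  Taking \<open>z = w\<^sup>2\<close> as the variable makes the functional equation automatic and
  brings the order down to \<open>1/2\<close>.
\<close>

definition phi_series :: "complex \<Rightarrow> complex" where
  "phi_series z = (\<Sum>k. of_real (phi_coeff k) * z ^ k)"

definition Xi :: "complex \<Rightarrow> complex" where
  "Xi z = 1 / 2 + 2 * (z - 1 / 4) * phi_series z"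

lemma summable_norm_phi_series: "summable (\<lambda>k. norm (of_real (phi_coeff k) * z ^ k :: complex))"
  using summable_phi_coeff[of "norm z"] by (simp add: norm_mult norm_power phi_coeff_nonneg)

lemma phi_series_sums: "(\<lambda>k. of_real (phi_coeff k) * z ^ k) sums phi_series z"
  unfolding phi_series_def by (intro summable_sums summable_norm_cancel[OF summable_norm_phi_series])

lemma norm_phi_series_le: "norm (phi_series z) \<le> (\<Sum>k. phi_coeff k * norm z ^ k)"
  unfolding phi_series_def
  using summable_norm[OF summable_norm_phi_series[of z]] by (simp add: norm_mult norm_power phi_coeff_nonneg)

lemma phi_series_holomorphic [holomorphic_intros]: "phi_series holomorphic_on S"
proof -
  have "phi_series holomorphic_on ball 0 r" for r
    by (rule power_series_holomorphic[of _ _ "\<lambda>k. of_real (phi_coeff k)"]) (use phi_series_sums in auto)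
  hence "phi_series holomorphic_on (\<Union>r\<in>UNIV. ball 0 r)"
    by (subst holomorphic_on_UN_open) auto
  also have "(\<Union>r\<in>UNIV. ball 0 r) = (UNIV :: complex set)"
    using gt_ex by auto
  finally show ?thesis by (rule holomorphic_on_subset) auto
qed

lemma Xi_holomorphic [holomorphic_intros]: "Xi holomorphic_on S"
  unfolding Xi_def[abs_def] by (intro holomorphic_intros)

definition xi_real :: "real \<Rightarrow> real" where
  "xi_real s = s * (s - 1) / 2 * pi powr (- s / 2) * Gamma (s / 2) * zeta_real s"

lemma phi_series_of_real_square:
  assumes w: "w > 1 / 2"
  shows "phi_series (of_real (w\<^sup>2)) = of_real (\<Sum>k. phi_coeff k * (w\<^sup>2) ^ k)"
  using phi_series_sums[of "of_real (w\<^sup>2)"] sums_of_real[OF summable_sums[OF summable_phi_coeff[of "w\<^sup>2"]], where 'a=complex]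
  by (simp add: sums_iff)

text \<open>The factor 2 (z - 1/4) turns the pole term - 1 / (4 (w^2 - 1/4)) into - 1/2, which the
  constant 1/2 in \<open>Xi\<close> cancels; and w^2 - 1/4 is s (s - 1) for s = w + 1/2.\<close>

lemma Xi_of_real_square:
  assumes w: "w > 1 / 2"
  shows "Xi (of_real (w\<^sup>2)) = of_real (xi_real (w + 1/2))"
proof -
  define P where "P = pi powr (- (w + 1/2) / 2) * Gamma ((w + 1/2) / 2) * zeta_real (w + 1/2)"
  have w2: "w\<^sup>2 - 1/4 \<noteq> 0"
  proof -
    have "w\<^sup>2 - 1/4 = (w - 1/2) * (w + 1/2)" by (simp add: power2_eq_square algebra_simps)
    thus ?thesis using w by auto
  qed
  have J: "phi_series (of_real (w\<^sup>2)) = of_real (P / 4 - 1 / (4 * (w\<^sup>2 - 1/4)))"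
    using phi_coeff_sums[OF w] phi_series_of_real_square[OF w] by (simp add: sums_iff P_def)
  have "Xi (of_real (w\<^sup>2)) = of_real (1 / 2 + 2 * (w\<^sup>2 - 1/4) * (P / 4 - 1 / (4 * (w\<^sup>2 - 1/4))))"
    unfolding Xi_def J by simp
  also have "1 / 2 + 2 * (w\<^sup>2 - 1/4) * (P / 4 - 1 / (4 * (w\<^sup>2 - 1/4))) = (w\<^sup>2 - 1/4) / 2 * P"
    using w2 by (simp add: field_simps)
  also have "w\<^sup>2 - 1/4 = (w + 1/2) * (w + 1/2 - 1)" by (simp add: power2_eq_square algebra_simps)
  finally show ?thesis by (simp add: xi_real_def P_def)
qed

lemma zeta_real_antimono: "1 < s \<Longrightarrow> s \<le> s' \<Longrightarrow> zeta_real s' \<le> zeta_real s"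
  unfolding zeta_real_def by (intro suminf_le summable_zeta_real powr_mono) auto

lemma zeta_real_pos: "s > 1 \<Longrightarrow> zeta_real s > 0"
  unfolding zeta_real_def by (intro suminf_pos summable_zeta_real) auto

lemma zeta_real_2: "zeta_real 2 = pi\<^sup>2 / 6"
proof -
  have "real (Suc n) powr (- 2) = 1 / (real (n + 1))\<^sup>2" for n
    by (simp add: powr_minus field_simps flip: powr_numeral)
  thus ?thesis unfolding zeta_real_def using inverse_squares_sums by (simp add: sums_iff)
qed

lemma xi_real_pos: "s > 1 \<Longrightarrow> xi_real s > 0"
  unfolding xi_real_def by (intro mult_pos_pos divide_pos_pos zeta_real_pos Gamma_real_pos) auto

text \<open>\<open>Xi 0\<close> is (1 - \<open>phi_coeff 0\<close>) / 2, so a crude bound on one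
  coefficient suffices: it is at most the whole series at w = 3/2, that is s = 2, where zeta is pi^2
  / 6 and the Gamma factor is 1.\<close>

lemma Xi_0_nonzero: "Xi 0 \<noteq> 0"
proof -
  have "phi_coeff 0 = (\<Sum>k<1. phi_coeff k * ((3/2)\<^sup>2) ^ k)" by simp
  also have "\<dots> \<le> (\<Sum>k. phi_coeff k * ((3/2)\<^sup>2) ^ k)"
    by (rule sum_le_suminf) (auto intro!: summable_phi_coeff mult_nonneg_nonneg phi_coeff_nonneg)
  also have "\<dots> = pi powr (- 1) * zeta_real 2 / 4 - 1 / 8"
    using phi_coeff_sums[of "3/2"] by (simp add: sums_iff power2_eq_square)
  also have "\<dots> = pi / 24 - 1 / 8"
    by (simp add: zeta_real_2 powr_minus power2_eq_square field_simps)
  also have "\<dots> < 1" using pi_less_4 by simp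
  finally have "phi_coeff 0 < 1" .
  moreover have "phi_series 0 = of_real (phi_coeff 0)"
    using phi_series_sums[of 0] sums_unique2[OF phi_series_sums[of 0] powser_sums_zero[of "\<lambda>k. of_real (phi_coeff k)"]] by simp
  hence "Xi 0 = of_real (1/2 - phi_coeff 0 / 2)" by (simp add: Xi_def)
  ultimately show ?thesis by (simp only: of_real_eq_0_iff)
qed

text \<open>By nonnegativity of the coefficients \<open>phi_series\<close> is largest, on a circle
  around 0, at the positive real point w^2. With w = 2 n + 3/2 the Gamma factor there is n!, so the
  logarithm of the bound grows like n log n on a circle of radius about 4 n^2.\<close>

lemma norm_Xi_le:
  assumes z: "norm z = (2 * real n + 3/2)\<^sup>2"
  shows "norm (Xi z) \<le> 1 / 2 + (norm z + 1) * fact n"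
proof -
  define w where "w = 2 * real n + 3/2"
  have w: "w > 1/2" "w\<^sup>2 - 1/4 > 0"
  proof -
    have "w\<^sup>2 - 1/4 = (w - 1/2) * (w + 1/2)" by (simp add: power2_eq_square algebra_simps)
    thus "w > 1/2" "w\<^sup>2 - 1/4 > 0" by (simp_all add: w_def)
  qed
  have s: "(w + 1/2) / 2 = 1 + real n" by (simp add: w_def field_simps)
  have "norm (phi_series z) \<le> (\<Sum>k. phi_coeff k * (w\<^sup>2) ^ k)"
    using norm_phi_series_le[of z] unfolding z w_def .
  also have "\<dots> = pi powr (- (w + 1/2) / 2) * Gamma ((w + 1/2) / 2) * zeta_real (w + 1/2) / 4 - 1 / (4 * (w\<^sup>2 - 1/4))"
    using phi_coeff_sums[OF w(1)] by (simp add: sums_iff)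
  also have "\<dots> \<le> pi powr (- (w + 1/2) / 2) * Gamma ((w + 1/2) / 2) * zeta_real (w + 1/2) / 4"
    using w(2) by simp
  also have "\<dots> \<le> 1 * fact n * 2 / 4"
  proof (intro divide_right_mono mult_mono)
    show "pi powr (- (w + 1/2) / 2) \<le> 1"
      using powr_mono[of "- (w + 1/2) / 2" 0 pi] w(1) pi_ge_two by simp
    show "Gamma ((w + 1/2) / 2) \<le> fact n" unfolding s by (simp add: Gamma_fact)
    have "zeta_real (w + 1/2) \<le> zeta_real 2" by (rule zeta_real_antimono) (auto simp: w_def)
    also have "\<dots> \<le> 2" 
    proof -
      have "pi\<^sup>2 \<le> 3.15\<^sup>2" using pi_approx by (intro power_mono) auto
      thus ?thesis by (simp add: zeta_real_2 power2_eq_square)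
    qed
    finally show "zeta_real (w + 1/2) \<le> 2" .
  qed (use w in \<open>auto intro!: Gamma_real_nonneg order.strict_implies_order[OF zeta_real_pos] order.strict_implies_order[OF Gamma_real_pos]\<close>)
  finally have J: "norm (phi_series z) \<le> fact n / 2" by simp
  have "norm (Xi z) \<le> norm (1/2 :: complex) + norm (2 * (z - 1/4) * phi_series z)"
    unfolding Xi_def by (rule norm_triangle_ineq)
  also have "norm (2 * (z - 1/4) * phi_series z) = 2 * norm (z - 1/4) * norm (phi_series z)"
    by (simp only: norm_mult norm_numeral)
  also have "\<dots> \<le> 2 * (norm z + 1) * (fact n / 2)"
  proof (intro mult_mono J)
    have "norm (z - 1/4) \<le> norm z + norm (1/4 :: complex)" by (rule norm_triangle_ineq4)
    thus "norm (z - 1/4) \<le> norm z + 1" by simp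
  qed auto
  finally show ?thesis by (simp add: field_simps)
qed

section \<open>Identification with the Riemann zeta and xi functions\<close>

lemma dirichlet_series_derivative:
  obtains D D' :: "complex \<Rightarrow> complex" where
    "\<And>s. Re s > 1 \<Longrightarrow> (\<lambda>n. of_nat (Suc n) powr (- s)) sums D s"
    "\<And>s. Re s > 1 \<Longrightarrow> (\<lambda>n. - of_real (ln (real (Suc n))) * of_nat (Suc n) powr (- s)) sums D' s"
    "\<And>s. Re s > 1 \<Longrightarrow> (D has_field_derivative D' s) (at s)"
proof -
  have "\<exists>D D'. \<forall>s\<in>{s::complex. Re s > 1}. (\<lambda>n. of_nat (Suc n) powr (- s)) sums D s \<and>
     (\<lambda>n. - of_real (ln (real (Suc n))) * of_nat (Suc n) powr (- s)) sums D' s \<and> (D has_field_derivative D' s) (at s)"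
  proof (rule series_and_derivative_comparison_complex)
    show "open {s. Re s > 1}" by (rule open_halfspace_Re_gt)
    show "((\<lambda>s. of_nat (Suc n) powr (- s)) has_field_derivative - of_real (ln (real (Suc n))) * of_nat (Suc n) powr (- s)) (at s)" for n and s :: complex
    proof -
      have "((\<lambda>s. of_nat (Suc n) powr (- s)) has_field_derivative (Ln (of_nat (Suc n)) * of_nat (Suc n) powr (- s)) * (- 1)) (at s)"
        by (rule DERIV_chain2[OF has_field_derivative_powr_right])
           (auto intro!: derivative_eq_intros simp del: of_nat_Suc)
      thus ?thesis using Ln_of_nat[of "Suc n"] by (simp del: of_nat_Suc)
    qed
    fix x :: complex assume x: "x \<in> {s. Re s > 1}"
    \<comment> \<open>On the ball of radius \<open>d\<close> around x real parts stay at least 1 +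
      d, so the convergent series with exponent 1 + d dominates.\<close>
    define d where "d = (Re x - 1) / 2"
    have d: "d > 0" using x by (simp add: d_def)
    have "summable (\<lambda>n. complex_of_real (real (Suc n) powr (- (1 + d))))"
      using summable_zeta_real[of "1 + d"] d by (intro summable_of_real) auto
    moreover have "range (\<lambda>n. complex_of_real (real (Suc n) powr (- (1 + d)))) \<subseteq> \<real>\<^sub>\<ge>\<^sub>0" by auto
    moreover have "cmod (of_nat (Suc n) powr (- y)) \<le> cmod (complex_of_real (real (Suc n) powr (- (1 + d))))" if "y \<in> ball x d" for n y
    proof -
      have "\<bar>Re x - Re y\<bar> \<le> dist x y" using abs_Re_le_cmod[of "x - y"] by (simp add: dist_norm)
      hence "Re y \<ge> 1 + d" using that unfolding d_def by (simp add: field_simps)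
      hence "real (Suc n) powr (- Re y) \<le> real (Suc n) powr (- (1 + d))" by (intro powr_mono) auto
      moreover have "cmod (of_nat (Suc n) powr (- y)) = real (Suc n) powr (- Re y)"
        using norm_powr_real_powr[of "of_nat (Suc n)" "- y"] by (simp del: of_nat_Suc)
      ultimately show ?thesis by simp
    qed
    ultimately show "\<exists>d h. 0 < d \<and> summable h \<and> range h \<subseteq> \<real>\<^sub>\<ge>\<^sub>0 \<and> (\<forall>\<^sub>F n in sequentially. \<forall>y\<in>ball x d \<inter> {s. Re s > 1}. cmod (of_nat (Suc n) powr (- y)) \<le> cmod (h n))"
      using d by (intro exI[of _ d] exI[of _ "\<lambda>n. complex_of_real (real (Suc n) powr (- (1 + d)))"]) auto
  qed
  thus ?thesis using that by blast
qed

lemma of_nat_powr_of_real: "of_nat (Suc n) powr (- complex_of_real s) = of_real (real (Suc n) powr (- s))"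
  using powr_of_real[of "real (Suc n)" "- s"] by (simp del: of_nat_Suc)

text \<open>Inherited from the complex series by restricting to the real axis and taking real
  parts.\<close>

lemma zeta_real_has_derivative:
  assumes s: "s > 1"
  shows "summable (\<lambda>n. ln (real (Suc n)) * real (Suc n) powr (- s))"
    and "(zeta_real has_real_derivative - (\<Sum>n. ln (real (Suc n)) * real (Suc n) powr (- s))) (at s)"
proof -
  obtain D D' :: "complex \<Rightarrow> complex" where D:
    "\<And>s. Re s > 1 \<Longrightarrow> (\<lambda>n. of_nat (Suc n) powr (- s)) sums D s"
    "\<And>s. Re s > 1 \<Longrightarrow> (\<lambda>n. - of_real (ln (real (Suc n))) * of_nat (Suc n) powr (- s)) sums D' s"
    "\<And>s. Re s > 1 \<Longrightarrow> (D has_field_derivative D' s) (at s)"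
    using dirichlet_series_derivative by blast
  have "(\<lambda>n. complex_of_real (- (ln (real (Suc n)) * real (Suc n) powr (- s)))) sums D' (of_real s)"
    using D(2)[of "of_real s"] s unfolding of_nat_powr_of_real by simp
  hence D's: "(\<lambda>n. - (ln (real (Suc n)) * real (Suc n) powr (- s))) sums Re (D' (of_real s))"
    using sums_Re by fastforce
  thus summ: "summable (\<lambda>n. ln (real (Suc n)) * real (Suc n) powr (- s))"
    using summable_minus_iff sums_summable by blast
  have ReD': "Re (D' (of_real s)) = - (\<Sum>n. ln (real (Suc n)) * real (Suc n) powr (- s))"
    using sums_unique2[OF D's sums_minus[OF summable_sums[OF summ]]] .
  have DZ: "D (of_real x) = of_real (zeta_real x)" if "x > 1" for x
  proof -
    have "(\<lambda>n. complex_of_real (real (Suc n) powr (- x))) sums of_real (zeta_real x)"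
      unfolding zeta_real_def using that by (intro sums_of_real summable_sums summable_zeta_real)
    moreover have "(\<lambda>n. complex_of_real (real (Suc n) powr (- x))) sums D (of_real x)"
      using D(1)[of "of_real x"] that unfolding of_nat_powr_of_real by simp
    ultimately show ?thesis by (rule sums_unique2[symmetric])
  qed
  have "((\<lambda>x. D (of_real x)) has_vector_derivative D' (of_real s)) (at s)"
    using D(3)[of "of_real s"] s by (intro has_vector_derivative_real_field) auto
  hence "((\<lambda>x. Re (D (of_real x))) has_real_derivative Re (D' (of_real s))) (at s)"
    by (auto simp: has_vector_derivative_complex_iff)
  hence A: "((\<lambda>x. Re (D (of_real x))) has_real_derivative - (\<Sum>n. ln (real (Suc n)) * real (Suc n) powr (- s))) (at s)"
    unfolding ReD' .
  have "eventually (\<lambda>x. x > 1) (nhds s)" using s eventually_nhds_in_open[of "{1<..}" s] by simp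
  hence E: "eventually (\<lambda>x. Re (D (of_real x)) = zeta_real x) (nhds s)"
    by eventually_elim (simp add: DZ)
  show "(zeta_real has_real_derivative - (\<Sum>n. ln (real (Suc n)) * real (Suc n) powr (- s))) (at s)"
    by (rule DERIV_cong_ev[OF refl E refl, THEN iffD1, OF A])
qed

text \<open>The algebra of dividing xi by its prefactor, where g is Gamma (s / 2), p and q are
  opposite powers of pi, and s / 2 * g is Gamma (s / 2 + 1). It is stated over a field to cover real
  and complex s at once.\<close>

lemma xi_prefactor_cancel:
  fixes s :: "'a :: field_char_0"
  assumes "s \<noteq> 0" "s \<noteq> 1" "g \<noteq> 0" "p * q = 1"
  shows "s * (s - 1) / 2 * p * g * z * q * inverse (s / 2 * g) / (s - 1) = z"
proof -
  have "s * (s - 1) / 2 * p * g * z * q * inverse (s / 2 * g) / (s - 1) = (p * q) * z"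
    using assms(1-3) by (simp add: divide_simps)
  thus ?thesis using assms(4) by simp
qed

text \<open>xi divided by its prefactor, with s / 2 * Gamma (s / 2) merged into Gamma (s / 2 + 1).
  The reciprocal of Gamma is entire, which leaves s = 1 as the only possible singularity.\<close>

definition zeta_cont :: "complex \<Rightarrow> complex" where
  "zeta_cont s = Xi ((s - 1/2)\<^sup>2) * of_real pi powr (s / 2) * rGamma (s / 2 + 1) / (s - 1)"

lemma zeta_cont_of_real:
  assumes s: "s > 1"
  shows "zeta_cont (of_real s) = of_real (zeta_real s)"
proof -
  have "(complex_of_real s - 1/2)\<^sup>2 = of_real ((s - 1/2)\<^sup>2)" by simp
  hence Xi: "Xi ((complex_of_real s - 1/2)\<^sup>2) = of_real (xi_real s)"
    using Xi_of_real_square[of "s - 1/2"] s by (simp del: of_real_power of_real_diff)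
  have "complex_of_real pi powr (of_real s / 2) = of_real (pi powr (s / 2))"
    using powr_of_real[of pi "s / 2"] by simp
  moreover have "rGamma (complex_of_real s / 2 + 1) = of_real (rGamma (s / 2 + 1))"
    using rGamma_complex_of_real[of "s / 2 + 1"] by simp
  ultimately have "zeta_cont (of_real s) = of_real (xi_real s * pi powr (s / 2) * rGamma (s / 2 + 1) / (s - 1))"
    unfolding zeta_cont_def Xi by simp
  also have "xi_real s * pi powr (s / 2) * rGamma (s / 2 + 1) / (s - 1) = zeta_real s"
  proof -
    have "s / 2 > 0" using s by simp
    hence "Gamma (s / 2 + 1) = s / 2 * Gamma (s / 2)" 
      using Gamma_plus1[of "s / 2"] nonpos_Ints_nonpos[of "s/2"] by force
    hence "rGamma (s / 2 + 1) = inverse (s / 2 * Gamma (s / 2))" by (simp only: rGamma_inverse_Gamma)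
    moreover have "Gamma (s / 2) \<noteq> 0" using Gamma_real_pos[of "s / 2"] s by linarith
    moreover have "pi powr (- s / 2) * pi powr (s / 2) = 1" by (simp add: powr_add[symmetric])
    ultimately show ?thesis using s xi_prefactor_cancel[of s "Gamma (s / 2)" "pi powr (- s / 2)" "pi powr (s / 2)" "zeta_real s"]
      unfolding xi_real_def by simp
  qed
  finally show ?thesis .
qed

lemma zeta_cont_holomorphic: "zeta_cont holomorphic_on (- {1})"
  unfolding zeta_cont_def[abs_def]
  by (intro holomorphic_intros holomorphic_on_compose_gen[OF _ Xi_holomorphic[of UNIV], unfolded o_def]) auto

text \<open>Sum and continuation are both holomorphic on Re s > 1 and agree for real s > 1, a set
  accumulating at 2.\<close>

lemma zeta_cont_sums:
  assumes s: "Re s > 1"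
  shows "(\<lambda>n. of_nat (Suc n) powr (- s)) sums zeta_cont s"
proof -
  obtain D D' :: "complex \<Rightarrow> complex" where D:
    "\<And>s. Re s > 1 \<Longrightarrow> (\<lambda>n. of_nat (Suc n) powr (- s)) sums D s"
    "\<And>s. Re s > 1 \<Longrightarrow> (D has_field_derivative D' s) (at s)"
    using dirichlet_series_derivative by metis
  define S where "S = {s::complex. Re s > 1}"
  have "D s - zeta_cont s = 0"
  proof (rule analytic_continuation[where f = "\<lambda>s. D s - zeta_cont s" and S = S and U = "of_real ` {1<..}" and \<xi> = 2])
    have "D holomorphic_on S" using D(2) 
      by (auto simp: holomorphic_on_def field_differentiable_def S_def intro: has_field_derivative_at_within)
    moreover have "zeta_cont holomorphic_on S"
      by (rule holomorphic_on_subset[OF zeta_cont_holomorphic]) (auto simp: S_def)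
    ultimately show "(\<lambda>s. D s - zeta_cont s) holomorphic_on S" by (intro holomorphic_intros)
    show "open S" by (simp add: S_def open_halfspace_Re_gt)
    show "connected S" by (simp add: S_def convex_connected convex_halfspace_Re_gt)
    show "(2::complex) islimpt of_real ` {1<..}"
      unfolding islimpt_approachable
    proof (intro allI impI)
      fix e :: real assume e: "e > 0"
      show "\<exists>x'\<in>of_real ` {1<..}. x' \<noteq> (2::complex) \<and> dist x' 2 < e"
      proof (rule bexI[of _ "of_real (2 + e / 2)"])
        have "dist (complex_of_real (2 + e / 2)) 2 = \<bar>e / 2\<bar>"
          by (simp add: dist_norm norm_divide)
        moreover have "complex_of_real (2 + e / 2) \<noteq> of_real 2" using e by (subst of_real_eq_iff) auto
        ultimately show "complex_of_real (2 + e / 2) \<noteq> 2 \<and> dist (complex_of_real (2 + e / 2)) 2 < e"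
          using e by simp
        show "complex_of_real (2 + e / 2) \<in> of_real ` {1<..}"
          by (rule imageI) (use e in simp)
      qed
    qed
    fix z :: complex assume "z \<in> of_real ` {1<..}"
    then obtain x where x: "x > 1" "z = of_real x" by auto
    have "(\<lambda>n. complex_of_real (real (Suc n) powr (- x))) sums of_real (zeta_real x)"
      unfolding zeta_real_def using x by (intro sums_of_real summable_sums summable_zeta_real)
    moreover have "(\<lambda>n. complex_of_real (real (Suc n) powr (- x))) sums D (of_real x)"
      using D(1)[of "of_real x"] x unfolding of_nat_powr_of_real by simp
    ultimately have "D (of_real x) = of_real (zeta_real x)" by (rule sums_unique2[symmetric])
    thus "D z - zeta_cont z = 0" using x zeta_cont_of_real by simp
  qed (use s in \<open>auto simp: S_def\<close>)
  thus ?thesis using D(1)[OF s] by simp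
qed

lemma connected_punctured_plane: "connected (- {1 :: complex})"
  by (intro connected_punctured_universe) simp

text \<open>\<open>Z\<close> meets the defining conditions, and any competitor agrees with it on Re
  s > 1, hence on the punctured plane, which is connected.\<close>

lemma riemann_zeta_eq:
  assumes s: "s \<noteq> 1"
  shows "riemann_zeta s = zeta_cont s"
proof -
  define Z where "Z s = (if s = 1 then 0 else zeta_cont s)" for s
  have eq: "riemann_zeta = Z"
    unfolding riemann_zeta_def
  proof (rule the_equality)
    have "Z holomorphic_on (- {1})"
      by (rule holomorphic_transform[OF zeta_cont_holomorphic]) (auto simp: Z_def)
    moreover have "(\<lambda>n. of_nat (Suc n) powr (- s)) sums Z s" if "Re s > 1" for s
      using zeta_cont_sums[OF that] that by (auto simp: Z_def)
    ultimately show Z: "Z holomorphic_on (- {1}) \<and> (\<forall>s. Re s > 1 \<longrightarrow> (\<lambda>n. of_nat (Suc n) powr (- s)) sums Z s) \<and> Z 1 = 0"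
      by (auto simp: Z_def)
    fix f assume f: "f holomorphic_on (- {1}) \<and> (\<forall>s. Re s > 1 \<longrightarrow> (\<lambda>n. of_nat (Suc n) powr (- s)) sums f s) \<and> f 1 = 0"
    show "f = Z"
    proof
      fix s
      show "f s = Z s"
      proof (cases "s = 1")
        case False
        have holo: "(\<lambda>s. f s - Z s) holomorphic_on (- {1})" using f Z by (intro holomorphic_intros) auto
        have "f s - Z s = 0"
        proof (rule analytic_continuation_open[where f = "\<lambda>s. f s - Z s" and g = "\<lambda>_. 0" and s = "{s. Re s > 1}" and s' = "- {1}"])
          show "f z - Z z = 0" if "z \<in> {s. Re s > 1}" for z
            using f Z that sums_unique2 by fastforce
          have "2 \<in> {s::complex. Re s > 1}" by simp
          thus "{s::complex. Re s > 1} \<noteq> {}" by blast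
          show "{s::complex. Re s > 1} \<subseteq> - {1}" by auto
        qed (use holo False connected_punctured_plane in \<open>auto simp: open_halfspace_Re_gt\<close>)
        thus ?thesis by simp
      qed (use f Z in auto)
    qed
  qed
  show ?thesis unfolding eq Z_def using s by simp
qed

text \<open>All exceptional points of the product defining xi are integers: 0, 1 and the poles 0,
  -2, -4, ... of Gamma (s / 2). Avoiding the integers avoids them together.\<close>

lemma eventually_not_Ints: "eventually (\<lambda>z::complex. z \<notin> \<int>) (at s)"
proof (cases "s \<in> \<int>")
  case True
  show ?thesis unfolding eventually_at
  proof (intro exI[of _ 1] conjI ballI impI notI)
    fix x :: complex assume x: "x \<noteq> s \<and> dist x s < 1" "x \<in> \<int>"
    hence "x - s \<in> \<int>" "x - s \<noteq> 0" using True by auto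
    obtain k :: int where k: "x - s = of_int k" using \<open>x - s \<in> \<int>\<close> by (auto elim!: Ints_cases)
    with \<open>x - s \<noteq> 0\<close> have "k \<noteq> 0" by auto
    hence "1 \<le> \<bar>real_of_int k\<bar>" by linarith
    with k show False using x by (simp add: dist_norm)
  qed auto
next
  case False
  have "eventually (\<lambda>z. z \<in> - \<int>) (nhds s)"
    using False by (intro eventually_nhds_in_open) (auto simp: closed_Ints open_Compl)
  thus ?thesis by (auto intro: filter_leD[OF at_within_le_nhds] elim!: eventually_mono)
qed

text \<open>Off the integers the prefactor cancels; continuity of the right-hand side then makes it
  the limit that \<open>remove_sings\<close> returns, also at the removable singularities.\<close>

theorem riemann_xi_eq: "riemann_xi s = Xi ((s - 1/2)\<^sup>2)"
  unfolding riemann_xi_def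
proof (rule remove_sings_eqI)
  have cont: "isCont (\<lambda>s. Xi ((s - 1/2)\<^sup>2)) s"
  proof -
    have "(\<lambda>s. Xi ((s - 1/2)\<^sup>2)) holomorphic_on UNIV"
      by (intro holomorphic_intros holomorphic_on_compose_gen[OF _ Xi_holomorphic[of UNIV], unfolded o_def]) auto
    thus ?thesis using holomorphic_on_imp_continuous_on continuous_on_eq_continuous_at open_UNIV by blast
  qed
  have ev: "eventually (\<lambda>s. Xi ((s - 1/2)\<^sup>2) = 1 / 2 * s * (s - 1) * of_real pi powr (- s / 2) *
     Gamma (s / 2) * riemann_zeta s) (at s)"
    using eventually_not_Ints[of s]
  proof eventually_elim
    case (elim s)
    have s1: "s \<noteq> 1" using elim by auto
    have s2: "s / 2 \<notin> \<int>\<^sub>\<le>\<^sub>0"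
    proof
      assume "s / 2 \<in> \<int>\<^sub>\<le>\<^sub>0"
      hence "s / 2 + s / 2 \<in> \<int>" by (intro Ints_add) (auto elim: nonpos_Ints_cases)
      thus False using elim by simp
    qed
    have s0: "s \<noteq> 0" using elim by auto
    have "rGamma (s / 2 + 1) = inverse (s / 2 * Gamma (s / 2))"
      by (simp only: rGamma_inverse_Gamma Gamma_plus1[OF s2])
    moreover have "Gamma (s / 2) \<noteq> 0" using s2 by (simp add: Gamma_eq_zero_iff)
    moreover have "of_real pi powr (- s / 2) * of_real pi powr (s / 2) = (1::complex)"
      by (simp add: powr_add[symmetric])
    ultimately have c: "s * (s - 1) / 2 * of_real pi powr (- s / 2) * Gamma (s / 2) * Xi ((s - 1/2)\<^sup>2) *
        of_real pi powr (s / 2) * rGamma (s / 2 + 1) / (s - 1) = Xi ((s - 1/2)\<^sup>2)"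
      using s0 s1 xi_prefactor_cancel[of s "Gamma (s / 2)" "of_real pi powr (- s / 2)" "of_real pi powr (s / 2)" "Xi ((s - 1/2)\<^sup>2)"]
      by simp
    show ?case
      unfolding riemann_zeta_eq[OF s1] zeta_cont_def by (subst c[symmetric]) (simp add: mult_ac)
  qed
  show "(\<lambda>s. 1 / 2 * s * (s - 1) * of_real pi powr (- s / 2) * Gamma (s / 2) * riemann_zeta s) \<midarrow>s\<rightarrow> Xi ((s - 1/2)\<^sup>2)"
    using cont tendsto_cong[OF ev] by (simp add: isCont_def)
qed

section \<open>The logarithmic derivative of xi\<close>

text \<open>The extra index 0 adds nothing, because \<open>0 powr x\<close> is 0.\<close>

lemma sums_real_powr: "s > 1 \<Longrightarrow> (\<lambda>n. real n powr (- s)) sums zeta_real s"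
  using summable_sums[OF summable_zeta_real[of s]] sums_Suc_iff[of "\<lambda>n. real n powr (- s)" "zeta_real s"]
  by (simp add: zeta_real_def)

lemma sums_ln_powr:
  "s > 1 \<Longrightarrow> (\<lambda>n. ln (real n) * real n powr (- s)) sums (\<Sum>n. ln (real (Suc n)) * real (Suc n) powr (- s))"
  using summable_sums[OF zeta_real_has_derivative(1)[of s]]
    sums_Suc_iff[of "\<lambda>n. ln (real n) * real n powr (- s)" "\<Sum>n. ln (real (Suc n)) * real (Suc n) powr (- s)"]
  by simp

lemma summable_mangoldt_powr:
  assumes "s > 1"
  shows "summable (\<lambda>n. mangoldt n * real n powr (- s) :: real)"
proof (rule summable_comparison_test')
  show "summable (\<lambda>n. ln (real n) * real n powr (- s))" using sums_ln_powr[OF assms] by (simp add: sums_iff)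
  show "norm (mangoldt n * real n powr (- s)) \<le> ln (real n) * real n powr (- s)" for n
    by (cases "n = 0") (auto simp: abs_mult mangoldt_le intro!: mult_right_mono)
qed

text \<open>The Dirichlet convolution of the von Mangoldt function with 1 is the logarithm.
  Nonnegativity permits regrouping the double sum by the product of the two indices.\<close>

lemma mangoldt_zeta_real:
  assumes s: "s > 1"
  shows "(\<Sum>n. mangoldt n * real n powr (- s)) * zeta_real s = (\<Sum>n. ln (real (Suc n)) * real (Suc n) powr (- s))"
proof -
  \<comment> \<open>0 is left out because every d divides it; all the functions summed here vanish
    at 0.\<close>
  define A where "A = {1::nat..}"
  define f where "f n = (mangoldt n * real n powr (- s) :: real)" for n
  define g where "g n = real n powr (- s)" for n
  have f0: "f n \<ge> 0" and g0: "g n \<ge> 0" for n by (auto simp: f_def g_def mangoldt_nonneg)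
  have restr: "(h has_sum S) A" if "(h has_sum S) UNIV" "h 0 = 0" for h :: "nat \<Rightarrow> real" and S
  proof -
    have "(h has_sum S) UNIV \<longleftrightarrow> (h has_sum S) A"
      by (rule has_sum_cong_neutral) (use that(2) in \<open>auto simp: A_def not_less_eq_eq\<close>)
    thus ?thesis using that(1) by blast
  qed
  have f: "(f has_sum (\<Sum>n. f n)) A"
    using summable_mangoldt_powr[OF s] f0 by (intro restr sums_nonneg_imp_has_sum) (auto simp: f_def[abs_def])
  have g: "(g has_sum zeta_real s) A"
    using sums_real_powr[OF s] g0 by (intro restr sums_nonneg_imp_has_sum) (auto simp: g_def[abs_def])
  have l: "((\<lambda>n. ln (real n) * real n powr (- s)) has_sum (\<Sum>n. ln (real (Suc n)) * real (Suc n) powr (- s))) A"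
  proof (intro restr sums_nonneg_imp_has_sum sums_ln_powr s)
    show "ln (real n) * real n powr (- s) \<ge> 0" for n by (cases "n = 0") auto
  qed auto
  have inner: "((\<lambda>b. f a * g b) has_sum f a * zeta_real s) A" for a
    by (intro has_sum_cmult_right g)
  have outer: "((\<lambda>a. f a * zeta_real s) has_sum (\<Sum>n. f n) * zeta_real s) A"
    by (intro has_sum_cmult_left f)
  have "(\<lambda>(a, b). f a * g b) summable_on A \<times> A"
    by (rule summable_on_SigmaI[where g = "\<lambda>a. f a * zeta_real s"])
       (use inner outer f0 g0 in \<open>auto simp: summable_on_def\<close>)
  hence pairs: "((\<lambda>(a, b). f a * g b) has_sum (\<Sum>n. f n) * zeta_real s) (A \<times> A)"
    by (intro has_sum_SigmaI[where g = "\<lambda>a. f a * zeta_real s"]) (use inner outer in auto)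
  have "((\<lambda>(n, d). f d * g (n div d)) has_sum (\<Sum>n. f n) * zeta_real s) (Sigma A (\<lambda>n. {d. d dvd n}))"
    using pairs
  proof (rule has_sum_reindex_bij_witness[where i = "\<lambda>(a, b). (a * b, a)" and j = "\<lambda>(n, d). (d, n div d)", THEN iffD2, rotated -1])
  qed (auto simp: A_def elim!: dvdE simp: not_less_eq_eq Suc_le_eq)
  hence "((\<lambda>n. \<Sum>d | d dvd n. f d * g (n div d)) has_sum (\<Sum>n. f n) * zeta_real s) A"
    by (rule has_sum_Sigma') (auto intro!: has_sum_finite simp: A_def)
  also have "?this \<longleftrightarrow> ((\<lambda>n. ln (real n) * real n powr (- s)) has_sum (\<Sum>n. f n) * zeta_real s) A"
  proof (rule has_sum_cong)
    fix n assume n: "n \<in> A"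
    have "(\<Sum>d | d dvd n. f d * g (n div d)) = (\<Sum>d | d dvd n. mangoldt d * real n powr (- s))"
    proof (rule sum.cong)
      fix d assume "d \<in> {d. d dvd n}"
      then obtain k where k: "n = d * k" by auto
      hence "real n powr (- s) = real d powr (- s) * real k powr (- s)" by (simp add: powr_mult)
      thus "f d * g (n div d) = mangoldt d * real n powr (- s)"
        using k n by (auto simp: f_def g_def A_def)
    qed auto
    also have "\<dots> = ln (real n) * real n powr (- s)"
      using n by (simp add: sum_distrib_right[symmetric] mangoldt_sum A_def)
    finally show "(\<Sum>d | d dvd n. f d * g (n div d)) = ln (real n) * real n powr (- s)" .
  qed
  finally show ?thesis using l unfolding f_def using has_sum_unique by blast
qed

text \<open>xi' / xi for s > 1, with zeta' / zeta written as minus the von Mangoldt series.\<close>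

definition xi_logderiv :: "real \<Rightarrow> real" where
  "xi_logderiv s = 1 / s + 1 / (s - 1) + (Digamma (s / 2) - ln pi) / 2 - (\<Sum>n. mangoldt n * real n powr (- s))"

lemma xi_real_has_derivative:
  assumes s: "s > 1"
  shows "(xi_real has_real_derivative xi_real s * xi_logderiv s) (at s)"
proof -
  define M where "M = (\<Sum>n. mangoldt n * real n powr (- s))"
  have z: "(zeta_real has_real_derivative - (M * zeta_real s)) (at s)"
    using zeta_real_has_derivative(2)[OF s] mangoldt_zeta_real[OF s] by (simp add: M_def)
  have np: "s / 2 \<notin> \<int>\<^sub>\<le>\<^sub>0" using s nonpos_Ints_nonpos[of "s / 2"] by force
  have G: "((\<lambda>s. Gamma (s / 2)) has_real_derivative (Gamma (s / 2) * Digamma (s / 2)) / 2) (at s)"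
    using np by (auto intro!: derivative_eq_intros)
  have P: "((\<lambda>s. pi powr (- s / 2)) has_real_derivative - (pi powr (- s / 2) * ln pi / 2)) (at s)"
    by (auto intro!: derivative_eq_intros)
  have Q: "((\<lambda>s::real. s * (s - 1) / 2) has_real_derivative (2 * s - 1) / 2) (at s)"
    by (auto intro!: derivative_eq_intros simp: field_simps)
  define p g dg z where "p = pi powr (- s / 2)" and "g = Gamma (s / 2)" and "dg = Digamma (s / 2)" and "z = zeta_real s"
  have "(xi_real has_real_derivative
    ((((2 * s - 1) / 2 * p + - (p * ln pi / 2) * (s * (s - 1) / 2)) * g
     + (g * dg) / 2 * (s * (s - 1) / 2 * p)) * z
     + - (M * z) * (s * (s - 1) / 2 * p * g))) (at s)"
    unfolding xi_real_def[abs_def] p_def g_def dg_def z_def by (intro DERIV_mult Q P G z)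
  moreover have "(((2 * s - 1) / 2 * p + - (p * ln pi / 2) * (s * (s - 1) / 2)) * g
     + (g * dg) / 2 * (s * (s - 1) / 2 * p)) * z
     + - (M * z) * (s * (s - 1) / 2 * p * g) = xi_real s * xi_logderiv s"
    unfolding xi_real_def xi_logderiv_def M_def[symmetric] p_def[symmetric] g_def[symmetric] dg_def[symmetric] z_def[symmetric]
    using s by (simp add: field_simps)
  ultimately show ?thesis by simp
qed

text \<open>The derivative of x |-> Xi (x^2) along the real axis is computed twice, by the chain
  rule for \<open>Xi\<close> and through \<open>xi_real\<close>.\<close>

lemma xi_real_logderiv_Xi:
  assumes w: "w > 1/2"
  shows "2 * of_real w * deriv Xi (of_real (w\<^sup>2)) / Xi (of_real (w\<^sup>2)) = of_real (xi_logderiv (w + 1/2))"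
proof -
  have D: "(Xi has_field_derivative deriv Xi z) (at z)" for z
    using Xi_holomorphic[of UNIV] by (intro holomorphic_derivI) auto
  have "((\<lambda>x. Xi (x\<^sup>2)) has_field_derivative deriv Xi ((of_real w)\<^sup>2) * (2 * of_real w)) (at (of_real w))"
    by (rule DERIV_chain2[OF D]) (auto intro!: derivative_eq_intros)
  from has_vector_derivative_real_field[OF this]
  have 1: "((\<lambda>x. Xi (of_real (x\<^sup>2))) has_vector_derivative deriv Xi (of_real (w\<^sup>2)) * (2 * of_real w)) (at w)"
    by simp
  have "((\<lambda>x. xi_real (x + 1/2)) has_real_derivative xi_real (w + 1/2) * xi_logderiv (w + 1/2) * 1) (at w)"
    by (rule DERIV_chain2[OF xi_real_has_derivative]) (use w in \<open>auto intro!: derivative_eq_intros\<close>)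
  hence 2: "((\<lambda>x. complex_of_real (xi_real (x + 1/2))) has_vector_derivative of_real (xi_real (w + 1/2) * xi_logderiv (w + 1/2))) (at w)"
    by (intro has_vector_derivative_of_real) (simp add: has_real_derivative_iff_has_vector_derivative)
  have 3: "((\<lambda>x. Xi (of_real (x\<^sup>2))) has_vector_derivative of_real (xi_real (w + 1/2) * xi_logderiv (w + 1/2))) (at w)"
    by (rule has_vector_derivative_transform_within_open[OF 2, of "{1/2<..}"])
       (use w Xi_of_real_square in auto)
  have "deriv Xi (of_real (w\<^sup>2)) * (2 * of_real w) = of_real (xi_real (w + 1/2) * xi_logderiv (w + 1/2))"
    using vector_derivative_unique_at[OF 1 3] .
  moreover have "xi_real (w + 1/2) \<noteq> 0" using xi_real_pos[of "w + 1/2"] w by simp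
  ultimately show ?thesis unfolding Xi_of_real_square[OF w] by (simp add: field_simps)
qed

lemma Digamma_diff_sums:
  fixes x y :: real
  assumes "x > 0" "y > 0"
  shows "(\<lambda>n. 1 / (y + real n) - 1 / (x + real n)) sums (Digamma x - Digamma y)"
proof -
  have "(\<lambda>n. inverse (real (Suc n)) - inverse (z + real n)) sums (Digamma z + euler_mascheroni)" if "z > 0" for z
    using summable_sums[OF summable_Digamma[of z]] that by (simp add: Digamma_def)
  from sums_diff[OF this[OF assms(1)] this[OF assms(2)]] show ?thesis
    by (simp add: inverse_eq_divide)
qed

section \<open>The Laplace transform of Psi\<close>

text \<open>The ramp is the second primitive of a point mass at L. For L = ln n the value is n^(-w)
  / w^2, one term of a Dirichlet series.\<close>

lemma has_bochner_integral_ramp: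
  fixes w L :: real
  assumes w: "w > 0"
  shows "has_bochner_integral lborel (\<lambda>t. indicator {L..} t * ((t - L) * exp (- w * t))) (exp (- w * L) / w\<^sup>2)"
proof (rule has_bochner_integral_nn_integral)
  define F where "F t = - ((t - L) / w + 1 / w\<^sup>2) * exp (- w * t)" for t
  have "(\<integral>\<^sup>+t. ennreal ((t - L) * exp (- w * t)) * indicator {L..} t \<partial>lborel) = 0 - F L"
  proof (rule nn_integral_FTC_atLeast)
    show "(F has_real_derivative (t - L) * exp (- w * t)) (at t)" for t
      unfolding F_def using w
      by (auto intro!: derivative_eq_intros simp: field_simps power2_eq_square)
    show "(F \<longlongrightarrow> 0) at_top" unfolding F_def using w by real_asymp
  qed auto
  also have "(\<integral>\<^sup>+t. ennreal ((t - L) * exp (- w * t)) * indicator {L..} t \<partial>lborel) =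
    (\<integral>\<^sup>+t. ennreal (indicator {L..} t * ((t - L) * exp (- w * t))) \<partial>lborel)"
    by (intro nn_integral_cong) (auto simp: indicator_def)
  finally show "(\<integral>\<^sup>+t. ennreal (indicator {L..} t * ((t - L) * exp (- w * t))) \<partial>lborel) = ennreal (exp (- w * L) / w\<^sup>2)"
    by (simp add: F_def)
qed (auto simp: indicator_def)

text \<open>The summand in \<open>Psi\<close>, extended by 0 below ln n, so that a sum whose range
  depends on t becomes a series over a fixed index set. At n = 0 division by \<open>sqrt 0\<close>
  makes it 0.\<close>

definition mangoldt_ramp :: "nat \<Rightarrow> real \<Rightarrow> real" where
  "mangoldt_ramp n t = mangoldt n / sqrt (real n) * (indicator {ln (real n)..} t * (t - ln (real n)))"

lemma mangoldt_ramp_eq_0: "n \<notin> {n. 1 \<le> n \<and> real n \<le> exp t} \<Longrightarrow> mangoldt_ramp n t = 0"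
proof (cases "n = 0")
  case False
  assume "n \<notin> {n. 1 \<le> n \<and> real n \<le> exp t}"
  hence "exp t < real n" using False by auto
  hence "t < ln (real n)" using False ln_less_cancel_iff[of "exp t" "real n"] by simp
  thus ?thesis by (simp add: mangoldt_ramp_def)
qed (simp add: mangoldt_ramp_def)

lemma finite_nat_le_real: "finite {n::nat. 1 \<le> n \<and> real n \<le> x}"
  by (rule finite_subset[of _ "{..nat \<lfloor>x\<rfloor>}"]) (auto simp: le_nat_floor)

lemma mangoldt_ramp_sum:
  "(\<Sum>n | 1 \<le> n \<and> real n \<le> exp t. mangoldt n / sqrt (real n) * (t - ln (real n))) =
   (\<Sum>n | 1 \<le> n \<and> real n \<le> exp t. mangoldt_ramp n t)"
proof (rule sum.cong)
  fix n assume "n \<in> {n. 1 \<le> n \<and> real n \<le> exp t}"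
  hence "ln (real n) \<le> t" using ln_le_cancel_iff[of "real n" "exp t"] by simp
  thus "mangoldt n / sqrt (real n) * (t - ln (real n)) = mangoldt_ramp n t"
    by (simp add: mangoldt_ramp_def)
qed auto

lemma mangoldt_ramp_sums:
  "(\<lambda>n. mangoldt_ramp n t) sums (\<Sum>n | 1 \<le> n \<and> real n \<le> exp t. mangoldt n / sqrt (real n) * (t - ln (real n)))"
  unfolding mangoldt_ramp_sum
  by (rule sums_finite[OF finite_nat_le_real]) (rule mangoldt_ramp_eq_0)

lemma mangoldt_ramp_nonneg: "mangoldt_ramp n t \<ge> 0"
  by (auto simp: mangoldt_ramp_def indicator_def mangoldt_nonneg)

text \<open>The weight 1 / sqrt n shifts the exponent from w to w + 1/2, so w > 1/2 is the half line
  of convergence of the Dirichlet series.\<close>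

lemma laplace_mangoldt_sum:
  assumes w: "w > 1 / 2"
  shows "has_bochner_integral lborel (\<lambda>t. indicator {0..} t * (exp (- w * t) *
      (\<Sum>n | 1 \<le> n \<and> real n \<le> exp t. mangoldt n / sqrt (real n) * (t - ln (real n)))))
    ((\<Sum>n. mangoldt n * real n powr (- (w + 1/2))) / w\<^sup>2)"
proof (rule has_bochner_integral_sums_nonneg)
  show "(\<lambda>n. indicator {0..} t * (exp (- w * t) * mangoldt_ramp n t)) sums
    (indicator {0..} t * (exp (- w * t) *
      (\<Sum>n | 1 \<le> n \<and> real n \<le> exp t. mangoldt n / sqrt (real n) * (t - ln (real n)))))" for t
    by (intro sums_mult mangoldt_ramp_sums)
  show "(\<lambda>n. mangoldt n * real n powr (- (w + 1/2)) / w\<^sup>2) sums ((\<Sum>n. mangoldt n * real n powr (- (w + 1/2))) / w\<^sup>2)"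
    using w by (intro sums_divide summable_sums summable_mangoldt_powr) auto
  show "indicator {0..} t * (exp (- w * t) * mangoldt_ramp n t) \<ge> 0" for n t
    by (intro mult_nonneg_nonneg mangoldt_ramp_nonneg) auto
  fix n :: nat
  show "has_bochner_integral lborel (\<lambda>t. indicator {0..} t * (exp (- w * t) * mangoldt_ramp n t)) 
      (mangoldt n * real n powr (- (w + 1/2)) / w\<^sup>2)"
  proof (cases "n = 0")
    case False
    have "has_bochner_integral lborel (\<lambda>t. mangoldt n / sqrt (real n) * (indicator {ln (real n)..} t * ((t - ln (real n)) * exp (- w * t))))
       (mangoldt n / sqrt (real n) * (exp (- w * ln (real n)) / w\<^sup>2))"
      by (intro has_bochner_integral_mult_right has_bochner_integral_ramp) (use w in auto)
    also have "exp (- w * ln (real n)) = real n powr (- w)" using False by (simp add: powr_def)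
    also have "mangoldt n / sqrt (real n) * (real n powr (- w) / w\<^sup>2) = mangoldt n * real n powr (- (w + 1/2)) / w\<^sup>2"
    proof -
      have "real n powr (- w - 1/2) = real n powr (- w) / sqrt (real n)"
        using False by (simp only: powr_diff powr_half_sqrt)
      moreover have "- (w + 1/2) = - w - 1/2" by simp
      ultimately show ?thesis by (simp only:) simp
    qed
    also have "(\<lambda>t. mangoldt n / sqrt (real n) * (indicator {ln (real n)..} t * ((t - ln (real n)) * exp (- w * t)))) = 
       (\<lambda>t. indicator {0..} t * (exp (- w * t) * mangoldt_ramp n t))"
    proof
      fix t
      \<comment> \<open>For n >= 1 the ramp starts at ln n >= 0, so the restriction to t >= 0 loses
        nothing.\<close>
      have "ln (real n) \<ge> 0" using False by simp
      hence "indicator {ln (real n)..} t = indicator {0..} t * (indicator {ln (real n)..} t :: real)"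
        by (auto simp: indicator_def)
      thus "mangoldt n / sqrt (real n) * (indicator {ln (real n)..} t * ((t - ln (real n)) * exp (- w * t))) =
         indicator {0..} t * (exp (- w * t) * mangoldt_ramp n t)"
        unfolding mangoldt_ramp_def by (simp add: mult_ac)
    qed
    finally show ?thesis .
  qed (simp add: mangoldt_ramp_def has_bochner_integral_zero)
qed

section \<open>The Lerch term\<close>

lemma summable_lerch_quarter: "summable (\<lambda>n. 1 / (real n + 1 / 4)\<^sup>2)"
proof (rule summable_comparison_test')
  have "summable (\<lambda>n. 1 / (real (n + 1))\<^sup>2)" using inverse_squares_sums by (simp add: sums_iff)
  thus "summable (\<lambda>n. 16 * (1 / (real (n + 1))\<^sup>2))" by (rule summable_mult)
  show "norm (1 / (real n + 1 / 4)\<^sup>2) \<le> 16 * (1 / (real (n + 1))\<^sup>2)" for n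
  proof -
    have "(real (n + 1) / 4)\<^sup>2 \<le> (real n + 1 / 4)\<^sup>2" by (intro power_mono) auto
    hence "1 / (real n + 1 / 4)\<^sup>2 \<le> 1 / (real (n + 1) / 4)\<^sup>2" by (intro divide_left_mono) auto
    thus ?thesis by (simp add: power_divide)
  qed
qed

lemma powr_minus_2: "x > 0 \<Longrightarrow> (x :: real) powr (- 2) = 1 / x\<^sup>2"
  by (simp add: powr_minus inverse_eq_divide)

lemma lerch_quarter_term:
  "exp (- t / 2) * ((real n + 1/4) powr (- 2) * exp (- 2 * t) ^ n) = 1 / (real n + 1/4)\<^sup>2 * exp (- (2 * real n + 1/2) * t)"
proof -
  have "exp (- t / 2) * exp (- 2 * t) ^ n = exp (- (2 * real n + 1/2) * t)"
    by (simp add: exp_of_nat_mult[symmetric] exp_add[symmetric] algebra_simps)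
  moreover have "(real n + 1/4) powr (- 2) = 1 / (real n + 1/4)\<^sup>2"
    by (rule powr_minus_2) simp
  ultimately show ?thesis by (simp add: mult_ac)
qed

lemma lerch_quarter_bound:
  assumes "t \<ge> 0"
  shows "norm ((real n + 1/4) powr (- 2) * exp (- 2 * t) ^ n) \<le> 1 / (real n + 1/4)\<^sup>2"
proof -
  have "exp (- 2 * t) ^ n \<le> 1" using assms by (intro power_le_one) auto
  moreover have "(real n + 1/4) powr (- 2) = 1 / (real n + 1/4)\<^sup>2"
    by (rule powr_minus_2) simp
  ultimately show ?thesis using mult_left_mono[of "exp (- 2 * t) ^ n" 1 "1 / (real n + 1/4)\<^sup>2"] by (simp add: abs_mult)
qed

lemma lerch_quarter_sums:
  assumes t: "t \<ge> 0"
  shows "(\<lambda>n. 1 / (real n + 1/4)\<^sup>2 * exp (- (2 * real n + 1/2) * t)) sums (exp (- t / 2) * lerch_phi (exp (- 2 * t)) 2 (1 / 4))"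
  unfolding lerch_phi_def lerch_quarter_term[symmetric]
  by (intro sums_mult summable_sums summable_comparison_test'[OF summable_lerch_quarter lerch_quarter_bound] t)

text \<open>With m = n + 1/4 the terms 1 / (m^2 (w + 2 m)) split into 1 / (m^2 w) and - 2 / w^2
  times 1 / m - 1 / (w / 2 + m); the latter sum to a difference of digamma values.\<close>

lemma laplace_lerch_quarter:
  fixes w :: real
  assumes w: "w > 0"
  defines "B \<equiv> (\<Sum>n. 1 / (real n + 1/4)\<^sup>2) / w - 2 * (Digamma (w / 2 + 1 / 4) - Digamma (1 / 4)) / w\<^sup>2"
  shows "has_bochner_integral lborel (\<lambda>t. indicator {0..} t * (exp (- w * t) * (exp (- t / 2) * lerch_phi (exp (- 2 * t)) 2 (1 / 4)))) B"
proof (rule has_bochner_integral_sums_nonneg)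
  define m where "m n = real n + 1/4" for n :: nat
  have m: "m n > 0" for n by (simp add: m_def)
  show "(\<lambda>n. 1 / (m n)\<^sup>2 * (indicator {0..} t * exp (- (w + 2 * m n) * t))) sums
    (indicator {0..} t * (exp (- w * t) * (exp (- t / 2) * lerch_phi (exp (- 2 * t)) 2 (1 / 4))))" for t
  proof (cases "t \<ge> 0")
    case True
    have "exp (- w * t) * (1 / (real n + 1/4)\<^sup>2 * exp (- (2 * real n + 1/2) * t)) = 1 / (m n)\<^sup>2 * exp (- (w + 2 * m n) * t)" for n
      by (simp add: m_def exp_add[symmetric] algebra_simps)
    with sums_mult[OF lerch_quarter_sums[OF True], of "exp (- w * t)"] True show ?thesis by simp
  qed auto
  show "1 / (m n)\<^sup>2 * (indicator {0..} t * exp (- (w + 2 * m n) * t)) \<ge> 0" for n t by simp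
  show "has_bochner_integral lborel (\<lambda>t. 1 / (m n)\<^sup>2 * (indicator {0..} t * exp (- (w + 2 * m n) * t))) (1 / (m n)\<^sup>2 * (1 / (w + 2 * m n)))" for n
    by (intro has_bochner_integral_mult_right has_bochner_integral_exp_minus) (use w m[of n] in linarith)
  have "(\<lambda>n. 1 / (m n)\<^sup>2 / w - 2 / w\<^sup>2 * (1 / (1 / 4 + real n) - 1 / ((w / 2 + 1 / 4) + real n))) sums
     ((\<Sum>n. 1 / (m n)\<^sup>2) / w - 2 / w\<^sup>2 * (Digamma (w / 2 + 1 / 4) - Digamma (1 / 4)))"
    using w by (intro sums_diff sums_divide sums_mult Digamma_diff_sums summable_sums) 
       (auto simp: m_def summable_lerch_quarter)
  also have "(\<lambda>n. 1 / (m n)\<^sup>2 / w - 2 / w\<^sup>2 * (1 / (1 / 4 + real n) - 1 / ((w / 2 + 1 / 4) + real n))) = 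
     (\<lambda>n. 1 / (m n)\<^sup>2 * (1 / (w + 2 * m n)))"
  proof
    fix n
    have "1 / a\<^sup>2 / w - 2 / w\<^sup>2 * (1 / a - 1 / (w / 2 + a)) = 1 / a\<^sup>2 * (1 / (w + 2 * a))" if "a > 0" for a
    proof -
      have "1 / a - 1 / (w / 2 + a) = w / (a * (w + 2 * a))" using that w by (simp add: divide_simps)
      thus ?thesis using that w by (simp add: divide_simps power2_eq_square)
    qed
    from this[OF m[of n]] show "1 / (m n)\<^sup>2 / w - 2 / w\<^sup>2 * (1 / (1 / 4 + real n) - 1 / ((w / 2 + 1 / 4) + real n)) = 1 / (m n)\<^sup>2 * (1 / (w + 2 * m n))"
      by (simp add: m_def add_ac)
  qed
  also have "(\<Sum>n. 1 / (m n)\<^sup>2) / w - 2 / w\<^sup>2 * (Digamma (w / 2 + 1 / 4) - Digamma (1 / 4)) = B"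
    by (simp add: B_def m_def)
  finally show "(\<lambda>n. 1 / (m n)\<^sup>2 * (1 / (w + 2 * m n))) sums B" .
qed

text \<open>
  A constant summand does not affect boundedness, so the closed form
  \<open>\<pi>\<^sup>2 + 8 G\<close> of the trigamma value \<open>\<Sum>n. 1 / (n + 1/4)\<^sup>2\<close> is not needed.
\<close>

definition Psi_shift :: real where
  "Psi_shift = ((\<Sum>n. 1 / (real n + 1/4)\<^sup>2) - (pi\<^sup>2 + 8 * catalan_constant)) / 4"

text \<open>With s = w + 1/2 the parts of \<open>Psi\<close> match those of xi' / xi divided by w^2.
  The exponentials give 1 / s + 1 / (s - 1), the prime sum gives the von Mangoldt series, and the
  linear and Lerch terms give digamma and ln pi, Digamma (1/4) cancelling between them. The 1 / w
  left by the Lerch term is absorbed by \<open>Psi_shift\<close>.\<close>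

theorem laplace_Psi:
  assumes w: "w > 1 / 2"
  shows "has_bochner_integral lborel (\<lambda>t. indicator {0..} t * (exp (- w * t) * (Psi t + Psi_shift)))
     (xi_logderiv (w + 1/2) / w\<^sup>2)"
proof -
  define C where "C = (\<Sum>n. 1 / (real n + 1/4)\<^sup>2)"
  define k where "k = Digamma (1 / 4) - ln pi"
  define M where "M = (\<Sum>n. mangoldt n * real n powr (- (w + 1/2)) :: real)"
  define dg where "dg = Digamma (w / 2 + 1 / 4)"
  let ?S = "\<lambda>t. \<Sum>n | 1 \<le> n \<and> real n \<le> exp t. mangoldt n / sqrt (real n) * (t - ln (real n))"
  let ?B = "\<lambda>t. exp (- t / 2) * lerch_phi (exp (- 2 * t)) 2 (1 / 4)"
  have 1: "has_bochner_integral lborel (\<lambda>t. indicator {0..} t * exp (- (w - 1/2) * t)) (1 / (w - 1/2))"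
   and 2: "has_bochner_integral lborel (\<lambda>t. indicator {0..} t * exp (- (w + 1/2) * t)) (1 / (w + 1/2))"
   and 3: "has_bochner_integral lborel (\<lambda>t. indicator {0..} t * exp (- w * t)) (1 / w)"
    by (rule has_bochner_integral_exp_minus, use w in simp)+
  have 4: "has_bochner_integral lborel (\<lambda>t. indicator {0..} t * ((t - 0) * exp (- w * t))) (exp (- w * 0) / w\<^sup>2)"
    by (rule has_bochner_integral_ramp) (use w in simp)
  have 5: "has_bochner_integral lborel (\<lambda>t. indicator {0..} t * (exp (- w * t) * ?S t)) (M / w\<^sup>2)"
    unfolding M_def by (rule laplace_mangoldt_sum[OF w])
  have 6: "has_bochner_integral lborel (\<lambda>t. indicator {0..} t * (exp (- w * t) * ?B t)) (C / w - 2 * (dg - Digamma (1 / 4)) / w\<^sup>2)"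
    unfolding C_def dg_def by (rule laplace_lerch_quarter) (use w in simp)
  have 7: "has_bochner_integral lborel (\<lambda>t.
      4 * (indicator {0..} t * exp (- (w - 1/2) * t)) + 4 * (indicator {0..} t * exp (- (w + 1/2) * t))
      - (8 - C / 4) * (indicator {0..} t * exp (- w * t)) - indicator {0..} t * (exp (- w * t) * ?S t)
      + k / 2 * (indicator {0..} t * ((t - 0) * exp (- w * t))) - 1 / 4 * (indicator {0..} t * (exp (- w * t) * ?B t)))
     (4 * (1 / (w - 1/2)) + 4 * (1 / (w + 1/2)) - (8 - C / 4) * (1 / w) - M / w\<^sup>2 + k / 2 * (exp (- w * 0) / w\<^sup>2)
      - 1 / 4 * (C / w - 2 * (dg - Digamma (1 / 4)) / w\<^sup>2))"
    by (intro has_bochner_integral_add has_bochner_integral_diff has_bochner_integral_mult_right 1 2 3 4 5 6)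
  have feq: "(\<lambda>t. 4 * (indicator {0..} t * exp (- (w - 1/2) * t)) + 4 * (indicator {0..} t * exp (- (w + 1/2) * t))
      - (8 - C / 4) * (indicator {0..} t * exp (- w * t)) - indicator {0..} t * (exp (- w * t) * ?S t)
      + k / 2 * (indicator {0..} t * ((t - 0) * exp (- w * t))) - 1 / 4 * (indicator {0..} t * (exp (- w * t) * ?B t))) =
     (\<lambda>t. indicator {0..} t * (exp (- w * t) * (Psi t + Psi_shift)))"
  proof
    fix t
    have e: "exp (- (w - 1/2) * t) = exp (- w * t) * exp (t / 2)" "exp (- (w + 1/2) * t) = exp (- w * t) * exp (- t / 2)"
      by (simp_all add: exp_add[symmetric] algebra_simps)
    have alg: "4 * (i * (E * P)) + 4 * (i * (E * Q)) - (8 - C / 4) * (i * E) - i * (E * S) + k / 2 * (i * ((t - 0) * E)) - 1 / 4 * (i * (E * B))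
      = i * (E * (4 * (P + Q - 2) - S + t / 2 * k + 1 / 4 * (C0 - B) + (C - C0) / 4))" for i E P Q S B C0 :: real
      by (simp add: field_simps)
    show "4 * (indicator {0..} t * exp (- (w - 1/2) * t)) + 4 * (indicator {0..} t * exp (- (w + 1/2) * t))
      - (8 - C / 4) * (indicator {0..} t * exp (- w * t)) - indicator {0..} t * (exp (- w * t) * ?S t)
      + k / 2 * (indicator {0..} t * ((t - 0) * exp (- w * t))) - 1 / 4 * (indicator {0..} t * (exp (- w * t) * ?B t)) =
     indicator {0..} t * (exp (- w * t) * (Psi t + Psi_shift))"
      unfolding e Psi_def Psi_shift_def C_def[symmetric] k_def[symmetric] by (rule alg)
  qed
  have val: "4 * (1 / (w - 1/2)) + 4 * (1 / (w + 1/2)) - (8 - C / 4) * (1 / w) - M / w\<^sup>2 + k / 2 * (exp (- w * 0) / w\<^sup>2)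
      - 1 / 4 * (C / w - 2 * (dg - Digamma (1 / 4)) / w\<^sup>2) = xi_logderiv (w + 1/2) / w\<^sup>2"
  proof -
    have "4 * (1 / (w - 1/2)) + 4 * (1 / (w + 1/2)) - 8 * (1 / w) = (1 / (w + 1/2) + 1 / (w - 1/2)) / w\<^sup>2"
      using w by (simp add: divide_simps power2_eq_square) (simp add: algebra_simps)
    moreover have "(w + 1/2) / 2 = w / 2 + 1 / 4" "w + 1/2 - 1 = w - 1/2" by simp_all
    ultimately show ?thesis using w
      unfolding xi_logderiv_def M_def[symmetric] by (simp add: k_def dg_def diff_divide_distrib add_divide_distrib algebra_simps)
  qed
  show ?thesis using 7 unfolding feq val .
qed

text \<open>Each term of the prime sum enters with value 0, as max 0 (t - ln n), and for t < N only
  the finitely many n <= exp N take part. The Lerch series converges uniformly on t >= 0.\<close>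

lemma continuous_on_Psi: "continuous_on {0..} Psi"
proof -
  let ?S = "\<lambda>t. \<Sum>n | 1 \<le> n \<and> real n \<le> exp t. mangoldt n / sqrt (real n) * (t - ln (real n)) :: real"
  have S: "continuous_on {..<real N} ?S" for N
  proof -
    define F where "F t = (\<Sum>n | 1 \<le> n \<and> real n \<le> exp (real N). mangoldt n / sqrt (real n) * max 0 (t - ln (real n)))" for t
    have cF: "continuous_on {..<real N} F" unfolding F_def by (intro continuous_intros)
    have eqF: "?S t = F t" if "t \<in> {..<real N}" for t
    proof -
      have "?S t = (\<Sum>n | 1 \<le> n \<and> real n \<le> exp (real N). mangoldt_ramp n t)"
        unfolding mangoldt_ramp_sum
      proof (rule sum.mono_neutral_left)
        have "exp t \<le> exp (real N)" using that by simp
        thus "{n. 1 \<le> n \<and> real n \<le> exp t} \<subseteq> {n. 1 \<le> n \<and> real n \<le> exp (real N)}"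
          using order_trans by blast
      qed (use finite_nat_le_real in \<open>auto intro!: mangoldt_ramp_eq_0\<close>)
      also have "\<dots> = F t" unfolding F_def
        by (intro sum.cong) (auto simp: mangoldt_ramp_def indicator_def max_def)
      finally show ?thesis .
    qed
    show ?thesis by (rule continuous_on_eq[OF cF]) (simp only: eqF)
  qed
  have "continuous_on (\<Union>N. {..<real N}) ?S"
    by (rule continuous_on_open_UN) (use S in auto)
  hence S': "continuous_on {0..} ?S"
    by (rule continuous_on_subset) (use reals_Archimedean2 in auto)
  have L: "continuous_on {0..} (\<lambda>t. lerch_phi (exp (- 2 * t)) 2 (1 / 4))"
  proof (rule uniform_limit_theorem)
    show "uniform_limit {0..} (\<lambda>N t. \<Sum>n<N. (real n + 1/4) powr (- 2) * exp (- 2 * t) ^ n)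
       (\<lambda>t. lerch_phi (exp (- 2 * t)) 2 (1 / 4)) sequentially"
      unfolding lerch_phi_def
      by (rule Weierstrass_m_test[OF lerch_quarter_bound summable_lerch_quarter]) auto
    show "\<forall>\<^sub>F N in sequentially. continuous_on {0..} (\<lambda>t. \<Sum>n<N. (real n + 1/4) powr (- 2) * exp (- 2 * t) ^ n)"
      by (intro always_eventually allI continuous_intros)
  qed auto
  show ?thesis unfolding Psi_def[abs_def] by (intro continuous_intros S' L) auto
qed

section \<open>Approximating a logarithmic derivative by zeros\<close>

text \<open>Borel-Caratheodory: y |-> y / (2 A - y) maps Re y < A into the unit disc, so Schwarz's
  lemma gives |g| <= 2 A for |u| <= R / 2. A Cauchy estimate with radius R / 4 then yields 2 A / (R
  / 4).\<close>

lemma borel_caratheodory_deriv: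
  assumes holo: "g holomorphic_on ball 0 R" and g0: "g 0 = 0" and R: "R > 0" and A: "A > 0"
    and Re: "\<And>z. norm z < R \<Longrightarrow> Re (g z) < A" and z: "norm z \<le> R / 4"
  shows "norm (deriv g z) \<le> 8 * A / R"
proof -
  have bound: "norm (g u) \<le> 2 * A" if u: "norm u \<le> R / 2" for u
  proof -
    define v where "v x = g (of_real R * x) / (2 * of_real A - g (of_real R * x))" for x
    have nz: "2 * of_real A - g (of_real R * x) \<noteq> 0" if "norm x < 1" for x
    proof
      assume "2 * of_real A - g (of_real R * x) = 0"
      hence "Re (g (of_real R * x)) = 2 * A" by (simp add: complex_eq_iff)
      moreover have "norm (of_real R * x) < R" using that R by (simp add: norm_mult)
      ultimately show False using Re[of "of_real R * x"] A by simp
    qed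
    have holo': "(\<lambda>x. g (of_real R * x)) holomorphic_on ball 0 1"
      by (rule holomorphic_on_compose_gen[OF _ holo, unfolded o_def])
         (use R in \<open>auto intro!: holomorphic_intros simp: norm_mult\<close>)
    have v_holo: "v holomorphic_on ball 0 1"
      unfolding v_def by (intro holomorphic_intros holo') (use nz in auto)
    have v0: "v 0 = 0" by (simp add: v_def g0)
    have v1: "norm (v x) < 1" if x: "norm x < 1" for x
    proof -
      define y where "y = g (of_real R * x)"
      have "Re y < A" unfolding y_def using x R by (intro Re) (simp add: norm_mult)
      \<comment> \<open>Re = A is the perpendicular bisector of 0 and 2 A, and y lies on the side of
        0.\<close>
      hence "(norm y)\<^sup>2 < (norm (2 * of_real A - y))\<^sup>2"
        using A unfolding cmod_power2 by (simp add: power2_eq_square algebra_simps)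
      hence "norm y < norm (2 * of_real A - y)" by (rule power_less_imp_less_base) auto
      moreover from this have "norm (2 * of_real A - y) > 0" by (rule le_less_trans[OF norm_ge_zero])
      ultimately show ?thesis unfolding v_def y_def[symmetric] by (simp only: norm_divide divide_less_eq_1_pos)
    qed
    define x where "x = u / of_real R"
    have x: "norm x \<le> 1 / 2" "of_real R * x = u" using u R by (auto simp: x_def norm_divide field_simps)
    have "norm (v x) \<le> norm x"
      by (rule Schwarz_Lemma(1)[OF v_holo v0 v1]) (use x in auto)
    hence "norm (v x) \<le> 1 / 2" using x by linarith
    hence "norm (g u) \<le> norm (2 * of_real A - g u) / 2"
      using nz[of x] x unfolding v_def x(2) by (simp add: norm_divide divide_simps)
    also have "norm (2 * of_real A - g u) \<le> norm (2 * complex_of_real A) + norm (g u)" by (rule norm_triangle_ineq4)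
    also have "norm (2 * complex_of_real A) = 2 * A" using A by (simp add: norm_mult)
    finally show ?thesis by simp
  qed
  have sub: "norm u \<le> R / 2" if "u \<in> cball z (R / 4)" for u
  proof -
    have "norm u \<le> norm z + dist z u" by (metis dist_norm norm_minus_commute norm_triangle_sub)
    thus ?thesis using that z by simp
  qed
  have "norm ((deriv ^^ 1) g z) \<le> fact 1 * (2 * A) / (R / 4) ^ 1"
  proof (rule Cauchy_inequality)
    have "cball z (R / 4) \<subseteq> ball 0 R" using sub R by force
    thus "continuous_on (cball z (R / 4)) g" "g holomorphic_on ball z (R / 4)"
      using holo holomorphic_on_imp_continuous_on holomorphic_on_subset continuous_on_subset ball_subset_cball
      by (meson, meson)
    show "norm (g x) \<le> 2 * A" if "norm (z - x) = R / 4" for x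
      using that by (intro bound sub) (simp add: dist_norm)
  qed (use R in auto)
  thus ?thesis by simp
qed

section \<open>Dividing out zeros\<close>

text \<open>The factor is normalised as 1 - z / a so that the value at 0 is unchanged by the
  division.\<close>

lemma factor_out_zero:
  fixes f :: "complex \<Rightarrow> complex"
  assumes holo: "f holomorphic_on UNIV" and f0: "f 0 \<noteq> 0" and a: "f a = 0"
  obtains n h where "h holomorphic_on UNIV" "\<And>z. f z = (1 - z / a) ^ n * h z" "h a \<noteq> 0"
proof -
  have a0: "a \<noteq> 0" using a f0 by auto
  have "\<not> f constant_on UNIV" using a f0 unfolding constant_on_def by (metis UNIV_I)
  then obtain g r n where g: "0 < n" "0 < r" "g holomorphic_on ball a r"
      "\<And>w. w \<in> ball a r \<Longrightarrow> f w = (w - a) ^ n * g w" "\<And>w. w \<in> ball a r \<Longrightarrow> g w \<noteq> 0"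
    using holomorphic_factor_zero_nonconstant[OF holo open_UNIV connected_UNIV _ a] by (metis UNIV_I)
  \<comment> \<open>The value at a is the limit; \<open>(- a) ^ n\<close> converts between powers of
    w - a and of 1 - w / a.\<close>
  define h where "h w = (if w = a then (- a) ^ n * g a else f w / (1 - w / a) ^ n)" for w
  have fac: "(w - a) ^ n = (1 - w / a) ^ n * (- a) ^ n" for w
    using a0 by (simp add: power_mult_distrib[symmetric] algebra_simps)
  have fh: "f z = (1 - z / a) ^ n * h z" for z
    using a a0 g(1) by (auto simp: h_def)
  have hg: "h w = (- a) ^ n * g w" if "w \<in> ball a r" for w
    using that g(4)[OF that] a0 unfolding h_def fac by auto
  have "h holomorphic_on ball a r"
    by (rule holomorphic_transform[of "\<lambda>w. (- a) ^ n * g w"]) (use hg g(3) in \<open>auto intro!: holomorphic_intros\<close>)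
  moreover have "h holomorphic_on (- {a})"
    by (rule holomorphic_transform[of "\<lambda>w. f w / (1 - w / a) ^ n"])
       (use a0 holo in \<open>auto simp: h_def intro!: holomorphic_intros intro: holomorphic_on_subset\<close>)
  ultimately have "h holomorphic_on (ball a r \<union> - {a})"
    by (subst holomorphic_on_Un) auto
  moreover have "ball a r \<union> - {a} = UNIV" using g(2) by auto
  ultimately have "h holomorphic_on UNIV" by simp
  thus ?thesis using that[of h n] fh hg[of a] g(2) g(5)[of a] a0 by auto
qed

text \<open>Induction on the number of distinct zeros in the disc: one step removes a zero with its
  full multiplicity, recorded by repeating it in the list.\<close>

lemma factor_out_zeros_in_cball:
  fixes f :: "complex \<Rightarrow> complex"
  assumes "f holomorphic_on UNIV" "f 0 \<noteq> 0"
  shows "\<exists>rs h. h holomorphic_on UNIV \<and> (\<forall>z. f z = (\<Prod>r\<leftarrow>rs. 1 - z / r) * h z) \<and>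
           (\<forall>z\<in>cball 0 R. h z \<noteq> 0) \<and> (\<forall>r\<in>set rs. r \<in> cball 0 R \<and> f r = 0)"
  using assms
proof (induction "card {z\<in>cball 0 R. f z = 0}" arbitrary: f rule: less_induct)
  case less
  have fin: "finite {z\<in>cball 0 R. f z = 0}" if "\<exists>a. f a = 0"
  proof (rule holomorphic_compact_finite_zeros)
    show "\<not> f constant_on UNIV" using that less.prems(2) unfolding constant_on_def by (metis UNIV_I)
  qed (use less.prems in auto)
  show ?case
  proof (cases "\<exists>a\<in>cball 0 R. f a = 0")
    case False
    thus ?thesis using less.prems by (intro exI[of _ "[]"] exI[of _ f]) auto
  next
    case True
    then obtain a where a: "a \<in> cball 0 R" "f a = 0" by blast
    obtain n h where h: "h holomorphic_on UNIV" "\<And>z. f z = (1 - z / a) ^ n * h z" "h a \<noteq> 0"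
      using factor_out_zero[OF less.prems a(2)] by blast
    have h0: "h 0 \<noteq> 0" using h(2)[of 0] less.prems by simp
    have sub: "{z\<in>cball 0 R. h z = 0} \<subset> {z\<in>cball 0 R. f z = 0}"
      using a h(2,3) by auto
    have "card {z\<in>cball 0 R. h z = 0} < card {z\<in>cball 0 R. f z = 0}"
      using fin a by (intro psubset_card_mono sub) auto
    from less.hyps[OF this h(1) h0] obtain rs k where k: "k holomorphic_on UNIV"
      "\<And>z. h z = (\<Prod>r\<leftarrow>rs. 1 - z / r) * k z" "\<forall>z\<in>cball 0 R. k z \<noteq> 0" "\<forall>r\<in>set rs. r \<in> cball 0 R \<and> h r = 0"
      by blast
    have prod: "(\<Prod>r\<leftarrow>replicate n a @ rs. 1 - z / r) = (1 - z / a) ^ n * (\<Prod>r\<leftarrow>rs. 1 - z / r)" for z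
      by (simp add: prod_list_replicate)
    show ?thesis
      by (intro exI[of _ "replicate n a @ rs"] exI[of _ k])
         (use k a h(2) in \<open>auto simp: prod mult.assoc\<close>)
  qed
qed

lemma prod_list_linear_derivative:
  fixes z :: complex
  assumes "\<And>r. r \<in> set rs \<Longrightarrow> r \<noteq> 0 \<and> z \<noteq> r"
  shows "((\<lambda>z. \<Prod>r\<leftarrow>rs. 1 - z / r) has_field_derivative (\<Prod>r\<leftarrow>rs. 1 - z / r) * (\<Sum>r\<leftarrow>rs. 1 / (z - r))) (at z)"
  using assms
proof (induction rs)
  case (Cons a rs)
  have a: "a \<noteq> 0" "z \<noteq> a" using Cons.prems by auto
  have "((\<lambda>z. 1 - z / a) has_field_derivative - 1 / a) (at z)"
    using a by (auto intro!: derivative_eq_intros)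
  moreover have "- 1 / a = (1 - z / a) * (1 / (z - a))" using a by (simp add: divide_simps)
  ultimately have 1: "((\<lambda>z. 1 - z / a) has_field_derivative (1 - z / a) * (1 / (z - a))) (at z)" by simp
  have 2: "((\<lambda>z. \<Prod>r\<leftarrow>rs. 1 - z / r) has_field_derivative (\<Prod>r\<leftarrow>rs. 1 - z / r) * (\<Sum>r\<leftarrow>rs. 1 / (z - r))) (at z)"
    by (rule Cons.IH) (use Cons.prems in auto)
  have alg: "X * c * P + P * S * X = X * P * (c + S)" for X c P S :: complex
    by (simp add: algebra_simps)
  show ?case using DERIV_mult[OF 1 2] unfolding alg by simp
qed simp

lemma prod_list_linear_ge_1:
  fixes z :: complex
  assumes "\<And>r. r \<in> set rs \<Longrightarrow> r \<noteq> 0 \<and> 2 * norm r \<le> norm z"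
  shows "norm (\<Prod>r\<leftarrow>rs. 1 - z / r) \<ge> 1"
  using assms
proof (induction rs)
  case (Cons a rs)
  have a: "a \<noteq> 0" "2 * norm a \<le> norm z" using Cons.prems by auto
  have "2 \<le> norm (z / a)" using a by (simp add: norm_divide field_simps)
  also have "norm (z / a) \<le> norm (1 - z / a) + norm (1 :: complex)"
    by (metis norm_minus_commute norm_triangle_sub add.commute)
  finally have "norm (1 - z / a) \<ge> 1" by simp
  moreover have "norm (\<Prod>r\<leftarrow>rs. 1 - z / r) \<ge> 1" by (rule Cons.IH) (use Cons.prems in auto)
  ultimately show ?case using mult_mono[of 1 "norm (1 - z / a)" 1 "norm (\<Prod>r\<leftarrow>rs. 1 - z / r)"] by (simp add: norm_mult)
qed simp

text \<open>
  This replaces Hadamard's factorisation. Only the zeros in the disc of radius \<open>R\<close> are divided out;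
  on the circle of radius \<open>2 R\<close> each factor \<open>1 - z / r\<close> has norm at least 1, so no lower
  bounds for canonical products are required.
\<close>

theorem logderiv_approx_by_zeros:
  fixes f :: "complex \<Rightarrow> complex"
  assumes holo: "f holomorphic_on UNIV" and f0: "f 0 \<noteq> 0" and R: "R > 0"
    and M: "\<And>z. norm z = 2 * R \<Longrightarrow> norm (f z) \<le> M" and f0M: "norm (f 0) \<le> M"
  shows "\<exists>rs. (\<forall>r\<in>set rs. f r = 0) \<and> (\<forall>z. norm z \<le> R / 4 \<longrightarrow> f z \<noteq> 0 \<longrightarrow>
    norm (deriv f z / f z - (\<Sum>r\<leftarrow>rs. 1 / (z - r))) \<le> 8 * (ln (M / norm (f 0)) + 1) / R)"
proof -
  obtain rs h where h: "h holomorphic_on UNIV" "\<And>z. f z = (\<Prod>r\<leftarrow>rs. 1 - z / r) * h z"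
     "\<forall>z\<in>cball 0 R. h z \<noteq> 0" "\<forall>r\<in>set rs. r \<in> cball 0 R \<and> f r = 0"
    using factor_out_zeros_in_cball[OF holo f0, of R] by blast
  have rs0: "r \<noteq> 0" if "r \<in> set rs" for r using h(4) that f0 by auto
  have prod0: "(\<Prod>r\<leftarrow>rs. 1 - 0 / r) = 1" by (induction rs) auto
  have h0: "h 0 = f 0" using h(2)[of 0] prod0 by simp
  have M0: "M > 0" using f0 f0M by (smt (verit) zero_less_norm_iff)
  have hM: "norm (h z) \<le> M" if "norm z < R" for z
  proof (rule maximum_modulus_frontier[of h "cball 0 (2 * R)"])
    show "norm (h z) \<le> M" if "z \<in> frontier (cball 0 (2 * R))" for z
    proof -
      have z: "norm z = 2 * R" using that R by (simp add: frontier_cball)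
      have "norm (h z) * 1 \<le> norm (h z) * norm (\<Prod>r\<leftarrow>rs. 1 - z / r)"
        by (intro mult_left_mono prod_list_linear_ge_1) (use z rs0 h(4) in auto)
      also have "\<dots> = norm (f z)" by (simp add: h(2)[of z] norm_mult)
      also have "\<dots> \<le> M" by (rule M[OF z])
      finally show ?thesis by simp
    qed
    show "h holomorphic_on interior (cball 0 (2 * R))" "continuous_on (closure (cball 0 (2 * R))) h"
      using h(1) holomorphic_on_imp_continuous_on by (auto intro: holomorphic_on_subset continuous_on_subset)
  qed (use that R in auto)
  \<comment> \<open>\<open>h\<close> has no zeros in the disc and is therefore an exponential; the
    bound on |h| becomes an upper bound on the real part of the exponent.\<close>
  obtain g0 where g0: "g0 holomorphic_on ball 0 R" "\<And>z. z \<in> ball 0 R \<Longrightarrow> h z = exp (g0 z)"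
  proof (rule contractible_imp_holomorphic_log[of h "ball 0 R"])
    show "h holomorphic_on ball 0 R" using h(1) by (rule holomorphic_on_subset) auto
    show "contractible (ball (0::complex) R)" by (intro convex_imp_contractible) auto
  qed (use h(3) that in auto)
  define g where "g z = g0 z - g0 0" for z
  \<comment> \<open>The summand 1 keeps \<open>A\<close> positive and Re g < A strict even when
    \<open>M\<close> equals |f 0|.\<close>
  define A where "A = ln (M / norm (f 0)) + 1"
  have lnM: "ln (M / norm (f 0)) \<ge> 0" using f0 f0M by (intro ln_ge_zero) (auto simp: field_simps)
  have g: "norm (deriv g z) \<le> 8 * A / R" if "norm z \<le> R / 4" for z
  proof (rule borel_caratheodory_deriv)
    show "g holomorphic_on ball 0 R" unfolding g_def by (intro holomorphic_intros g0)
    show "A > 0" using lnM by (simp add: A_def)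
    fix u :: complex assume u: "norm u < R"
    have "exp (Re (g0 u)) \<le> M" using hM[OF u] g0(2)[of u] u by simp
    hence 1: "Re (g0 u) \<le> ln M" using M0 by (simp add: ln_ge_iff)
    have "exp (Re (g0 0)) = norm (f 0)" using g0(2)[of 0] R h0 by (metis centre_in_ball norm_exp_eq_Re)
    hence 2: "Re (g0 0) = ln (norm (f 0))" by (metis ln_exp)
    show "Re (g u) < A" using 1 2 M0 f0 by (simp add: g_def A_def ln_div)
  qed (use R that in \<open>auto simp: g_def\<close>)
  show ?thesis
  proof (intro exI[of _ rs] conjI allI impI)
    show "\<forall>r\<in>set rs. f r = 0" using h(4) by auto
    fix z assume z: "norm z \<le> R / 4" "f z \<noteq> 0"
    have zR: "z \<in> ball 0 R" using z R by auto
    have rsz: "r \<noteq> 0 \<and> z \<noteq> r" if "r \<in> set rs" for r using that rs0 h(4) z by auto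
    have g0': "(g0 has_field_derivative deriv g0 z) (at z)"
      by (rule holomorphic_derivI[OF g0(1)]) (use zR in auto)
    have "((\<lambda>z. exp (g0 z)) has_field_derivative exp (g0 z) * deriv g0 z) (at z)"
      by (rule DERIV_chain2[OF DERIV_exp g0'])
    hence h': "(h has_field_derivative h z * deriv g0 z) (at z)"
      using zR g0(2) by (subst (asm) DERIV_cong_ev[of z z _ h]) 
        (auto intro!: eventually_mono[OF eventually_nhds_in_open[of "ball 0 R" z]])
    have dg: "deriv g z = deriv g0 z"
      unfolding g_def by (rule DERIV_imp_deriv) (auto intro!: derivative_eq_intros g0')
    have feq: "(\<lambda>z. (\<Prod>r\<leftarrow>rs. 1 - z / r) * h z) = f" using h(2) by (simp add: fun_eq_iff)
    have "deriv f z = f z * (deriv g z + (\<Sum>r\<leftarrow>rs. 1 / (z - r)))"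
      using DERIV_imp_deriv[OF DERIV_mult[OF prod_list_linear_derivative h', of rs]] rsz 
      unfolding feq h(2)[of z] dg by (simp add: algebra_simps)
    hence "deriv f z / f z - (\<Sum>r\<leftarrow>rs. 1 / (z - r)) = deriv g z" using z(2) by simp
    thus "norm (deriv f z / f z - (\<Sum>r\<leftarrow>rs. 1 / (z - r))) \<le> 8 * (ln (M / norm (f 0)) + 1) / R"
      using g[OF z(1)] by (simp add: A_def)
  qed
qed

section \<open>Boundedness implies the Riemann hypothesis\<close>

text \<open>Truncated transforms are entire by differentiation under the integral over a compact
  interval. On Re w >= d the tail is at most B exp (- d N) / d, so they converge locally
  uniformly.\<close>

lemma laplace_bounded:
  fixes H :: "real \<Rightarrow> real"
  assumes cont: "continuous_on {0..} H" and B: "\<And>t. t \<ge> 0 \<Longrightarrow> \<bar>H t\<bar> \<le> B"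
  defines "f \<equiv> \<lambda>w t. indicator {0..} t *\<^sub>R (exp (- w * complex_of_real t) * of_real (H t))"
  shows "\<And>w. Re w > 0 \<Longrightarrow> integrable lborel (f w)"
    and "(\<lambda>w. integral\<^sup>L lborel (f w)) holomorphic_on {w. Re w > 0}"
proof -
  have contf: "continuous_on {0..} (\<lambda>t. exp (- w * complex_of_real t) * of_real (H t))" for w
    by (intro continuous_intros cont)
  have meas: "f w \<in> borel_measurable borel" for w
    unfolding f_def by (rule borel_measurable_continuous_on_indicator[OF _ contf]) auto
  have norm_f: "norm (f w t) \<le> B * (indicator {0..} t * exp (- d * t))" if "d \<le> Re w" for w t d
  proof (cases "t \<ge> 0")
    case True
    have "norm (f w t) = exp (- Re w * t) * \<bar>H t\<bar>" using True by (simp add: f_def norm_mult)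
    also have "\<dots> \<le> exp (- d * t) * B" using True that
      by (intro mult_mono B) (auto intro: mult_right_mono)
    finally show ?thesis using True by (simp add: mult.commute)
  qed (simp add: f_def)
  have int_bound: "integrable lborel (\<lambda>t. B * (indicator {0..} t * exp (- d * t)))" if "d > 0" for d
    using has_bochner_integral_exp_minus[OF that] by (simp add: has_bochner_integral_iff)
  have int: "integrable lborel (f w)" if "Re w > 0" for w
    by (rule Bochner_Integration.integrable_bound[OF int_bound[OF that]])
       (use meas norm_f[of "Re w" w] in \<open>auto intro: order_trans[OF _ abs_ge_self]\<close>)
  thus "\<And>w. Re w > 0 \<Longrightarrow> integrable lborel (f w)" .
  define F where "F w = integral\<^sup>L lborel (f w)" for w
  define FN where "FN N w = integral (cbox 0 (real N)) (\<lambda>t. exp (- w * complex_of_real t) * of_real (H t))" for N w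
  have cont0: "continuous_on (cbox 0 (real N)) H" for N by (rule continuous_on_subset[OF cont]) auto
  have FN_holo: "FN N holomorphic_on UNIV" for N
    unfolding FN_def[abs_def]
  proof (rule leibniz_rule_holomorphic)
    show "((\<lambda>w. exp (- w * complex_of_real t) * of_real (H t)) has_field_derivative
        - of_real t * exp (- w * complex_of_real t) * of_real (H t)) (at w within UNIV)" for w t
      by (auto intro!: derivative_eq_intros)
    show "(\<lambda>t. exp (- w * complex_of_real t) * of_real (H t)) integrable_on cbox 0 (real N)" for w
      by (intro integrable_continuous continuous_intros cont0)
    have "continuous_on (UNIV \<times> cbox 0 (real N)) (\<lambda>p. H (snd p))"
      by (rule continuous_on_compose2[OF cont0]) (auto intro!: continuous_intros)
    thus "continuous_on (UNIV \<times> cbox 0 (real N)) (\<lambda>(w, t). - of_real t * exp (- w * complex_of_real t) * of_real (H t))"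
      unfolding case_prod_unfold by (intro continuous_intros)
  qed auto
  have diff: "norm (FN N w - F w) \<le> B * (exp (- d * real N) / d)" if d: "d > 0" "d \<le> Re w" for N w d
  proof -
    have w: "Re w > 0" using d by simp
    have intN: "integrable lborel (\<lambda>t. indicator {0..real N} t *\<^sub>R f w t)"
      by (rule integrable_mult_indicator[OF _ int[OF w]]) auto
    have intN': "integrable lborel (\<lambda>t. indicator {real N<..} t *\<^sub>R f w t)"
      by (rule integrable_mult_indicator[OF _ int[OF w]]) auto
    have "FN N w = (LINT t|lborel. indicator {0..real N} t *\<^sub>R f w t)"
    proof -
      have "(LINT t:{0..real N}|lborel. exp (- w * complex_of_real t) * of_real (H t)) = FN N w"
      proof (subst set_borel_integral_eq_integral(2))
        show "set_integrable lborel {0..real N} (\<lambda>t. exp (- w * complex_of_real t) * of_real (H t))"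
          using cont0[of N] by (intro borel_integrable_atLeastAtMost') (auto intro!: continuous_intros)
      qed (simp add: FN_def)
      also have "(LINT t:{0..real N}|lborel. exp (- w * complex_of_real t) * of_real (H t)) = (LINT t|lborel. indicator {0..real N} t *\<^sub>R f w t)"
        unfolding set_lebesgue_integral_def by (intro Bochner_Integration.integral_cong) (auto simp: f_def indicator_def)
      finally show ?thesis by simp
    qed
    moreover have "F w = (LINT t|lborel. indicator {0..real N} t *\<^sub>R f w t) + (LINT t|lborel. indicator {real N<..} t *\<^sub>R f w t)"
      unfolding F_def by (subst Bochner_Integration.integral_add[symmetric, OF intN intN'], intro Bochner_Integration.integral_cong)
        (auto simp: f_def indicator_def)
    ultimately have "norm (FN N w - F w) = norm (LINT t|lborel. indicator {real N<..} t *\<^sub>R f w t)"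
      by (simp add: norm_minus_commute)
    also have "\<dots> \<le> (LINT t|lborel. B * (indicator {real N..} t * exp (- d * t)))"
    proof (rule Bochner_Integration.integral_norm_bound_integral[OF intN'])
      show "integrable lborel (\<lambda>t. B * (indicator {real N..} t * exp (- d * t)))"
        using has_bochner_integral_exp_minus_from[OF d(1), of "real N"] by (simp add: has_bochner_integral_iff)
      have B0: "B \<ge> 0" using B[of 0] by simp
      show "norm (indicator {real N<..} t *\<^sub>R f w t) \<le> B * (indicator {real N..} t * exp (- d * t))" for t
        using norm_f[OF d(2), of t] B0 by (auto simp: indicator_def split: if_splits)
    qed
    also have "\<dots> = B * (exp (- d * real N) / d)"
      using has_bochner_integral_exp_minus_from[OF d(1), of "real N"] by (simp add: has_bochner_integral_iff)
    finally show ?thesis .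
  qed
  have "F holomorphic_on {w. Re w > 0}"
  proof (rule holomorphic_uniform_sequence[of _ FN])
    show "open {w. Re w > 0}" by (rule open_halfspace_Re_gt)
    show "FN N holomorphic_on {w. Re w > 0}" for N using FN_holo by (rule holomorphic_on_subset) auto
    fix w :: complex assume w: "w \<in> {w. Re w > 0}"
    define d where "d = Re w / 2"
    have d: "d > 0" using w by (simp add: d_def)
    have Re: "Re u \<ge> d" if "u \<in> cball w d" for u
    proof -
      have "\<bar>Re w - Re u\<bar> \<le> dist w u" using abs_Re_le_cmod[of "w - u"] by (simp add: dist_norm)
      thus ?thesis using that by (simp add: d_def abs_le_iff)
    qed
    have "uniform_limit (cball w d) FN F sequentially"
    proof (rule uniform_limitI)
      fix e :: real assume e: "e > 0"
      have "(\<lambda>N. B * (exp (- d * real N) / d)) \<longlonglongrightarrow> 0" using d by real_asymp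
      hence "eventually (\<lambda>N. B * (exp (- d * real N) / d) < e) sequentially" using e by (rule order_tendstoD)
      thus "\<forall>\<^sub>F N in sequentially. \<forall>u\<in>cball w d. dist (FN N u) (F u) < e"
      proof eventually_elim
        case (elim N)
        show ?case unfolding dist_norm
          using le_less_trans[OF diff[OF d Re] elim] by blast
      qed
    qed
    moreover have "cball w d \<subseteq> {w. Re w > 0}" using Re d by force
    ultimately show "\<exists>d>0. cball w d \<subseteq> {w. Re w > 0} \<and> uniform_limit (cball w d) FN F sequentially"
      using d by blast
  qed
  thus "(\<lambda>w. integral\<^sup>L lborel (f w)) holomorphic_on {w. Re w > 0}" unfolding F_def[abs_def] .
qed

text \<open>If P is a primitive of G, then A exp (- P) has derivative 0 and is constant on the half
  plane; the constant is nonzero because xi (3/2) > 0.\<close>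

lemma Xi_square_nonzero_if_bounded:
  assumes bdd: "bounded (Psi ` {0..})" and w: "Re w > 0"
  shows "Xi (w\<^sup>2) \<noteq> 0"
proof -
  define S where "S = {w::complex. Re w > 0}"
  have S: "open S" "convex S" by (auto simp: S_def open_halfspace_Re_gt convex_halfspace_Re_gt)
  define H where "H t = Psi t + Psi_shift" for t
  obtain B0 where B0: "\<And>t. t \<ge> 0 \<Longrightarrow> \<bar>Psi t\<bar> \<le> B0" using bdd by (auto simp: bounded_iff)
  have B: "\<bar>H t\<bar> \<le> B0 + \<bar>Psi_shift\<bar>" if "t \<ge> 0" for t using B0[OF that] by (simp add: H_def)
  have contH: "continuous_on {0..} H" unfolding H_def[abs_def] by (intro continuous_intros continuous_on_Psi)
  define F where "F w = (LINT t|lborel. indicator {0..} t *\<^sub>R (exp (- w * complex_of_real t) * of_real (H t)))" for w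
  have F_holo: "F holomorphic_on S" unfolding S_def F_def[abs_def] by (rule laplace_bounded(2)[OF contH B])
  have F_real: "F (of_real x) = of_real (xi_logderiv (x + 1/2) / x\<^sup>2)" if x: "x > 1/2" for x
  proof -
    have "(LINT t|lborel. indicator {0..} t * (exp (- x * t) * H t)) = xi_logderiv (x + 1/2) / x\<^sup>2"
      using laplace_Psi[OF x] by (simp add: has_bochner_integral_iff H_def)
    moreover have "(indicator {0..} t *\<^sub>R (exp (- of_real x * complex_of_real t) * of_real (H t))) = 
        complex_of_real (indicator {0..} t * (exp (- x * t) * H t))" for t
      by (simp add: scaleR_conv_of_real exp_of_real[symmetric])
    ultimately show ?thesis unfolding F_def by (simp only: integral_complex_of_real)
  qed
  define A where "A w = Xi (w\<^sup>2)" for w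
  define G where "G w = w\<^sup>2 * F w" for w
  have G_holo: "G holomorphic_on S" unfolding G_def by (intro holomorphic_intros F_holo)
  have D: "(Xi has_field_derivative deriv Xi z) (at z)" for z
    using Xi_holomorphic[of UNIV] by (intro holomorphic_derivI) auto
  have A': "(A has_field_derivative deriv Xi (w\<^sup>2) * (2 * w)) (at w)" for w
    unfolding A_def[abs_def] by (rule DERIV_chain2[OF D]) (auto intro!: derivative_eq_intros)
  have A_holo: "A holomorphic_on T" for T
    using A' by (auto simp: holomorphic_on_def field_differentiable_def intro: has_field_derivative_at_within)
  have dXi: "(\<lambda>w. deriv Xi (w\<^sup>2)) holomorphic_on T" for T
    by (rule holomorphic_on_compose_gen[of _ _ "deriv Xi" UNIV, unfolded o_def])
       (auto intro!: holomorphic_intros holomorphic_deriv Xi_holomorphic)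
  \<comment> \<open>Known for real u > 1/2, where \<open>Xi\<close> at u^2 is positive and the
    transform of \<open>Psi\<close> is computed; the product form is holomorphic and extends to the
    half plane.\<close>
  have ode: "deriv Xi (u\<^sup>2) * (2 * u) - G u * A u = 0" if u: "u \<in> S" for u
  proof (rule analytic_continuation[where f = "\<lambda>u. deriv Xi (u\<^sup>2) * (2 * u) - G u * A u" and S = S and U = "of_real ` {1/2<..}" and \<xi> = 1])
    show "(\<lambda>u. deriv Xi (u\<^sup>2) * (2 * u) - G u * A u) holomorphic_on S"
      by (intro holomorphic_intros dXi G_holo A_holo)
    show "(1::complex) islimpt of_real ` {1/2<..}"
      unfolding islimpt_approachable
    proof (intro allI impI)
      fix e :: real assume e: "e > 0"
      have "dist (complex_of_real (1 + e / 2)) 1 = \<bar>e / 2\<bar>" by (simp add: dist_norm norm_divide)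
      moreover have "complex_of_real (1 + e / 2) \<noteq> of_real 1" using e by (subst of_real_eq_iff) auto
      moreover have "complex_of_real (1 + e / 2) \<in> of_real ` {1/2<..}" by (rule imageI) (use e in simp)
      ultimately show "\<exists>x'\<in>of_real ` {1/2<..}. x' \<noteq> (1::complex) \<and> dist x' 1 < e"
        using e by (intro bexI[of _ "complex_of_real (1 + e / 2)"]) auto
    qed
    fix z :: complex assume "z \<in> of_real ` {1/2<..}"
    then obtain x where x: "x > 1/2" "z = of_real x" by auto
    have nz: "Xi (of_real (x\<^sup>2)) \<noteq> 0"
      unfolding Xi_of_real_square[OF x(1)] using xi_real_pos[of "x + 1/2"] x by simp
    have "G z = of_real (xi_logderiv (x + 1/2))" unfolding G_def x(2) F_real[OF x(1)] using x by simp
    also have "\<dots> = 2 * of_real x * deriv Xi (of_real (x\<^sup>2)) / Xi (of_real (x\<^sup>2))"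
      using xi_real_logderiv_Xi[OF x(1)] by simp
    finally show "deriv Xi (z\<^sup>2) * (2 * z) - G z * A z = 0"
      using nz unfolding A_def x(2) by (simp add: field_simps)
  qed (use S u in \<open>auto simp: convex_connected S_def\<close>)
  obtain P where P0: "\<And>z. z \<in> S \<Longrightarrow> (P has_field_derivative G z) (at z within S)"
    using that by (rule holomorphic_convex_primitive'[OF S(2,1) G_holo])
  have P: "(P has_field_derivative G z) (at z)" if "z \<in> S" for z
    using P0[OF that] at_within_open[OF that S(1)] by simp
  have const: "((\<lambda>u. A u * exp (- P u)) has_field_derivative 0) (at u within S)" if u: "u \<in> S" for u
  proof -
    have "((\<lambda>u. A u * exp (- P u)) has_field_derivative (deriv Xi (u\<^sup>2) * (2 * u) * exp (- P u) + exp (- P u) * (- G u) * A u)) (at u)"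
      by (rule DERIV_mult[OF A' DERIV_chain2[OF DERIV_exp DERIV_minus[OF P[OF u]]]])
    moreover have "deriv Xi (u\<^sup>2) * (2 * u) * exp (- P u) + exp (- P u) * (- G u) * A u = exp (- P u) * (deriv Xi (u\<^sup>2) * (2 * u) - G u * A u)"
      by (simp add: algebra_simps)
    ultimately show ?thesis using ode[OF u] by (auto intro: has_field_derivative_at_within)
  qed
  obtain c where c: "\<And>u. u \<in> S \<Longrightarrow> A u * exp (- P u) = c"
    using has_field_derivative_zero_constant[OF S(2) const] by auto
  have "A 1 = of_real (xi_real (1 + 1/2))" using Xi_of_real_square[of 1] by (simp add: A_def)
  hence "A 1 \<noteq> 0" using xi_real_pos[of "1 + 1/2"] by simp
  moreover have "1 \<in> S" by (simp add: S_def)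
  ultimately have "c \<noteq> 0" using c by fastforce
  thus ?thesis using c[of w] w by (auto simp: S_def A_def)
qed

lemma riemann_hypothesis_if_bounded:
  assumes bdd: "bounded (Psi ` {0..})"
  shows riemann_hypothesis
  unfolding riemann_hypothesis_def riemann_xi_eq
proof (intro allI impI)
  fix s :: complex assume s: "Xi ((s - 1/2)\<^sup>2) = 0"
  have "\<not> Re (s - 1/2) > 0" using Xi_square_nonzero_if_bounded[OF bdd] s by blast
  moreover have "\<not> Re (- (s - 1/2)) > 0" using Xi_square_nonzero_if_bounded[OF bdd, of "- (s - 1/2)"] s by (simp only: power2_minus) blast
  ultimately show "Re s = 1 / 2" by simp
qed

section \<open>The Riemann hypothesis implies boundedness\<close>

text \<open>At radius 2 R the growth bound makes ln M of order n log n while R is about 2 n^2, so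
  the error bound tends to 0. Growth of order below one is what lets plain sums of 1 / (z - r)
  converge to the logarithmic derivative.\<close>

lemma Xi_logderiv_approx:
  "\<exists>rs. (\<forall>n. \<forall>r\<in>set (rs n). Xi r = 0) \<and>
     (\<forall>z. Xi z \<noteq> 0 \<longrightarrow> (\<lambda>n. \<Sum>r\<leftarrow>rs n. 1 / (z - r)) \<longlonglongrightarrow> deriv Xi z / Xi z)"
proof -
  define R where "R n = (2 * real n + 3/2)\<^sup>2 / 2" for n
  \<comment> \<open>\<open>real n ^ n\<close> majorises the factorial in a form suited to
    asymptotics, and the last summand covers the value at 0.\<close>
  define M where "M n = 1 / 2 + (2 * R n + 1) * real n ^ n + norm (Xi 0)" for n
  define err where "err n = 8 * (ln (M n / norm (Xi 0)) + 1) / R n" for n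
  have R: "R n > 0" for n
  proof -
    have "2 * real n + 3/2 > 0" by simp
    thus ?thesis unfolding R_def by simp
  qed
  have "\<exists>rs. (\<forall>r\<in>set rs. Xi r = 0) \<and> (\<forall>z. norm z \<le> R n / 4 \<longrightarrow> Xi z \<noteq> 0 \<longrightarrow>
    norm (deriv Xi z / Xi z - (\<Sum>r\<leftarrow>rs. 1 / (z - r))) \<le> err n)" for n
    unfolding err_def
  proof (rule logderiv_approx_by_zeros[OF Xi_holomorphic Xi_0_nonzero R])
    fix z :: complex assume z: "norm z = 2 * R n"
    have "norm (Xi z) \<le> 1 / 2 + (norm z + 1) * fact n"
      by (rule norm_Xi_le) (simp add: z R_def)
    also have "\<dots> \<le> 1 / 2 + (norm z + 1) * real n ^ n"
      using fact_le_power[of n, where 'a = real] by (intro add_left_mono mult_left_mono) auto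
    also have "\<dots> \<le> M n" by (simp add: M_def z)
    finally show "norm (Xi z) \<le> M n" .
  next
    show "norm (Xi 0) \<le> M n" using R[of n] by (simp add: M_def)
  qed
  then obtain rs where rs: "\<And>n r. r \<in> set (rs n) \<Longrightarrow> Xi r = 0"
    "\<And>n z. norm z \<le> R n / 4 \<Longrightarrow> Xi z \<noteq> 0 \<Longrightarrow> norm (deriv Xi z / Xi z - (\<Sum>r\<leftarrow>rs n. 1 / (z - r))) \<le> err n"
    by metis
  have err: "err \<longlonglongrightarrow> 0"
  proof -
    define c where "c = norm (Xi 0)"
    have c: "c > 0" using Xi_0_nonzero by (simp add: c_def)
    show ?thesis unfolding err_def M_def R_def c_def[symmetric] using c by real_asymp
  qed
  have Rlim: "filterlim (\<lambda>n. R n / 4) at_top sequentially" unfolding R_def by real_asymp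
  have "(\<lambda>n. \<Sum>r\<leftarrow>rs n. 1 / (z - r)) \<longlonglongrightarrow> deriv Xi z / Xi z" if z: "Xi z \<noteq> 0" for z
  proof (rule LIM_zero_cancel, rule Lim_null_comparison[OF _ err])
    have "eventually (\<lambda>n. norm z \<le> R n / 4) sequentially"
      using Rlim by (simp add: filterlim_at_top)
    thus "\<forall>\<^sub>F n in sequentially. norm ((\<Sum>r\<leftarrow>rs n. 1 / (z - r)) - deriv Xi z / Xi z) \<le> err n"
      by eventually_elim (use rs(2) z in \<open>auto simp: norm_minus_commute\<close>)
  qed
  thus ?thesis using rs(1) by blast
qed

text \<open>For w^2 = z the point 1/2 + w is a zero of xi, so w is purely imaginary and its square
  is a nonpositive real; 0 itself is no zero of \<open>Xi\<close>.\<close>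

lemma Xi_zero_if_riemann_hypothesis:
  assumes rh: riemann_hypothesis and z: "Xi z = 0"
  shows "\<exists>\<rho>>0. z = - of_real \<rho>"
proof -
  define w where "w = csqrt z"
  have w2: "w\<^sup>2 = z" by (simp add: w_def)
  have "riemann_xi (1/2 + w) = 0" using z w2 by (simp add: riemann_xi_eq)
  hence "Re w = 0" using rh by (force simp: riemann_hypothesis_def)
  hence "w = \<i> * of_real (Im w)" by (simp add: complex_eq_iff)
  hence "z = - of_real ((Im w)\<^sup>2)" using w2 by (metis of_real_power power_mult_distrib power2_i mult_minus1)
  moreover have "Im w \<noteq> 0" using Xi_0_nonzero z calculation by auto
  ultimately show ?thesis by (intro exI[of _ "(Im w)\<^sup>2"]) auto
qed

text \<open>The integrand is nonnegative, so an explicit antiderivative tending to 0 settles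
  integrability and value together. For b^2 = \<open>\<rho>\<close> and the weight 2 /
  \<open>\<rho>\<close> the value becomes 2 / (w (w^2 + \<open>\<rho>\<close>)).\<close>

lemma has_bochner_integral_laplace_1_minus_cos:
  fixes w b :: real
  assumes w: "w > 0"
  shows "has_bochner_integral lborel (\<lambda>t. indicator {0..} t * (exp (- w * t) * (1 - cos (b * t)))) (b\<^sup>2 / (w * (w\<^sup>2 + b\<^sup>2)))"
proof (rule has_bochner_integral_nn_integral)
  have p: "w\<^sup>2 + b\<^sup>2 > 0" using w by (simp add: add_pos_nonneg)
  define F where "F t = exp (- w * t) * ((w * cos (b * t) - b * sin (b * t)) / (w\<^sup>2 + b\<^sup>2) - 1 / w)" for t
  have "(\<integral>\<^sup>+t. ennreal (exp (- w * t) * (1 - cos (b * t))) * indicator {0..} t \<partial>lborel) = 0 - F 0"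
  proof (rule nn_integral_FTC_atLeast)
    show "(F has_real_derivative exp (- w * t) * (1 - cos (b * t))) (at t)" for t
    proof -
      have E: "((\<lambda>t. exp (- w * t)) has_real_derivative - w * exp (- w * t)) (at t)"
        by (auto intro!: derivative_eq_intros)
      have num: "((\<lambda>t. w * cos (b * t) - b * sin (b * t)) has_real_derivative (- w * b * sin (b * t) - b * b * cos (b * t))) (at t)"
        by (auto intro!: derivative_eq_intros simp: algebra_simps)
      have G: "((\<lambda>t. (w * cos (b * t) - b * sin (b * t)) / P - 1 / w) has_real_derivative
          (- w * b * sin (b * t) - b * b * cos (b * t)) / P) (at t)" for P
        using DERIV_diff[OF DERIV_cdivide[OF num, of P] DERIV_const[of "1 / w"]] by simp
      have "(F has_real_derivative (- w * exp (- w * t)) * ((w * cos (b * t) - b * sin (b * t)) / (w\<^sup>2 + b\<^sup>2) - 1 / w)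
         + exp (- w * t) * ((- w * b * sin (b * t) - b * b * cos (b * t)) / (w\<^sup>2 + b\<^sup>2))) (at t)"
        unfolding F_def[abs_def] by (rule DERIV_cong[OF DERIV_mult[OF E G]]) (simp add: mult.commute)
      also have "(- w * exp (- w * t)) * ((w * cos (b * t) - b * sin (b * t)) / (w\<^sup>2 + b\<^sup>2) - 1 / w)
         + exp (- w * t) * ((- w * b * sin (b * t) - b * b * cos (b * t)) / (w\<^sup>2 + b\<^sup>2)) =
         exp (- w * t) * (1 - cos (b * t) * ((w\<^sup>2 + b\<^sup>2) / (w\<^sup>2 + b\<^sup>2)))"
      proof -
        have "(- w * e) * ((w * c - b * s) / P - 1 / w) + e * ((- w * b * s - b * b * c) / P) = e * (1 - c * ((w\<^sup>2 + b\<^sup>2) / P))"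
          if "P \<noteq> 0" for P c s e :: real
          using that w by (simp add: field_simps power2_eq_square)
        thus ?thesis using p by (simp only:)
      qed
      finally show ?thesis using p w by simp
    qed
    define K where "K = (w + \<bar>b\<bar>) / (w\<^sup>2 + b\<^sup>2) + 1 / w"
    show "(F \<longlongrightarrow> 0) at_top"
    proof (rule Lim_null_comparison)
      show "((\<lambda>t. exp (- w * t) * K) \<longlongrightarrow> 0) at_top" using w by real_asymp
      show "\<forall>\<^sub>F t in at_top. norm (F t) \<le> exp (- w * t) * K"
      proof (intro always_eventually allI)
        fix t
        have "\<bar>w * cos (b * t)\<bar> \<le> w" "\<bar>b * sin (b * t)\<bar> \<le> \<bar>b\<bar>"
          using mult_left_mono[OF abs_cos_le_one[of "b * t"], of w]
            mult_left_mono[OF abs_sin_le_one[of "b * t"], of "\<bar>b\<bar>"] w by (simp_all add: abs_mult)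
        hence "\<bar>w * cos (b * t) - b * sin (b * t)\<bar> \<le> w + \<bar>b\<bar>" by linarith
        hence "\<bar>(w * cos (b * t) - b * sin (b * t)) / (w\<^sup>2 + b\<^sup>2)\<bar> \<le> (w + \<bar>b\<bar>) / (w\<^sup>2 + b\<^sup>2)"
          using p by (simp add: divide_right_mono)
        moreover have "\<bar>1 / w\<bar> = 1 / w" using w by simp
        ultimately have "\<bar>(w * cos (b * t) - b * sin (b * t)) / (w\<^sup>2 + b\<^sup>2) - 1 / w\<bar> \<le> K"
          unfolding K_def by linarith
        thus "norm (F t) \<le> exp (- w * t) * K" by (simp add: F_def abs_mult)
      qed
    qed
  qed auto
  also have "(\<integral>\<^sup>+t. ennreal (exp (- w * t) * (1 - cos (b * t))) * indicator {0..} t \<partial>lborel) =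
    (\<integral>\<^sup>+t. ennreal (indicator {0..} t * (exp (- w * t) * (1 - cos (b * t)))) \<partial>lborel)"
    by (intro nn_integral_cong) (auto simp: indicator_def)
  also have "0 - F 0 = b\<^sup>2 / (w * (w\<^sup>2 + b\<^sup>2))" using w p by (simp add: F_def field_simps power2_eq_square)
  finally show "(\<integral>\<^sup>+t. ennreal (indicator {0..} t * (exp (- w * t) * (1 - cos (b * t)))) \<partial>lborel) = ennreal (b\<^sup>2 / (w * (w\<^sup>2 + b\<^sup>2)))" .
  show "b\<^sup>2 / (w * (w\<^sup>2 + b\<^sup>2)) \<ge> 0" using w p by simp
qed auto

section \<open>Signs from Laplace transforms\<close>

text \<open>Under x = \<open>exp (- t)\<close> the signed weight \<open>J\<close> has nonnegative
  integral against polynomials nonnegative on [0, 1], hence by density against a tent around exp (-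
  t0). If H were negative at t0, a narrow tent would make that integrand nonpositive and negative on
  an interval.\<close>

lemma nonneg_if_laplace_nonneg:
  fixes H :: "real \<Rightarrow> real"
  assumes cont: "continuous_on {0..} H"
    and int: "integrable lborel (\<lambda>t. indicator {0..} t * (exp (- t) * H t))"
    and pos: "\<And>p. real_polynomial_function p \<Longrightarrow> (\<And>x. x \<in> {0..1} \<Longrightarrow> p x \<ge> 0) \<Longrightarrow>
      (LINT t|lborel. indicator {0..} t * (exp (- t) * H t) * p (exp (- t))) \<ge> 0"
    and t0: "t0 \<ge> 0"
  shows "H t0 \<ge> 0"
proof (rule ccontr)
  assume "\<not> H t0 \<ge> 0"
  hence neg: "H t0 < 0" by simp
  define J where "J t = indicator {0..} t * (exp (- t) * H t)" for t :: real
  have intJ: "integrable lborel J" unfolding J_def[abs_def] by (rule int)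
  obtain d where d: "d > 0" "\<And>t. t \<ge> 0 \<Longrightarrow> \<bar>t - t0\<bar> < d \<Longrightarrow> H t < 0"
  proof -
    have "eventually (\<lambda>t. H t < 0) (at t0 within {0..})"
      using cont t0 neg by (intro order_tendstoD(2)[of H "H t0"]) (auto simp: continuous_on_def)
    then obtain d where "d > 0" "\<And>t. t \<in> {0..} \<Longrightarrow> t \<noteq> t0 \<Longrightarrow> dist t t0 < d \<Longrightarrow> H t < 0"
      unfolding eventually_at by blast
    thus ?thesis using that[of d] neg by (auto simp: dist_real_def)
  qed
  define x0 where "x0 = exp (- t0)"
  \<comment> \<open>The distance from exp (- t0) to exp (- t0 - d), so that x within it of exp (-
    t0) forces |t - t0| < d.\<close>
  define \<eta> where "\<eta> = x0 * (1 - exp (- d))"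
  have \<eta>: "\<eta> > 0" using d by (simp add: \<eta>_def x0_def)
  have near: "\<bar>t - t0\<bar> < d" if "\<bar>exp (- t) - x0\<bar> < \<eta>" for t
  proof -
    have e1: "exp (- t) > x0 * exp (- d)" using that by (simp add: \<eta>_def algebra_simps abs_less_iff)
    have "exp (- t) < x0 + x0 * (1 - exp (- d))" using that by (simp add: \<eta>_def abs_less_iff)
    also have "\<dots> = x0 * (2 - exp (- d))" by (simp add: algebra_simps)
    \<comment> \<open>The interval is symmetric in x but not in t; the other end is covered by exp d
      + exp (- d) >= 2.\<close>
    also have "\<dots> \<le> x0 * exp d"
    proof (rule mult_left_mono)
      have "0 \<le> (exp (d / 2) - exp (- d / 2))\<^sup>2" by simp
      also have "\<dots> = exp d + exp (- d) - 2" by (simp add: power2_diff exp_add[symmetric] flip: exp_double)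
      finally show "2 - exp (- d) \<le> exp d" by simp
    qed (simp add: x0_def)
    finally have e2: "exp (- t) < x0 * exp d" .
    have "exp (- t) > exp (- t0 - d)" "exp (- t) < exp (- t0 + d)"
      using e1 e2 by (simp_all add: x0_def exp_add[symmetric] exp_diff exp_minus field_simps)
    thus ?thesis by auto
  qed
  define b where "b x = max 0 (\<eta> - \<bar>x - x0\<bar>)" for x
  have contb: "continuous_on A b" for A unfolding b_def by (intro continuous_intros)
  have b_bound: "0 \<le> b x" "b x \<le> \<eta>" for x using \<eta> by (auto simp: b_def)
  have contr: "continuous_on UNIV (\<lambda>t. q (exp (- t)))" if "continuous_on UNIV q" for q :: "real \<Rightarrow> real"
    by (rule continuous_on_compose2[OF that]) (auto intro!: continuous_intros)
  have int_mult: "integrable lborel (\<lambda>t. J t * q (exp (- t)))" if q: "continuous_on UNIV q" for q :: "real \<Rightarrow> real"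
  proof -
    obtain B where B: "\<And>x. x \<in> {0..1} \<Longrightarrow> \<bar>q x\<bar> \<le> B"
      using compact_continuous_image[OF continuous_on_subset[OF q] compact_Icc, of 0 1, THEN compact_imp_bounded]
      by (force simp: bounded_iff)
    show ?thesis
    proof (rule Bochner_Integration.integrable_bound)
      show "integrable lborel (\<lambda>t. B * \<bar>J t\<bar>)" using intJ by simp
      have "(\<lambda>t. q (exp (- t))) \<in> borel_measurable borel"
        using contr[OF q] by (rule borel_measurable_continuous_onI)
      thus "(\<lambda>t. J t * q (exp (- t))) \<in> borel_measurable lborel"
        using intJ by auto
      show "AE t in lborel. norm (J t * q (exp (- t))) \<le> norm (B * \<bar>J t\<bar>)"
      proof (rule AE_I2)
        fix t :: real
        show "norm (J t * q (exp (- t))) \<le> norm (B * \<bar>J t\<bar>)"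
        proof (cases "t \<ge> 0")
          case True
          hence "\<bar>J t\<bar> * \<bar>q (exp (- t))\<bar> \<le> \<bar>J t\<bar> * B" by (intro mult_left_mono B) auto
          also have "\<dots> \<le> \<bar>B\<bar> * \<bar>J t\<bar>" by (simp add: mult.commute mult_right_mono)
          finally show ?thesis by (simp add: abs_mult)
        qed (simp add: J_def)
      qed
    qed
  qed
  define I where "I = (LINT t|lborel. J t * b (exp (- t)))"
  define N where "N = (LINT t|lborel. \<bar>J t\<bar>)"
  have N0: "N \<ge> 0" by (simp add: N_def)
  have I_ge: "I \<ge> - (2 * e * N)" if e: "e > 0" for e
  proof -
    obtain p where p: "real_polynomial_function p" "\<And>x. x \<in> {0..1} \<Longrightarrow> \<bar>b x - p x\<bar> < e"
      using Stone_Weierstrass_real_polynomial_function[OF compact_Icc contb e] by blast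
    \<comment> \<open>Raising the approximant by \<open>e\<close> makes it nonnegative on [0, 1] and
      at most doubles the error.\<close>
    define q where "q x = p x + e" for x
    have q: "real_polynomial_function q"
      unfolding q_def[abs_def] using p(1)
      by (intro real_polynomial_function.intros(2,3))
    have contq: "continuous_on UNIV q"
      using q continuous_on_polymonial_function real_polynomial_function_eq by auto
    have qb: "\<bar>q x - b x\<bar> \<le> 2 * e" and q0: "q x \<ge> 0" if "x \<in> {0..1}" for x
      using p(2)[OF that] b_bound(1)[of x] by (auto simp: q_def)
    have "0 \<le> (LINT t|lborel. J t * q (exp (- t)))"
      unfolding J_def by (rule pos[OF q q0])
    also have "\<dots> = I + (LINT t|lborel. J t * (q (exp (- t)) - b (exp (- t))))"
      unfolding I_def using int_mult[OF contq] int_mult[OF contb]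
      by (subst Bochner_Integration.integral_add[symmetric])
         (auto simp: algebra_simps intro!: Bochner_Integration.integrable_diff)
    also have "(LINT t|lborel. J t * (q (exp (- t)) - b (exp (- t)))) \<le> (LINT t|lborel. 2 * e * \<bar>J t\<bar>)"
    proof (rule integral_mono)
      show "integrable lborel (\<lambda>t. J t * (q (exp (- t)) - b (exp (- t))))"
        using int_mult[OF contq] int_mult[OF contb] by (auto simp: algebra_simps intro!: Bochner_Integration.integrable_diff)
      show "integrable lborel (\<lambda>t. 2 * e * \<bar>J t\<bar>)" using intJ by simp
      show "J t * (q (exp (- t)) - b (exp (- t))) \<le> 2 * e * \<bar>J t\<bar>" for t
      proof (cases "t \<ge> 0")
        case True
        hence "\<bar>J t\<bar> * \<bar>q (exp (- t)) - b (exp (- t))\<bar> \<le> \<bar>J t\<bar> * (2 * e)" by (intro mult_left_mono qb) auto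
        thus ?thesis unfolding abs_mult[symmetric] by (simp add: mult_ac)
      qed (simp add: J_def)
    qed
    also have "(LINT t|lborel. 2 * e * \<bar>J t\<bar>) = 2 * e * N" by (simp add: N_def)
    finally show ?thesis by simp
  qed
  have "I \<ge> 0"
  proof (rule ccontr)
    assume "\<not> I \<ge> 0"
    define e where "e = - I / (4 * (N + 1))"
    have e: "e > 0" unfolding e_def using \<open>\<not> I \<ge> 0\<close> N0 by (intro divide_pos_pos) auto
    have "2 * e * N \<le> 2 * e * (N + 1)" using e by simp
    also have "\<dots> = - I / 2" using N0 by (simp add: e_def field_simps)
    finally show False using I_ge[OF e] \<open>\<not> I \<ge> 0\<close> by simp
  qed
  have Jb: "- (J t * b (exp (- t))) \<ge> 0" for t
  proof (cases "t \<ge> 0 \<and> \<bar>exp (- t) - x0\<bar> < \<eta>")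
    case True
    hence "H t < 0" using d(2) near by blast
    hence "J t \<le> 0" using True by (auto simp: J_def mult_nonneg_nonpos)
    thus ?thesis using b_bound(1) by (simp add: mult_nonpos_nonneg)
  qed (auto simp: J_def b_def max_def)
  have "(LINT t|lborel. - (J t * b (exp (- t)))) = 0"
    using \<open>I \<ge> 0\<close> Bochner_Integration.integral_nonneg[of lborel "\<lambda>t. - (J t * b (exp (- t)))"] Jb
    by (simp add: I_def)
  hence AE: "AE t in lborel. - (J t * b (exp (- t))) = 0"
    using int_mult[OF contb] Jb by (subst (asm) integral_nonneg_eq_0_iff_AE) auto
  \<comment> \<open>Only the right side of t0 is used, so the interval stays in t >= 0 even for t0 =
    0.\<close>
  have near': "eventually (\<lambda>t. \<bar>exp (- t) - x0\<bar> < \<eta>) (at_right t0)"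
  proof -
    have "((\<lambda>t. \<bar>exp (- t) - x0\<bar>) \<longlongrightarrow> \<bar>exp (- t0) - x0\<bar>) (at_right t0)" by (intro tendsto_intros)
    thus ?thesis using \<eta> by (intro order_tendstoD(2)) (auto simp: x0_def)
  qed
  then obtain t1 where t1: "t1 > t0" "\<And>t. t0 < t \<Longrightarrow> t < t1 \<Longrightarrow> \<bar>exp (- t) - x0\<bar> < \<eta>"
    unfolding eventually_at_right_field by blast
  have "AE t in lborel. t \<notin> {t0<..<t1}"
    using AE
  proof eventually_elim
    case (elim t)
    show ?case
    proof
      assume t: "t \<in> {t0<..<t1}"
      hence n: "\<bar>exp (- t) - x0\<bar> < \<eta>" and "t \<ge> 0" using t1 t0 by auto
      hence "H t < 0" using d(2) near by blast
      hence "J t < 0" using \<open>t \<ge> 0\<close> by (simp add: J_def mult_pos_neg)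
      moreover have "b (exp (- t)) > 0" using n by (simp add: b_def)
      ultimately show False using elim by simp
    qed
  qed
  hence "{t0<..<t1} \<in> null_sets lborel" by (subst AE_iff_null_sets) auto
  hence "emeasure lborel {t0<..<t1} = 0" by auto
  thus False using t1(1) by simp
qed


text \<open>Against the weight \<open>exp (- t)\<close> the monomial x^i becomes exp (- (i + 1) t),
  so a polynomial test involves finitely many transforms at positive integers, and convergence at
  each of them carries nonnegativity to the limit.\<close>

lemma nonneg_if_laplace_limit_nonneg:
  fixes H :: "real \<Rightarrow> real" and G :: "nat \<Rightarrow> real \<Rightarrow> real"
  assumes cont: "continuous_on {0..} H"
    and G: "\<And>n k. has_bochner_integral lborel (\<lambda>t. indicator {0..} t * (exp (- real (Suc k) * t) * G n t)) (a n k)"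
    and H: "\<And>k. has_bochner_integral lborel (\<lambda>t. indicator {0..} t * (exp (- real (Suc k) * t) * H t)) (b k)"
    and lim: "\<And>k. (\<lambda>n. a n k) \<longlonglongrightarrow> b k" and nonneg: "\<And>n t. G n t \<ge> 0" and t: "t \<ge> 0"
  shows "H t \<ge> 0"
proof (rule nonneg_if_laplace_nonneg[OF cont _ _ t])
  show "integrable lborel (\<lambda>t. indicator {0..} t * (exp (- t) * H t))"
    using H[of 0] by (simp add: has_bochner_integral_iff)
  fix p :: "real \<Rightarrow> real" assume p: "real_polynomial_function p" "\<And>x. x \<in> {0..1} \<Longrightarrow> p x \<ge> 0"
  obtain c d where pc: "p = (\<lambda>x. \<Sum>i\<le>d. c i * x ^ i)"
    using p(1) unfolding real_polynomial_function_iff_sum by blast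
  have val: "(LINT t|lborel. indicator {0..} t * (exp (- t) * F t) * p (exp (- t))) = (\<Sum>i\<le>d. c i * v i)"
    if F: "\<And>k. has_bochner_integral lborel (\<lambda>t. indicator {0..} t * (exp (- real (Suc k) * t) * F t)) (v k)" for F :: "real \<Rightarrow> real" and v
  proof -
    have "has_bochner_integral lborel (\<lambda>t. \<Sum>i\<le>d. c i * (indicator {0..} t * (exp (- real (Suc i) * t) * F t))) (\<Sum>i\<le>d. c i * v i)"
      by (intro has_bochner_integral_sum has_bochner_integral_mult_right F)
    also have "(\<lambda>t. \<Sum>i\<le>d. c i * (indicator {0..} t * (exp (- real (Suc i) * t) * F t))) =
      (\<lambda>t. indicator {0..} t * (exp (- t) * F t) * p (exp (- t)))"
    proof
      fix t
      have "exp (- real (Suc i) * t) = exp (- t) * exp (- t) ^ i" for i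
        by (simp add: exp_of_nat_mult[symmetric] exp_add[symmetric] algebra_simps)
      thus "(\<Sum>i\<le>d. c i * (indicator {0..} t * (exp (- real (Suc i) * t) * F t))) = indicator {0..} t * (exp (- t) * F t) * p (exp (- t))"
        by (simp add: pc sum_distrib_left mult_ac)
    qed
    finally show ?thesis by (simp add: has_bochner_integral_iff)
  qed
  have "(\<lambda>n. \<Sum>i\<le>d. c i * a n i) \<longlonglongrightarrow> (\<Sum>i\<le>d. c i * b i)" by (intro tendsto_intros lim)
  moreover have "(\<Sum>i\<le>d. c i * a n i) \<ge> 0" for n
    unfolding val[OF G, symmetric]
    by (intro Bochner_Integration.integral_nonneg) (auto simp: indicator_def intro!: mult_nonneg_nonneg nonneg p(2))
  ultimately have "(\<Sum>i\<le>d. c i * b i) \<ge> 0" by (intro LIMSEQ_le_const) auto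
  thus "0 \<le> (LINT t|lborel. indicator {0..} t * (exp (- t) * H t) * p (exp (- t)))"
    by (simp only: val[OF H])
qed

lemma has_bochner_integral_sum_list:
  fixes f :: "'b \<Rightarrow> 'a \<Rightarrow> real"
  assumes "\<And>r. r \<in> set rs \<Longrightarrow> has_bochner_integral M (f r) (a r)"
  shows "has_bochner_integral M (\<lambda>x. \<Sum>r\<leftarrow>rs. f r x) (\<Sum>r\<leftarrow>rs. a r)"
  using assms by (induction rs) (auto intro!: has_bochner_integral_add has_bochner_integral_zero)

lemma of_real_sum_list: "of_real (\<Sum>r\<leftarrow>rs. f r) = (\<Sum>r\<leftarrow>rs. of_real (f r))"
  by (induction rs) auto

lemma bounded_if_riemann_hypothesis:
  assumes rh: riemann_hypothesis
  shows "bounded (Psi ` {0..})"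
proof -
  obtain rs where rs: "\<And>n r. r \<in> set (rs n) \<Longrightarrow> Xi r = 0"
    "\<And>z. Xi z \<noteq> 0 \<Longrightarrow> (\<lambda>n. \<Sum>r\<leftarrow>rs n. 1 / (z - r)) \<longlonglongrightarrow> deriv Xi z / Xi z"
    using Xi_logderiv_approx by metis
  \<comment> \<open>A zero-free disc around 0; it will bound 1 / \<open>\<rho>\<close> by a multiple
    of 1 / (1 + \<open>\<rho>\<close>).\<close>
  obtain \<delta> where \<delta>: "\<delta> > 0" "\<And>z. norm z < \<delta> \<Longrightarrow> Xi z \<noteq> 0"
  proof -
    have "isCont Xi 0"
      using holomorphic_on_imp_continuous_on[OF Xi_holomorphic[of UNIV]] by (simp add: continuous_on_eq_continuous_at)
    hence "eventually (\<lambda>z. Xi z \<noteq> 0) (at 0)"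
      using Xi_0_nonzero unfolding isCont_def by (rule tendsto_imp_eventually_ne)
    then obtain d where "d > 0" "\<And>z. z \<noteq> 0 \<Longrightarrow> dist z 0 < d \<Longrightarrow> Xi z \<noteq> 0"
      unfolding eventually_at by auto
    thus ?thesis using that[of d] Xi_0_nonzero by (metis dist_0_norm dist_commute)
  qed
  define ps where "ps n = map (\<lambda>r. - Re r) (rs n)" for n
  have rp: "r = - of_real (- Re r) \<and> - Re r \<ge> \<delta>" if r: "r \<in> set (rs n)" for r n
  proof -
    obtain \<rho> where \<rho>: "\<rho> > 0" "r = - of_real \<rho>"
      using Xi_zero_if_riemann_hypothesis[OF rh rs(1)[OF r]] by blast
    have "\<not> norm r < \<delta>" using \<delta>(2) rs(1)[OF r] by blast
    thus ?thesis using \<rho> by simp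
  qed
  have ps: "\<rho> \<ge> \<delta>" if "\<rho> \<in> set (ps n)" for \<rho> n using that rp by (auto simp: ps_def)
  define S where "S n x = (\<Sum>\<rho>\<leftarrow>ps n. 1 / (x + \<rho>))" for n x
  have S_eq: "(\<Sum>r\<leftarrow>rs n. 1 / (of_real x - r)) = complex_of_real (S n x)" for n x
  proof -
    have "(\<Sum>r\<leftarrow>rs n. 1 / (of_real x - r)) = (\<Sum>r\<leftarrow>rs n. complex_of_real (1 / (x + - Re r)))"
    proof (intro arg_cong[of _ _ sum_list] map_cong refl)
      fix r assume "r \<in> set (rs n)"
      hence "r = of_real (Re r)" using rp by fastforce
      thus "1 / (of_real x - r) = complex_of_real (1 / (x + - Re r))" by (metis of_real_1 of_real_diff of_real_divide diff_conv_add_uminus)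
    qed
    also have "\<dots> = complex_of_real (\<Sum>r\<leftarrow>rs n. 1 / (x + - Re r))"
      by (rule sym, rule of_real_sum_list[where f = "\<lambda>r. 1 / (x + - Re r)"])
    also have "\<dots> = complex_of_real (S n x)" unfolding S_def ps_def by (simp add: o_def)
    finally show ?thesis .
  qed
  have S_lim: "(\<lambda>n. 2 / w * S n (w\<^sup>2)) \<longlonglongrightarrow> xi_logderiv (w + 1/2) / w\<^sup>2" if w: "w > 1/2" for w
  proof -
    have nz: "Xi (of_real (w\<^sup>2)) \<noteq> 0"
      unfolding Xi_of_real_square[OF w] using xi_real_pos[of "w + 1/2"] w by simp
    have "(\<lambda>n. complex_of_real (S n (w\<^sup>2))) \<longlonglongrightarrow> deriv Xi (of_real (w\<^sup>2)) / Xi (of_real (w\<^sup>2))"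
      using rs(2)[OF nz] unfolding S_eq .
    also have "deriv Xi (of_real (w\<^sup>2)) / Xi (of_real (w\<^sup>2)) = complex_of_real (xi_logderiv (w + 1/2) / (2 * w))"
      using xi_real_logderiv_Xi[OF w] w by (simp add: field_simps)
    finally have "(\<lambda>n. S n (w\<^sup>2)) \<longlonglongrightarrow> xi_logderiv (w + 1/2) / (2 * w)" by (simp only: tendsto_of_real_iff)
    hence "(\<lambda>n. 2 / w * S n (w\<^sup>2)) \<longlonglongrightarrow> 2 / w * (xi_logderiv (w + 1/2) / (2 * w))" by (intro tendsto_intros)
    thus ?thesis using w by (simp add: power2_eq_square)
  qed
  \<comment> \<open>Convergence at w = 1 bounds the sums of 1 / (1 + \<open>\<rho>\<close>), and
    with \<open>\<rho>\<close> >= \<open>\<delta>\<close> also those of 1 / \<open>\<rho>\<close>,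
    uniformly in n.\<close>
  obtain K where K: "\<And>n. (\<Sum>\<rho>\<leftarrow>ps n. 1 / \<rho>) \<le> K"
  proof -
    have "Bseq (\<lambda>n. 2 / 1 * S n (1\<^sup>2))" using S_lim[of 1] by (intro convergent_imp_Bseq convergentI) auto
    then obtain B where B: "\<And>n. \<bar>2 * S n 1\<bar> \<le> B" by (auto simp: Bseq_def)
    have "(\<Sum>\<rho>\<leftarrow>ps n. 1 / \<rho>) \<le> (1 + 1 / \<delta>) * B" for n
    proof -
      have "(\<Sum>\<rho>\<leftarrow>ps n. 1 / \<rho>) \<le> (\<Sum>\<rho>\<leftarrow>ps n. (1 + 1 / \<delta>) * (1 / (1 + \<rho>)))"
      proof (rule sum_list_mono)
        fix \<rho> assume "\<rho> \<in> set (ps n)"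
        hence \<rho>: "\<rho> \<ge> \<delta>" "\<rho> > 0" using ps \<delta>(1) by force+
        have "1 / \<rho> = (1 + 1 / \<rho>) * (1 / (1 + \<rho>))" using \<rho> by (simp add: field_simps)
        also have "\<dots> \<le> (1 + 1 / \<delta>) * (1 / (1 + \<rho>))"
          using \<rho> \<delta>(1) by (intro mult_right_mono add_left_mono divide_left_mono) auto
        finally show "1 / \<rho> \<le> (1 + 1 / \<delta>) * (1 / (1 + \<rho>))" .
      qed
      also have "\<dots> = (1 + 1 / \<delta>) * S n 1" by (simp only: S_def sum_list_const_mult)
      also have "\<dots> \<le> (1 + 1 / \<delta>) * B" using B[of n] \<delta>(1) by (intro mult_left_mono) auto
      finally show ?thesis .
    qed
    thus ?thesis using that by blast
  qed
  \<comment> \<open>Partial sums of the expected expansion; 0 <= 1 - cos <= 2 and the bound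
    \<open>K\<close> confine them to [0, 4 K].\<close>
  define g where "g n t = (\<Sum>\<rho>\<leftarrow>ps n. 2 / \<rho> * (1 - cos (sqrt \<rho> * t)))" for n t
  have g_nonneg: "g n t \<ge> 0" for n t
    unfolding g_def
  proof (rule sum_list_nonneg)
    fix x assume "x \<in> set (map (\<lambda>\<rho>. 2 / \<rho> * (1 - cos (sqrt \<rho> * t))) (ps n))"
    then obtain \<rho> where "\<rho> \<in> set (ps n)" "x = 2 / \<rho> * (1 - cos (sqrt \<rho> * t))" by auto
    thus "x \<ge> 0" using ps[of \<rho> n] \<delta>(1) by simp
  qed
  have g_le: "g n t \<le> 4 * K" for n t
  proof -
    have "g n t \<le> (\<Sum>\<rho>\<leftarrow>ps n. 4 * (1 / \<rho>))"
      unfolding g_def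
    proof (rule sum_list_mono)
      fix \<rho> assume "\<rho> \<in> set (ps n)"
      hence "\<rho> > 0" using ps \<delta>(1) by force
      moreover have "1 - cos (sqrt \<rho> * t) \<le> 2" using cos_ge_minus_one[of "sqrt \<rho> * t"] by linarith
      ultimately have "2 / \<rho> * (1 - cos (sqrt \<rho> * t)) \<le> 2 / \<rho> * 2" by (intro mult_left_mono) auto
      thus "2 / \<rho> * (1 - cos (sqrt \<rho> * t)) \<le> 4 * (1 / \<rho>)" by simp
    qed
    also have "\<dots> = 4 * (\<Sum>\<rho>\<leftarrow>ps n. 1 / \<rho>)" by (simp only: sum_list_const_mult)
    finally show ?thesis using K[of n] by simp
  qed
  have g_laplace: "has_bochner_integral lborel (\<lambda>t. indicator {0..} t * (exp (- w * t) * g n t)) (2 / w * S n (w\<^sup>2))"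
    if w: "w > 0" for w n
  proof -
    have "has_bochner_integral lborel (\<lambda>t. \<Sum>\<rho>\<leftarrow>ps n. 2 / \<rho> * (indicator {0..} t * (exp (- w * t) * (1 - cos (sqrt \<rho> * t)))))
       (\<Sum>\<rho>\<leftarrow>ps n. 2 / \<rho> * ((sqrt \<rho>)\<^sup>2 / (w * (w\<^sup>2 + (sqrt \<rho>)\<^sup>2))))"
      by (intro has_bochner_integral_sum_list has_bochner_integral_mult_right has_bochner_integral_laplace_1_minus_cos w)
    also have "(\<lambda>t. \<Sum>\<rho>\<leftarrow>ps n. 2 / \<rho> * (indicator {0..} t * (exp (- w * t) * (1 - cos (sqrt \<rho> * t))))) =
       (\<lambda>t. indicator {0..} t * (exp (- w * t) * g n t))"
    proof
      fix t
      have "indicator {0..} t * (exp (- w * t) * g n t) =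
          (\<Sum>\<rho>\<leftarrow>ps n. indicator {0..} t * (exp (- w * t) * (2 / \<rho> * (1 - cos (sqrt \<rho> * t)))))"
        by (simp only: g_def sum_list_const_mult)
      also have "\<dots> = (\<Sum>\<rho>\<leftarrow>ps n. 2 / \<rho> * (indicator {0..} t * (exp (- w * t) * (1 - cos (sqrt \<rho> * t)))))"
        by (intro arg_cong[of _ _ sum_list] map_cong refl) (simp only: mult_ac)
      finally show "(\<Sum>\<rho>\<leftarrow>ps n. 2 / \<rho> * (indicator {0..} t * (exp (- w * t) * (1 - cos (sqrt \<rho> * t))))) =
          indicator {0..} t * (exp (- w * t) * g n t)" by (rule sym)
    qed
    also have "(\<Sum>\<rho>\<leftarrow>ps n. 2 / \<rho> * ((sqrt \<rho>)\<^sup>2 / (w * (w\<^sup>2 + (sqrt \<rho>)\<^sup>2)))) = (\<Sum>\<rho>\<leftarrow>ps n. 2 / w * (1 / (w\<^sup>2 + \<rho>)))"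
    proof (intro arg_cong[of _ _ sum_list] map_cong refl)
      fix \<rho> assume "\<rho> \<in> set (ps n)"
      hence "\<rho> > 0" using ps \<delta>(1) by force
      thus "2 / \<rho> * ((sqrt \<rho>)\<^sup>2 / (w * (w\<^sup>2 + (sqrt \<rho>)\<^sup>2))) = 2 / w * (1 / (w\<^sup>2 + \<rho>))" by simp
    qed
    also have "\<dots> = 2 / w * S n (w\<^sup>2)" by (simp only: sum_list_const_mult S_def)
    finally show ?thesis .
  qed
  define H where "H t = Psi t + Psi_shift" for t
  have contH: "continuous_on {0..} H" unfolding H_def[abs_def] by (intro continuous_intros continuous_on_Psi)
  define b where "b k = xi_logderiv (real (Suc k) + 1/2) / (real (Suc k))\<^sup>2" for k
  have H_laplace: "has_bochner_integral lborel (\<lambda>t. indicator {0..} t * (exp (- real (Suc k) * t) * H t)) (b k)" for k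
    unfolding H_def b_def by (rule laplace_Psi) simp
  have lim: "(\<lambda>n. 2 / real (Suc k) * S n ((real (Suc k))\<^sup>2)) \<longlonglongrightarrow> b k" for k
    unfolding b_def by (rule S_lim) simp
  have H_nonneg: "H t \<ge> 0" if "t \<ge> 0" for t
    by (rule nonneg_if_laplace_limit_nonneg[OF contH g_laplace H_laplace lim g_nonneg that]) simp
  have const: "has_bochner_integral lborel (\<lambda>t. 4 * K * (indicator {0..} t * exp (- real (Suc k) * t))) (4 * K * (1 / real (Suc k)))" for k
    by (intro has_bochner_integral_mult_right has_bochner_integral_exp_minus) simp
  have compl: "has_bochner_integral lborel (\<lambda>t. indicator {0..} t * (exp (- real (Suc k) * t) * (4 * K - F t))) (4 * K * (1 / real (Suc k)) - v)"
    if "has_bochner_integral lborel (\<lambda>t. indicator {0..} t * (exp (- real (Suc k) * t) * F t)) v" for F v k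
    using has_bochner_integral_diff[OF const[of k] that] by (simp add: algebra_simps)
  \<comment> \<open>The upper bound is the same positivity argument applied to the complements 4 K -
    g and 4 K - H.\<close>
  have "4 * K - H t \<ge> 0" if "t \<ge> 0" for t
  proof (rule nonneg_if_laplace_limit_nonneg[where H = "\<lambda>t. 4 * K - H t" and G = "\<lambda>n t. 4 * K - g n t", OF _ compl[OF g_laplace] compl[OF H_laplace] _ _ that])
    show "continuous_on {0..} (\<lambda>t. 4 * K - H t)" by (intro continuous_intros contH)
    show "(\<lambda>n. 4 * K * (1 / real (Suc k)) - 2 / real (Suc k) * S n ((real (Suc k))\<^sup>2)) \<longlonglongrightarrow> 4 * K * (1 / real (Suc k)) - b k" for k
      by (intro tendsto_intros lim)
    show "0 \<le> 4 * K - g n t" for n t using g_le by simp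
  qed simp
  hence "norm (Psi t) \<le> 4 * K + \<bar>Psi_shift\<bar>" if "t \<ge> 0" for t
    using H_nonneg[OF that] that unfolding H_def by (fastforce simp: abs_le_iff)
  thus ?thesis unfolding bounded_iff by blast
qed

theorem theorem1p6:
  shows "riemann_hypothesis \<longleftrightarrow> bounded (Psi ` {0..})"
  using bounded_if_riemann_hypothesis riemann_hypothesis_if_bounded by blast

end
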